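(* Let $d\ge2$ be an integer, let $X$ be a Banach space and let $T\in L(X)$. Suppose that some power $T^M$ ($M\in\mathbb N$, $M\ge1$) of $T$ is nuclear. Then the spectrum of $T$ is $\mathbb Z_d$-symmetric if and only if there is an integer $K\ge0$ such that for every $l>Kd$ the value $\operatorname{trace} T^l$ is well defined and $\operatorname{trace} T^{kd+r}=0$ for all $k=K,K+1,K+2,\dots$ and $r=1,2,\dots,d-1$.
   Context: Banach spaces are complex; $L(X)$ is the space of bounded linear operators on $X$. For a Banach space $X$ and $0<s\le1$, $X^*\widehat\otimes_s X$ is the set of elements $u$ of the projective tensor product $X^*\widehat\otimes X$ admitting a representation $u=\sum_{k=1}^\infty x'_k\otimes x_k$ with $\sum_k\|x'_k\|^s\|x_k\|^s<\infty$. Each $u=\sum_k x'_k\otimes x_k$ generates the operator $\widetilde u(x)=\sum_k\langle x'_k,x\rangle x_k$; the operators $\widetilde u$ with $u\in X^*\widehat\otimes_s X$ are called $s$-nuclear and form the space $N_s(X)$; nuclear means $1$-nuclear. $X$ has the property $AP_s$ if the map $u\mapsto\widetilde u$ is injective on $X^*\widehat\otimes_s X$. Every Banach space has $AP_{2/3}$ (Grothendieck). The functional $\operatorname{trace}$ on $X^*\widehat\otimes X$ is the continuous linear extension of $x'\otimes x\mapsto\langle x',x\rangle$. For $S\in L(X)$, $\operatorname{trace} S$ is well defined if $S\in N_s(X)$ for some $s\in(0,1]$ such that $X$ has $AP_s$; then $\operatorname{trace} S:=\operatorname{trace} u$ for the unique $u\in X^*\widehat\otimes_s X$ with $\widetilde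 u=S$ (the value is independent of the choice of such $s$). Since some power of $T$ is nuclear, all nonzero spectral values of $T$ are eigenvalues of finite algebraic multiplicity with no limit point except possibly zero. The spectrum of such an operator is called $\mathbb Z_d$-symmetric if for every nonzero eigenvalue $\lambda$ of $T$ and every $t\in\mathbb C$ with $t^d=1$, the number $t\lambda$ is also an eigenvalue of $T$, of the same algebraic multiplicity. *)

theory Defs
  imports "HOL-Analysis.Analysis"
begin

section \<open>Complex Banach spaces\<close>

class complex_vector = real_vector +
  fixes scaleC :: "complex \<Rightarrow> 'a \<Rightarrow> 'a"  (infixr "*\<^sub>C" 75)
  assumes scaleC_add_right: "a *\<^sub>C (x + y) = a *\<^sub>C x + a *\<^sub>C y"
    and scaleC_add_left: "(a + b) *\<^sub>C x = a *\<^sub>C x + b *\<^sub>C x"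
    and scaleC_scaleC: "a *\<^sub>C b *\<^sub>C x = (a * b) *\<^sub>C x"
    and scaleC_one: "1 *\<^sub>C x = x"
    and scaleR_scaleC: "r *\<^sub>R x = complex_of_real r *\<^sub>C x"

class complex_normed_vector = complex_vector + real_normed_vector +
  assumes norm_scaleC: "norm (a *\<^sub>C x) = cmod a * norm x"

class complex_banach = complex_normed_vector + banach

global_interpretation complex_vector: vector_space "scaleC :: complex \<Rightarrow> 'a \<Rightarrow> 'a::complex_vector"
  by standard (simp_all add: scaleC_add_right scaleC_add_left scaleC_scaleC scaleC_one)

instantiation complex :: complex_banach
begin

definition scaleC_complex :: "complex \<Rightarrow> complex \<Rightarrow> complex"
  where "scaleC_complex a x = a * x"

instance
  by standard
    (simp_all add: scaleC_complex_def algebra_simps norm_mult scaleR_conv_of_real)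

end


section \<open>Bounded complex-linear operators\<close>

typedef (overloaded) ('a, 'b) cblinfun  ("(_ \<Rightarrow>\<^sub>C\<^sub>L /_)" [22, 21] 21) =
  "{f :: 'a::complex_normed_vector \<Rightarrow> 'b::complex_normed_vector.
      bounded_linear f \<and> (\<forall>c x. f (c *\<^sub>C x) = c *\<^sub>C f x)}"
  morphisms cblinfun_apply CBlinfun
  by (rule exI[of _ "\<lambda>_. 0"]) simp

setup_lifting type_definition_cblinfun

declare [[coercion
  "cblinfun_apply :: ('a::complex_normed_vector \<Rightarrow>\<^sub>C\<^sub>L 'b::complex_normed_vector) \<Rightarrow> 'a \<Rightarrow> 'b"]]

lemma cblinfun_eqI: "(\<And>x. cblinfun_apply f x = cblinfun_apply g x) \<Longrightarrow> f = g"
  by transfer auto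

instantiation cblinfun :: (complex_normed_vector, complex_normed_vector) complex_normed_vector
begin

lift_definition norm_cblinfun :: "'a \<Rightarrow>\<^sub>C\<^sub>L 'b \<Rightarrow> real" is onorm .

lift_definition minus_cblinfun :: "'a \<Rightarrow>\<^sub>C\<^sub>L 'b \<Rightarrow> 'a \<Rightarrow>\<^sub>C\<^sub>L 'b \<Rightarrow> 'a \<Rightarrow>\<^sub>C\<^sub>L 'b"
  is "\<lambda>f g x. f x - g x"
  by (auto simp: bounded_linear_sub complex_vector.scale_right_diff_distrib)

definition dist_cblinfun :: "'a \<Rightarrow>\<^sub>C\<^sub>L 'b \<Rightarrow> 'a \<Rightarrow>\<^sub>C\<^sub>L 'b \<Rightarrow> real"
  where "dist_cblinfun a b = norm (a - b)"

definition uniformity_cblinfun :: "(('a \<Rightarrow>\<^sub>C\<^sub>L 'b) \<times> ('a \<Rightarrow>\<^sub>C\<^sub>L 'b)) filter"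
  where "uniformity_cblinfun = (INF e\<in>{0 <..}. principal {(x, y). dist x y < e})"

definition open_cblinfun :: "('a \<Rightarrow>\<^sub>C\<^sub>L 'b) set \<Rightarrow> bool"
  where "open_cblinfun S = (\<forall>x\<in>S. \<forall>\<^sub>F (x', y) in uniformity. x' = x \<longrightarrow> y \<in> S)"

lift_definition uminus_cblinfun :: "'a \<Rightarrow>\<^sub>C\<^sub>L 'b \<Rightarrow> 'a \<Rightarrow>\<^sub>C\<^sub>L 'b" is "\<lambda>f x. - f x"
  by (auto simp: bounded_linear_minus)

lift_definition zero_cblinfun :: "'a \<Rightarrow>\<^sub>C\<^sub>L 'b" is "\<lambda>x. 0"
  by auto

lift_definition plus_cblinfun :: "'a \<Rightarrow>\<^sub>C\<^sub>L 'b \<Rightarrow> 'a \<Rightarrow>\<^sub>C\<^sub>L 'b \<Rightarrow> 'a \<Rightarrow>\<^sub>C\<^sub>L 'b"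
  is "\<lambda>f g x. f x + g x"
  by (auto simp: bounded_linear_add scaleC_add_right)

lift_definition scaleC_cblinfun :: "complex \<Rightarrow> 'a \<Rightarrow>\<^sub>C\<^sub>L 'b \<Rightarrow> 'a \<Rightarrow>\<^sub>C\<^sub>L 'b"
  is "\<lambda>c f x. c *\<^sub>C f x"
proof (intro conjI allI)
  fix c :: complex and f :: "'a \<Rightarrow> 'b"
  assume f: "bounded_linear f \<and> (\<forall>c x. f (c *\<^sub>C x) = c *\<^sub>C f x)"
  interpret bounded_linear f using f by simp
  obtain K where K: "\<And>x. norm (f x) \<le> norm x * K" using bounded by blast
  show "bounded_linear (\<lambda>x. c *\<^sub>C f x)"
  proof (rule bounded_linear_intro[where K = "cmod c * K"])
    show "c *\<^sub>C f (x + y) = c *\<^sub>C f x + c *\<^sub>C f y" for x y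
      by (simp add: add scaleC_add_right)
    show "c *\<^sub>C f (r *\<^sub>R x) = r *\<^sub>R (c *\<^sub>C f x)" for r x
      by (subst scaleR) (simp only: scaleR_scaleC scaleC_scaleC mult.commute)
    show "norm (c *\<^sub>C f x) \<le> norm x * (cmod c * K)" for x
      using mult_left_mono[OF K[of x], of "cmod c"] by (simp add: norm_scaleC ac_simps)
  qed
  show "c *\<^sub>C f (b *\<^sub>C x) = b *\<^sub>C c *\<^sub>C f x" for b x
    using f by (simp add: scaleC_scaleC mult.commute)
qed

definition scaleR_cblinfun :: "real \<Rightarrow> 'a \<Rightarrow>\<^sub>C\<^sub>L 'b \<Rightarrow> 'a \<Rightarrow>\<^sub>C\<^sub>L 'b"
  where "scaleR_cblinfun r f = complex_of_real r *\<^sub>C f"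

definition sgn_cblinfun :: "'a \<Rightarrow>\<^sub>C\<^sub>L 'b \<Rightarrow> 'a \<Rightarrow>\<^sub>C\<^sub>L 'b"
  where "sgn_cblinfun x = scaleR (inverse (norm x)) x"

lemma onorm_scaleC:
  fixes f :: "'a \<Rightarrow> 'b"
  assumes f: "bounded_linear f" and cf: "bounded_linear (\<lambda>x. c *\<^sub>C f x)"
  shows "onorm (\<lambda>x. c *\<^sub>C f x) = cmod c * onorm f"
proof (rule antisym)
  have "norm (c *\<^sub>C f x) \<le> cmod c * onorm f * norm x" for x
    using mult_left_mono[OF onorm[OF f, of x], of "cmod c"] by (simp add: norm_scaleC ac_simps)
  then show "onorm (\<lambda>x. c *\<^sub>C f x) \<le> cmod c * onorm f"
    by (intro onorm_bound) (auto simp: onorm_pos_le[OF f])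
next
  show "cmod c * onorm f \<le> onorm (\<lambda>x. c *\<^sub>C f x)"
  proof (cases "c = 0")
    case True
    then show ?thesis by (simp add: onorm_zero)
  next
    case False
    have "norm (f x) \<le> inverse (cmod c) * onorm (\<lambda>x. c *\<^sub>C f x) * norm x" for x
      using onorm[OF cf, of x] False by (simp add: norm_scaleC field_simps)
    then have "onorm f \<le> inverse (cmod c) * onorm (\<lambda>x. c *\<^sub>C f x)"
      by (intro onorm_bound) (auto simp: onorm_pos_le[OF cf])
    with False show ?thesis by (simp add: field_simps)
  qed
qed

lemma norm_scaleC_cblinfun: "norm (c *\<^sub>C f) = cmod c * norm f" for f :: "'a \<Rightarrow>\<^sub>C\<^sub>L 'b"
proof -
  have "bounded_linear (cblinfun_apply (c *\<^sub>C f))" using cblinfun_apply by blast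
  moreover have "bounded_linear (cblinfun_apply f)" using cblinfun_apply by blast
  ultimately show ?thesis
    by (simp add: norm_cblinfun.rep_eq scaleC_cblinfun.rep_eq onorm_scaleC)
qed

instance
proof
  fix a b :: real and c e :: complex and x y z :: "'a \<Rightarrow>\<^sub>C\<^sub>L 'b"
  show "x + y + z = x + (y + z)" "x + y = y + x" "0 + x = x" "- x + x = 0" "x - y = x + - y"
    by (transfer; force)+
  show addr: "c *\<^sub>C (x + y) = c *\<^sub>C x + c *\<^sub>C y"
    by transfer (force simp: scaleC_add_right)
  show addl: "(c + e) *\<^sub>C x = c *\<^sub>C x + e *\<^sub>C x"
    by transfer (force simp: scaleC_add_left)
  show sc: "c *\<^sub>C e *\<^sub>C x = (c * e) *\<^sub>C x"
    by transfer (force simp: scaleC_scaleC)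
  show one: "1 *\<^sub>C x = x"
    by transfer (force simp: scaleC_one)
  show "a *\<^sub>R x = complex_of_real a *\<^sub>C x"
    by (simp add: scaleR_cblinfun_def)
  show "a *\<^sub>R (x + y) = a *\<^sub>R x + a *\<^sub>R y"
    unfolding scaleR_cblinfun_def by transfer (force simp: scaleC_add_right)
  show "(a + b) *\<^sub>R x = a *\<^sub>R x + b *\<^sub>R x"
    unfolding scaleR_cblinfun_def by transfer (force simp: scaleC_add_left)
  show "a *\<^sub>R b *\<^sub>R x = (a * b) *\<^sub>R x"
    unfolding scaleR_cblinfun_def by transfer (force simp: scaleC_scaleC)
  show "1 *\<^sub>R x = x"
    by (simp add: scaleR_cblinfun_def one)
  show "dist x y = norm (x - y)" by (rule dist_cblinfun_def)
  show "sgn x = scaleR (inverse (norm x)) x" by (rule sgn_cblinfun_def)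
  show "uniformity = (INF e\<in>{0<..}. principal {(x, y :: 'a \<Rightarrow>\<^sub>C\<^sub>L 'b). dist x y < e})"
    by (rule uniformity_cblinfun_def)
  show "open U = (\<forall>x\<in>U. \<forall>\<^sub>F (x', y) in uniformity. x' = x \<longrightarrow> y \<in> U)" for U :: "('a \<Rightarrow>\<^sub>C\<^sub>L 'b) set"
    by (rule open_cblinfun_def)
  show "norm x = 0 \<longleftrightarrow> x = 0"
    by transfer (auto simp: onorm_eq_0)
  show "norm (x + y) \<le> norm x + norm y"
    by transfer (auto simp: onorm_triangle)
  show "norm (a *\<^sub>R x) = \<bar>a\<bar> * norm x"
    by (simp add: scaleR_cblinfun_def norm_scaleC_cblinfun)
  show "norm (c *\<^sub>C x) = cmod c * norm x"
    by (rule norm_scaleC_cblinfun)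
qed

end

lemma bounded_linear_cblinfun_apply: "bounded_linear (cblinfun_apply f)"
  using cblinfun_apply by blast

lemma cblinfun_scaleC_right: "cblinfun_apply f (c *\<^sub>C x) = c *\<^sub>C cblinfun_apply f x"
  using cblinfun_apply by blast

lemma norm_cblinfun: "norm (cblinfun_apply f x) \<le> norm f * norm x"
  by transfer (auto simp: onorm)

lemma norm_cblinfun_bound:
  "0 \<le> b \<Longrightarrow> (\<And>x. norm (cblinfun_apply f x) \<le> b * norm x) \<Longrightarrow> norm f \<le> b"
  by transfer (auto simp: onorm_bound)

lemma bounded_linear_cblinfun_eval: "bounded_linear (\<lambda>f. cblinfun_apply f x)"
  by (rule bounded_linear_intro[where K = "norm x"])
    (simp_all add: plus_cblinfun.rep_eq scaleR_cblinfun_def scaleC_cblinfun.rep_eq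
      scaleR_scaleC norm_cblinfun)

lemma tendsto_scaleC:
  fixes f :: "'c \<Rightarrow> 'a::complex_normed_vector"
  assumes "(f \<longlongrightarrow> l) F"
  shows "((\<lambda>n. c *\<^sub>C f n) \<longlongrightarrow> c *\<^sub>C l) F"
proof -
  have "bounded_linear (\<lambda>x :: 'a. c *\<^sub>C x)"
    by (rule bounded_linear_intro[where K = "cmod c"])
      (simp_all add: scaleC_add_right scaleR_scaleC scaleC_scaleC norm_scaleC mult.commute)
  then show ?thesis using assms by (rule bounded_linear.tendsto)
qed

instance cblinfun :: (complex_normed_vector, complex_banach) complex_banach
proof
  fix X :: "nat \<Rightarrow> 'a \<Rightarrow>\<^sub>C\<^sub>L 'b"
  assume X: "Cauchy X"
  define Y where "Y n = Blinfun (cblinfun_apply (X n))" for n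
  have Y: "blinfun_apply (Y n) = cblinfun_apply (X n)" for n
    unfolding Y_def by (rule bounded_linear_Blinfun_apply[OF bounded_linear_cblinfun_apply])
  have "norm (Y m - Y n) = norm (X m - X n)" for m n
    by (simp add: norm_blinfun.rep_eq norm_cblinfun.rep_eq minus_blinfun.rep_eq
        minus_cblinfun.rep_eq Y)
  then have "Cauchy Y"
    using X unfolding Cauchy_def dist_norm by simp
  then obtain L where L: "Y \<longlonglongrightarrow> L"
    using Cauchy_convergent_iff convergent_def by blast
  have Lx: "(\<lambda>n. cblinfun_apply (X n) x) \<longlonglongrightarrow> blinfun_apply L x" for x
    using blinfun.tendsto[OF L tendsto_const[of x]] by (simp add: Y)
  have hom: "blinfun_apply L (c *\<^sub>C x) = c *\<^sub>C blinfun_apply L x" for c x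
    using Lx[of "c *\<^sub>C x"] tendsto_scaleC[OF Lx[of x], of c]
    by (simp add: cblinfun_scaleC_right LIMSEQ_unique)
  define M where "M = CBlinfun (blinfun_apply L)"
  have M: "cblinfun_apply M = blinfun_apply L"
    unfolding M_def by (rule CBlinfun_inverse) (auto simp: hom blinfun.bounded_linear_right)
  have "norm (X n - M) = norm (Y n - L)" for n
    by (simp add: norm_blinfun.rep_eq norm_cblinfun.rep_eq minus_blinfun.rep_eq
        minus_cblinfun.rep_eq Y M)
  then have "X \<longlonglongrightarrow> M"
    using L by (simp add: LIM_zero_iff lim_sequentially dist_norm)
  then show "convergent X"
    by (auto simp: convergent_def)
qed

lift_definition id_cblinfun :: "'a::complex_normed_vector \<Rightarrow>\<^sub>C\<^sub>L 'a" is "\<lambda>x. x"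
  by (simp add: bounded_linear_ident)

lift_definition cblinfun_compose ::
  "'b::complex_normed_vector \<Rightarrow>\<^sub>C\<^sub>L 'c::complex_normed_vector
     \<Rightarrow> 'a::complex_normed_vector \<Rightarrow>\<^sub>C\<^sub>L 'b \<Rightarrow> 'a \<Rightarrow>\<^sub>C\<^sub>L 'c"
  is "\<lambda>f g x. f (g x)"
  by (auto intro: bounded_linear_compose)

primrec cblinfun_power :: "'a::complex_normed_vector \<Rightarrow>\<^sub>C\<^sub>L 'a \<Rightarrow> nat \<Rightarrow> 'a \<Rightarrow>\<^sub>C\<^sub>L 'a" where
  "cblinfun_power T 0 = id_cblinfun"
| "cblinfun_power T (Suc n) = cblinfun_compose T (cblinfun_power T n)"

type_synonym 'a dual = "'a \<Rightarrow>\<^sub>C\<^sub>L complex"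


section \<open>Algebraic tensor product\<close>

definition cbilinear ::
  "('a::complex_vector \<Rightarrow> 'b::complex_vector \<Rightarrow> 'c::complex_vector) \<Rightarrow> bool"
  where "cbilinear B \<longleftrightarrow>
    (\<forall>y. Vector_Spaces.linear scaleC scaleC (\<lambda>x. B x y)) \<and>
    (\<forall>x. Vector_Spaces.linear scaleC scaleC (\<lambda>y. B x y))"

lemma cbilinear_iff:
  "cbilinear B \<longleftrightarrow>
    (\<forall>x x' y. B (x + x') y = B x y + B x' y) \<and> (\<forall>c x y. B (c *\<^sub>C x) y = c *\<^sub>C B x y) \<and>
    (\<forall>x y y'. B x (y + y') = B x y + B x y') \<and> (\<forall>c x y. B x (c *\<^sub>C y) = c *\<^sub>C B x y)"
  by (auto simp: cbilinear_def Vector_Spaces.linear_iff complex_vector.vector_space_axioms)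

definition bilinear_value ::
  "('a::complex_vector \<Rightarrow> 'b::complex_vector \<Rightarrow> 'c::complex_vector) \<Rightarrow> ('a \<times> 'b) list \<Rightarrow> 'c"
  where "bilinear_value B l = (\<Sum>(x, y)\<leftarrow>l. B x y)"

text \<open>A list \<open>[(x\<^sub>1, y\<^sub>1), \<dots>, (x\<^sub>n, y\<^sub>n)]\<close> stands for the tensor \<open>x\<^sub>1 \<otimes> y\<^sub>1 + \<dots> + x\<^sub>n \<otimes> y\<^sub>n\<close>,
  regarded as a functional on the space of all (not necessarily bounded) bilinear forms.\<close>

quotient_type (overloaded) ('a, 'b) alg_tensor = "('a::complex_vector \<times> 'b::complex_vector) list" /
  "\<lambda>l m. \<forall>B :: 'a \<Rightarrow> 'b \<Rightarrow> complex. cbilinear B \<longrightarrow> bilinear_value B l = bilinear_value B m"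
  by (rule equivpI) (auto simp: reflp_def symp_def transp_def)

lemma bilinear_value_simps [simp]:
  "bilinear_value B [] = 0"
  "bilinear_value B ((x, y) # l) = B x y + bilinear_value B l"
  "bilinear_value B (l @ m) = bilinear_value B l + bilinear_value B m"
  by (simp_all add: bilinear_value_def)

lemma bilinear_value_scale:
  "cbilinear B \<Longrightarrow> bilinear_value B (map (\<lambda>(x, y). (c *\<^sub>C x, y)) l) = c *\<^sub>C bilinear_value B l"
  by (induction l) (auto simp: cbilinear_iff scaleC_add_right)

instantiation alg_tensor :: (complex_vector, complex_vector) complex_vector
begin

lift_definition zero_alg_tensor :: "('a, 'b) alg_tensor" is "[]" .

lift_definition plus_alg_tensor :: "('a, 'b) alg_tensor \<Rightarrow> ('a, 'b) alg_tensor \<Rightarrow> ('a, 'b) alg_tensor"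
  is "\<lambda>l m. l @ m" by simp

lift_definition scaleC_alg_tensor :: "complex \<Rightarrow> ('a, 'b) alg_tensor \<Rightarrow> ('a, 'b) alg_tensor"
  is "\<lambda>c l. map (\<lambda>(x, y). (c *\<^sub>C x, y)) l" by (simp add: bilinear_value_scale)

definition scaleR_alg_tensor :: "real \<Rightarrow> ('a, 'b) alg_tensor \<Rightarrow> ('a, 'b) alg_tensor"
  where "scaleR_alg_tensor r t = complex_of_real r *\<^sub>C t"

definition uminus_alg_tensor :: "('a, 'b) alg_tensor \<Rightarrow> ('a, 'b) alg_tensor"
  where "uminus_alg_tensor t = (- 1) *\<^sub>C t"

definition minus_alg_tensor :: "('a, 'b) alg_tensor \<Rightarrow> ('a, 'b) alg_tensor \<Rightarrow> ('a, 'b) alg_tensor"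
  where "minus_alg_tensor s t = s + - t"

instance
proof
  fix a b :: real and c e :: complex and x y z :: "('a, 'b) alg_tensor"
  show "x + y + z = x + (y + z)" "x + y = y + x" "0 + x = x"
    by (transfer; simp)+
  show "- x + x = 0"
    unfolding uminus_alg_tensor_def
    by transfer (simp add: bilinear_value_scale scaleC_complex_def
        del: complex_vector.scale_minus_left)
  show "x - y = x + - y" by (rule minus_alg_tensor_def)
  show addr: "c *\<^sub>C (x + y) = c *\<^sub>C x + c *\<^sub>C y" for c
    by transfer simp
  show addl: "(c + e) *\<^sub>C x = c *\<^sub>C x + e *\<^sub>C x" for c e
    by transfer (simp add: bilinear_value_scale scaleC_complex_def distrib_right)
  show sc: "c *\<^sub>C e *\<^sub>C x = (c * e) *\<^sub>C x" for c e
    by transfer (simp add: bilinear_value_scale scaleC_complex_def del: map_map)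
  show one: "1 *\<^sub>C x = x"
    by transfer (simp add: bilinear_value_scale scaleC_complex_def)
  show "a *\<^sub>R x = complex_of_real a *\<^sub>C x"
    by (rule scaleR_alg_tensor_def)
  show "a *\<^sub>R (x + y) = a *\<^sub>R x + a *\<^sub>R y"
    by (simp add: scaleR_alg_tensor_def addr)
  show "(a + b) *\<^sub>R x = a *\<^sub>R x + b *\<^sub>R x"
    by (simp add: scaleR_alg_tensor_def addl)
  show "a *\<^sub>R b *\<^sub>R x = (a * b) *\<^sub>R x"
    by (simp add: scaleR_alg_tensor_def sc)
  show "1 *\<^sub>R x = x"
    by (simp add: scaleR_alg_tensor_def one)
qed

end


section \<open>Projective tensor product\<close>

definition proj_norm :: "('a::complex_normed_vector, 'b::complex_normed_vector) alg_tensor \<Rightarrow> real"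
  where "proj_norm t = Inf {(\<Sum>(x, y)\<leftarrow>l. norm x * norm y) | l. abs_alg_tensor l = t}"

lemma proj_cost_nonneg: "0 \<le> (\<Sum>(x, y)\<leftarrow>l. norm x * norm y)"
  by (induction l) auto

lemma proj_norm_le: "proj_norm (abs_alg_tensor l) \<le> (\<Sum>(x, y)\<leftarrow>l. norm x * norm y)"
  unfolding proj_norm_def
  by (rule cInf_lower) (auto intro!: bdd_belowI[where m = 0] proj_cost_nonneg)

lemma ex_abs_alg_tensor: "\<exists>l. abs_alg_tensor l = t"
  by (metis Quotient_abs_rep[OF Quotient_alg_tensor])

lemma proj_norm_nonneg: "0 \<le> proj_norm t"
  unfolding proj_norm_def
  using ex_abs_alg_tensor[of t] by (intro cInf_greatest) (auto intro: proj_cost_nonneg)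

lemma proj_norm_approx:
  assumes "0 < e"
  obtains l where "abs_alg_tensor l = t" "(\<Sum>(x, y)\<leftarrow>l. norm x * norm y) < proj_norm t + e"
proof -
  let ?S = "{(\<Sum>(x, y)\<leftarrow>l. norm x * norm y) | l. abs_alg_tensor l = t}"
  have "?S \<noteq> {}" using ex_abs_alg_tensor[of t] by auto
  moreover have "Inf ?S < proj_norm t + e" using assms by (simp add: proj_norm_def)
  ultimately obtain z where "z \<in> ?S" "z < proj_norm t + e" by (rule cInf_lessD[elim_format]) blast
  then show ?thesis using that by auto
qed

lemma proj_norm_triangle: "proj_norm (s + t) \<le> proj_norm s + proj_norm t"
proof (rule field_le_epsilon)
  fix e :: real assume "0 < e"
  then have e: "0 < e / 2" by simp
  obtain l where l: "abs_alg_tensor l = s" "(\<Sum>(x, y)\<leftarrow>l. norm x * norm y) < proj_norm s + e / 2"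
    using proj_norm_approx[OF e] .
  obtain m where m: "abs_alg_tensor m = t" "(\<Sum>(x, y)\<leftarrow>m. norm x * norm y) < proj_norm t + e / 2"
    using proj_norm_approx[OF e] .
  have "proj_norm (s + t) \<le> (\<Sum>(x, y)\<leftarrow>l @ m. norm x * norm y)"
    using proj_norm_le[of "l @ m"] l m by (simp add: plus_alg_tensor.abs_eq[symmetric])
  then show "proj_norm (s + t) \<le> proj_norm s + proj_norm t + e"
    using l m by simp
qed

lemma proj_norm_zero [simp]: "proj_norm 0 = 0"
  by (rule antisym[OF _ proj_norm_nonneg])
    (use proj_norm_le[of "[]"] in \<open>simp add: zero_alg_tensor.abs_eq\<close>)

lemma proj_norm_scale_le: "proj_norm (c *\<^sub>C t) \<le> cmod c * proj_norm t"
proof (rule field_le_epsilon)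
  fix e :: real assume "0 < e"
  then have e: "0 < e / (cmod c + 1)" by (simp add: add_nonneg_pos)
  obtain l where l: "abs_alg_tensor l = t"
      "(\<Sum>(x, y)\<leftarrow>l. norm x * norm y) < proj_norm t + e / (cmod c + 1)"
    using proj_norm_approx[OF e] .
  have "(\<Sum>(x, y)\<leftarrow>map (\<lambda>(x, y). (c *\<^sub>C x, y)) l. norm x * norm y)
      = cmod c * (\<Sum>(x, y)\<leftarrow>l. norm x * norm y)"
    by (induction l) (auto simp: norm_scaleC algebra_simps)
  then have "proj_norm (c *\<^sub>C t) \<le> cmod c * (\<Sum>(x, y)\<leftarrow>l. norm x * norm y)"
    using proj_norm_le[of "map (\<lambda>(x, y). (c *\<^sub>C x, y)) l"] l(1)
    by (simp add: scaleC_alg_tensor.abs_eq[symmetric])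
  also have "\<dots> \<le> cmod c * (proj_norm t + e / (cmod c + 1))"
    using l(2) by (intro mult_left_mono) auto
  also have "\<dots> = cmod c * proj_norm t + e * (cmod c / (cmod c + 1))"
    by (simp add: algebra_simps)
  also have "\<dots> \<le> cmod c * proj_norm t + e * 1"
    using \<open>0 < e\<close> by (intro add_left_mono mult_left_mono) (auto simp: divide_le_eq add_nonneg_pos)
  finally show "proj_norm (c *\<^sub>C t) \<le> cmod c * proj_norm t + e" by simp
qed

lemma proj_norm_scale: "proj_norm (c *\<^sub>C t) = cmod c * proj_norm t"
proof (cases "c = 0")
  case True
  then show ?thesis by simp
next
  case False
  have "proj_norm t = proj_norm (inverse c *\<^sub>C c *\<^sub>C t)"
    using False by (simp add: scaleC_scaleC scaleC_one)
  also have "\<dots> \<le> inverse (cmod c) * proj_norm (c *\<^sub>C t)"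
    using proj_norm_scale_le[of "inverse c" "c *\<^sub>C t"] by (simp add: norm_inverse)
  finally have "cmod c * proj_norm t \<le> proj_norm (c *\<^sub>C t)"
    using False by (simp add: field_simps)
  then show ?thesis using proj_norm_scale_le[of c t] by simp
qed

lemma proj_norm_minus: "proj_norm (- t) = proj_norm t"
  using proj_norm_scale[of "- 1" t] by (simp add: scaleC_one)

lemma proj_norm_minus_commute: "proj_norm (s - t) = proj_norm (t - s)"
  using proj_norm_minus[of "s - t"] by simp

lemma proj_norm_triangle_sub: "proj_norm s \<le> proj_norm t + proj_norm (s - t)"
  using proj_norm_triangle[of t "s - t"] by simp

lemma proj_norm_diff: "\<bar>proj_norm s - proj_norm t\<bar> \<le> proj_norm (s - t)"
  using proj_norm_triangle_sub[of s t] proj_norm_triangle_sub[of t s]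
  by (simp add: proj_norm_minus_commute[of t s])

definition proj_Cauchy ::
  "(nat \<Rightarrow> ('a::complex_normed_vector, 'b::complex_normed_vector) alg_tensor) \<Rightarrow> bool"
  where "proj_Cauchy f \<longleftrightarrow> (\<forall>e>0. \<exists>N. \<forall>m\<ge>N. \<forall>n\<ge>N. proj_norm (f m - f n) < e)"

lemma proj_null_triangle:
  assumes "(\<lambda>n. proj_norm (f n)) \<longlonglongrightarrow> 0" "(\<lambda>n. proj_norm (g n)) \<longlonglongrightarrow> 0"
    and "\<And>n. h n = f n + g n"
  shows "(\<lambda>n. proj_norm (h n)) \<longlonglongrightarrow> 0"
  by (rule tendsto_sandwich[OF _ _ tendsto_const tendsto_add_zero[OF assms(1,2)]])
    (auto simp: assms(3) proj_norm_nonneg proj_norm_triangle)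

text \<open>The completion of the algebraic tensor product with respect to the projective norm.\<close>

quotient_type (overloaded) ('a, 'b) proj_tensor =
  "nat \<Rightarrow> ('a::complex_normed_vector, 'b::complex_normed_vector) alg_tensor" / partial:
  "\<lambda>f g. proj_Cauchy f \<and> proj_Cauchy g \<and> (\<lambda>n. proj_norm (f n - g n)) \<longlonglongrightarrow> 0"
proof (rule part_equivpI)
  show "\<exists>f :: nat \<Rightarrow> ('a, 'b) alg_tensor.
      proj_Cauchy f \<and> proj_Cauchy f \<and> (\<lambda>n. proj_norm (f n - f n)) \<longlonglongrightarrow> 0"
    by (rule exI[of _ "\<lambda>_. 0"]) (auto simp: proj_Cauchy_def)
  show "symp (\<lambda>f g :: nat \<Rightarrow> ('a, 'b) alg_tensor.
      proj_Cauchy f \<and> proj_Cauchy g \<and> (\<lambda>n. proj_norm (f n - g n)) \<longlonglongrightarrow> 0)"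
    by (rule sympI) (simp add: proj_norm_minus_commute)
  show "transp (\<lambda>f g :: nat \<Rightarrow> ('a, 'b) alg_tensor.
      proj_Cauchy f \<and> proj_Cauchy g \<and> (\<lambda>n. proj_norm (f n - g n)) \<longlonglongrightarrow> 0)"
  proof (rule transpI, elim conjE, intro conjI)
    fix f g h :: "nat \<Rightarrow> ('a, 'b) alg_tensor"
    assume "(\<lambda>n. proj_norm (f n - g n)) \<longlonglongrightarrow> 0" "(\<lambda>n. proj_norm (g n - h n)) \<longlonglongrightarrow> 0"
    then show "(\<lambda>n. proj_norm (f n - h n)) \<longlonglongrightarrow> 0"
      by (rule proj_null_triangle) simp
  qed
qed

lemma proj_Cauchy_const [simp]: "proj_Cauchy (\<lambda>_. t)"
  by (simp add: proj_Cauchy_def)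

lemma proj_Cauchy_add:
  assumes "proj_Cauchy f" "proj_Cauchy g"
  shows "proj_Cauchy (\<lambda>n. f n + g n)"
  unfolding proj_Cauchy_def
proof (intro allI impI)
  fix e :: real assume "0 < e"
  then have e: "0 < e / 2" by simp
  from assms(1) e obtain N where N: "\<And>m n. m \<ge> N \<Longrightarrow> n \<ge> N \<Longrightarrow> proj_norm (f m - f n) < e / 2"
    unfolding proj_Cauchy_def by blast
  from assms(2) e obtain M where M: "\<And>m n. m \<ge> M \<Longrightarrow> n \<ge> M \<Longrightarrow> proj_norm (g m - g n) < e / 2"
    unfolding proj_Cauchy_def by blast
  show "\<exists>N. \<forall>m\<ge>N. \<forall>n\<ge>N. proj_norm (f m + g m - (f n + g n)) < e"
  proof (intro exI[of _ "max N M"] allI impI)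
    fix m n assume "max N M \<le> m" "max N M \<le> n"
    then have "proj_norm (f m - f n) < e / 2" "proj_norm (g m - g n) < e / 2"
      using N M by auto
    then show "proj_norm (f m + g m - (f n + g n)) < e"
      using proj_norm_triangle[of "f m - f n" "g m - g n"] by (simp add: algebra_simps)
  qed
qed

lemma proj_Cauchy_scale:
  assumes "proj_Cauchy f"
  shows "proj_Cauchy (\<lambda>n. c *\<^sub>C f n)"
  unfolding proj_Cauchy_def
proof (intro allI impI)
  fix e :: real assume "0 < e"
  then have e: "0 < e / (cmod c + 1)" by (simp add: add_nonneg_pos)
  with assms obtain N where N: "\<And>m n. m \<ge> N \<Longrightarrow> n \<ge> N \<Longrightarrow> proj_norm (f m - f n) < e / (cmod c + 1)"
    unfolding proj_Cauchy_def by blast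
  show "\<exists>N. \<forall>m\<ge>N. \<forall>n\<ge>N. proj_norm (c *\<^sub>C f m - c *\<^sub>C f n) < e"
  proof (intro exI[of _ N] allI impI)
    fix m n assume "N \<le> m" "N \<le> n"
    then have "(cmod c + 1) * proj_norm (f m - f n) < e"
      using N[of m n] by (simp add: pos_less_divide_eq add_nonneg_pos mult.commute)
    moreover have "cmod c * proj_norm (f m - f n) \<le> (cmod c + 1) * proj_norm (f m - f n)"
      by (intro mult_right_mono proj_norm_nonneg) simp
    ultimately show "proj_norm (c *\<^sub>C f m - c *\<^sub>C f n) < e"
      by (simp add: proj_norm_scale complex_vector.scale_right_diff_distrib[symmetric])
  qed
qed

lemma proj_Cauchy_norm_convergent:
  assumes "proj_Cauchy f"
  shows "convergent (\<lambda>n. proj_norm (f n))"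
proof -
  have "Cauchy (\<lambda>n. proj_norm (f n))"
    unfolding Cauchy_def dist_real_def
    using assms unfolding proj_Cauchy_def by (meson proj_norm_diff le_less_trans)
  then show ?thesis by (simp add: Cauchy_convergent_iff)
qed

instantiation proj_tensor :: (complex_normed_vector, complex_normed_vector) complex_normed_vector
begin

lift_definition zero_proj_tensor :: "('a, 'b) proj_tensor" is "\<lambda>_. 0" by simp

lift_definition plus_proj_tensor ::
  "('a, 'b) proj_tensor \<Rightarrow> ('a, 'b) proj_tensor \<Rightarrow> ('a, 'b) proj_tensor"
  is "\<lambda>f g n. f n + g n"
proof (elim conjE, intro conjI proj_Cauchy_add)
  fix f f' g g' :: "nat \<Rightarrow> ('a, 'b) alg_tensor"
  assume "(\<lambda>n. proj_norm (f n - f' n)) \<longlonglongrightarrow> 0" "(\<lambda>n. proj_norm (g n - g' n)) \<longlonglongrightarrow> 0"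
  then show "(\<lambda>n. proj_norm (f n + g n - (f' n + g' n))) \<longlonglongrightarrow> 0"
    by (rule proj_null_triangle) simp
qed

lift_definition scaleC_proj_tensor :: "complex \<Rightarrow> ('a, 'b) proj_tensor \<Rightarrow> ('a, 'b) proj_tensor"
  is "\<lambda>c f n. c *\<^sub>C f n"
  by (auto simp: proj_Cauchy_scale proj_norm_scale complex_vector.scale_right_diff_distrib[symmetric]
      intro: tendsto_mult_right_zero)

lift_definition norm_proj_tensor :: "('a, 'b) proj_tensor \<Rightarrow> real"
  is "\<lambda>f. lim (\<lambda>n. proj_norm (f n))"
proof (elim conjE)
  fix f g :: "nat \<Rightarrow> ('a, 'b) alg_tensor"
  assume f: "proj_Cauchy f" and g: "proj_Cauchy g"
    and fg: "(\<lambda>n. proj_norm (f n - g n)) \<longlonglongrightarrow> 0"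
  have "(\<lambda>n. proj_norm (f n) - proj_norm (g n)) \<longlonglongrightarrow> 0"
    by (rule Lim_null_comparison[OF _ fg]) (simp add: proj_norm_diff)
  moreover have "(\<lambda>n. proj_norm (f n) - proj_norm (g n))
      \<longlonglongrightarrow> lim (\<lambda>n. proj_norm (f n)) - lim (\<lambda>n. proj_norm (g n))"
    by (intro tendsto_diff; simp add: f g proj_Cauchy_norm_convergent convergent_LIMSEQ_iff[symmetric])
  ultimately show "lim (\<lambda>n. proj_norm (f n)) = lim (\<lambda>n. proj_norm (g n))"
    using LIMSEQ_unique by fastforce
qed

definition scaleR_proj_tensor :: "real \<Rightarrow> ('a, 'b) proj_tensor \<Rightarrow> ('a, 'b) proj_tensor"
  where "scaleR_proj_tensor r t = complex_of_real r *\<^sub>C t"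

definition uminus_proj_tensor :: "('a, 'b) proj_tensor \<Rightarrow> ('a, 'b) proj_tensor"
  where "uminus_proj_tensor t = (- 1) *\<^sub>C t"

definition minus_proj_tensor ::
  "('a, 'b) proj_tensor \<Rightarrow> ('a, 'b) proj_tensor \<Rightarrow> ('a, 'b) proj_tensor"
  where "minus_proj_tensor s t = s + - t"

definition sgn_proj_tensor :: "('a, 'b) proj_tensor \<Rightarrow> ('a, 'b) proj_tensor"
  where "sgn_proj_tensor t = scaleR (inverse (norm t)) t"

definition dist_proj_tensor :: "('a, 'b) proj_tensor \<Rightarrow> ('a, 'b) proj_tensor \<Rightarrow> real"
  where "dist_proj_tensor s t = norm (s - t)"

definition uniformity_proj_tensor :: "(('a, 'b) proj_tensor \<times> ('a, 'b) proj_tensor) filter"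
  where "uniformity_proj_tensor = (INF e\<in>{0 <..}. principal {(x, y). dist x y < e})"

definition open_proj_tensor :: "('a, 'b) proj_tensor set \<Rightarrow> bool"
  where "open_proj_tensor S = (\<forall>x\<in>S. \<forall>\<^sub>F (x', y) in uniformity. x' = x \<longrightarrow> y \<in> S)"

instance
proof
  fix a b :: real and c e :: complex and x y z :: "('a, 'b) proj_tensor"
  show "x + y + z = x + (y + z)" "x + y = y + x" "0 + x = x"
    by (transfer; simp add: proj_Cauchy_add ac_simps)+
  show "- x + x = 0"
    unfolding uminus_proj_tensor_def
    by transfer (simp add: proj_Cauchy_add proj_Cauchy_scale scaleC_one)
  show "x - y = x + - y" by (rule minus_proj_tensor_def)
  show addr: "c *\<^sub>C (x + y) = c *\<^sub>C x + c *\<^sub>C y" for c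
    by transfer (simp add: proj_Cauchy_add proj_Cauchy_scale scaleC_add_right)
  show addl: "(c + e) *\<^sub>C x = c *\<^sub>C x + e *\<^sub>C x" for c e
    by transfer (simp add: proj_Cauchy_add proj_Cauchy_scale scaleC_add_left)
  show sc: "c *\<^sub>C e *\<^sub>C x = (c * e) *\<^sub>C x" for c e
    by transfer (simp add: proj_Cauchy_scale scaleC_scaleC)
  show one: "1 *\<^sub>C x = x"
    by transfer (simp add: scaleC_one)
  show "a *\<^sub>R x = complex_of_real a *\<^sub>C x"
    by (rule scaleR_proj_tensor_def)
  show "a *\<^sub>R (x + y) = a *\<^sub>R x + a *\<^sub>R y"
    by (simp add: scaleR_proj_tensor_def addr)
  show "(a + b) *\<^sub>R x = a *\<^sub>R x + b *\<^sub>R x"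
    by (simp add: scaleR_proj_tensor_def addl)
  show "a *\<^sub>R b *\<^sub>R x = (a * b) *\<^sub>R x"
    by (simp add: scaleR_proj_tensor_def sc)
  show "1 *\<^sub>R x = x"
    by (simp add: scaleR_proj_tensor_def one)
  show "dist x y = norm (x - y)" by (rule dist_proj_tensor_def)
  show "sgn x = scaleR (inverse (norm x)) x" by (rule sgn_proj_tensor_def)
  show "uniformity = (INF e\<in>{0<..}. principal {(x, y :: ('a, 'b) proj_tensor). dist x y < e})"
    by (rule uniformity_proj_tensor_def)
  show "open U = (\<forall>x\<in>U. \<forall>\<^sub>F (x', y) in uniformity. x' = x \<longrightarrow> y \<in> U)"
    for U :: "('a, 'b) proj_tensor set"
    by (rule open_proj_tensor_def)
  show "norm x = 0 \<longleftrightarrow> x = 0"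
    by transfer (auto simp: limI convergent_LIMSEQ_iff dest: proj_Cauchy_norm_convergent)
  show "norm (x + y) \<le> norm x + norm y"
  proof transfer
    fix f g :: "nat \<Rightarrow> ('a, 'b) alg_tensor"
    assume "proj_Cauchy f \<and> proj_Cauchy f \<and> (\<lambda>n. proj_norm (f n - f n)) \<longlonglongrightarrow> 0"
      and "proj_Cauchy g \<and> proj_Cauchy g \<and> (\<lambda>n. proj_norm (g n - g n)) \<longlonglongrightarrow> 0"
    then have f: "proj_Cauchy f" and g: "proj_Cauchy g" by auto
    note conv = proj_Cauchy_norm_convergent[unfolded convergent_LIMSEQ_iff]
    show "lim (\<lambda>n. proj_norm (f n + g n)) \<le> lim (\<lambda>n. proj_norm (f n)) + lim (\<lambda>n. proj_norm (g n))"
      by (rule LIMSEQ_le[OF conv[OF proj_Cauchy_add[OF f g]] tendsto_add[OF conv[OF f] conv[OF g]]])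
        (auto simp: proj_norm_triangle)
  qed
  show nc: "norm (c *\<^sub>C x) = cmod c * norm x" for c
  proof transfer
    fix c and f :: "nat \<Rightarrow> ('a, 'b) alg_tensor"
    assume "proj_Cauchy f \<and> proj_Cauchy f \<and> (\<lambda>n. proj_norm (f n - f n)) \<longlonglongrightarrow> 0"
    then have "proj_Cauchy f" by auto
    then show "lim (\<lambda>n. proj_norm (c *\<^sub>C f n)) = cmod c * lim (\<lambda>n. proj_norm (f n))"
      using proj_Cauchy_norm_convergent[of f]
      by (auto simp: proj_norm_scale convergent_LIMSEQ_iff intro!: limI tendsto_mult_left)
  qed
  show "norm (a *\<^sub>R x) = \<bar>a\<bar> * norm x"
    by (simp add: scaleR_proj_tensor_def nc)
qed

end

definition proj_embed ::
  "('a::complex_normed_vector, 'b::complex_normed_vector) alg_tensor \<Rightarrow> ('a, 'b) proj_tensor"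
  where "proj_embed t = abs_proj_tensor (\<lambda>_. t)"

definition ptensor ::
  "'a::complex_normed_vector \<Rightarrow> 'b::complex_normed_vector \<Rightarrow> ('a, 'b) proj_tensor"  (infixl "\<otimes>\<^sub>\<pi>" 72)
  where "x \<otimes>\<^sub>\<pi> y = proj_embed (abs_alg_tensor [(x, y)])"

lemma norm_proj_embed: "norm (proj_embed t) = proj_norm t"
  by (simp add: proj_embed_def norm_proj_tensor.abs_eq)

lemma proj_embed_add: "proj_embed (s + t) = proj_embed s + proj_embed t"
  by (simp add: proj_embed_def plus_proj_tensor.abs_eq scaleC_proj_tensor.abs_eq)

lemma proj_embed_scale: "proj_embed (c *\<^sub>C t) = c *\<^sub>C proj_embed t"
  by (simp add: proj_embed_def plus_proj_tensor.abs_eq scaleC_proj_tensor.abs_eq)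

lemma proj_embed_zero: "proj_embed 0 = 0"
  by (simp add: proj_embed_def zero_proj_tensor.abs_eq)

lemma proj_embed_diff: "proj_embed (s - t) = proj_embed s - proj_embed t"
  using proj_embed_add[of "s - t" t] by simp

lemma proj_embed_list: "proj_embed (abs_alg_tensor l) = (\<Sum>(x, y)\<leftarrow>l. x \<otimes>\<^sub>\<pi> y)"
proof (induction l)
  case Nil
  then show ?case by (simp add: zero_alg_tensor.abs_eq[symmetric] proj_embed_zero)
next
  case (Cons p l)
  obtain x y where p: "p = (x, y)" by (cases p)
  have "abs_alg_tensor (p # l) = abs_alg_tensor [(x, y)] + abs_alg_tensor l"
    by (simp add: plus_alg_tensor.abs_eq p)
  then show ?case by (simp add: proj_embed_add ptensor_def Cons p)
qed

text \<open>The embedding of the algebraic tensor product is isometric (\<open>norm_proj_embed\<close>) and has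
  dense range.\<close>

lemma abs_proj_tensor_tendsto:
  assumes f: "proj_Cauchy f"
  shows "(\<lambda>n. proj_embed (f n)) \<longlonglongrightarrow> abs_proj_tensor f"
proof -
  have nrm: "norm (proj_embed (f n) - abs_proj_tensor f) = lim (\<lambda>m. proj_norm (f n - f m))" for n
  proof -
    have g: "proj_Cauchy (\<lambda>m. (- 1) *\<^sub>C f m)" by (rule proj_Cauchy_scale[OF f])
    have h: "proj_Cauchy (\<lambda>m. f n + (- 1) *\<^sub>C f m)" by (rule proj_Cauchy_add[OF _ g]) simp
    have "proj_embed (f n) - abs_proj_tensor f = abs_proj_tensor (\<lambda>m. f n + (- 1) *\<^sub>C f m)"
      using f g
      unfolding minus_proj_tensor_def uminus_proj_tensor_def proj_embed_def
      by (simp add: scaleC_proj_tensor.abs_eq plus_proj_tensor.abs_eq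
          del: complex_vector.scale_minus_left)
    then show ?thesis
      using h by (simp add: norm_proj_tensor.abs_eq scaleC_one)
  qed
  show ?thesis
  proof (rule LIMSEQ_I)
    fix e :: real assume "0 < e"
    then have "0 < e / 2" by simp
    with f obtain N where N: "\<And>m n. m \<ge> N \<Longrightarrow> n \<ge> N \<Longrightarrow> proj_norm (f m - f n) < e / 2"
      unfolding proj_Cauchy_def by blast
    have "norm (proj_embed (f n) - abs_proj_tensor f) < e" if n: "n \<ge> N" for n
    proof -
      have "proj_Cauchy (\<lambda>m. f n + (- 1) *\<^sub>C f m)"
        by (intro proj_Cauchy_add proj_Cauchy_scale f) simp
      then have "(\<lambda>m. proj_norm (f n - f m)) \<longlonglongrightarrow> lim (\<lambda>m. proj_norm (f n - f m))"
        using proj_Cauchy_norm_convergent by (fastforce simp: convergent_LIMSEQ_iff scaleC_one)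
      then have "lim (\<lambda>m. proj_norm (f n - f m)) \<le> e / 2"
        by (rule LIMSEQ_le_const2) (use N n in \<open>auto intro!: exI[of _ N] less_imp_le\<close>)
      then show ?thesis using nrm[of n] \<open>0 < e\<close> by simp
    qed
    then show "\<exists>N. \<forall>n\<ge>N. norm (proj_embed (f n) - abs_proj_tensor f) < e" by blast
  qed
qed

lemma proj_tensor_approx:
  obtains f where "proj_Cauchy f" "u = abs_proj_tensor f" "(\<lambda>n. proj_embed (f n)) \<longlonglongrightarrow> u"
proof -
  obtain f where "proj_Cauchy f" "u = abs_proj_tensor f"
    using Quotient_abs_rep[OF Quotient_proj_tensor, of u]
      Quotient_rep_reflp[OF Quotient_proj_tensor, of u] by metis
  then show ?thesis using that abs_proj_tensor_tendsto by blast
qed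

instance proj_tensor :: (complex_normed_vector, complex_normed_vector) complex_banach
proof
  fix X :: "nat \<Rightarrow> ('a, 'b) proj_tensor"
  assume X: "Cauchy X"
  have "\<exists>t. norm (X n - proj_embed t) < inverse (Suc n)" for n
  proof -
    obtain f where "(\<lambda>k. proj_embed (f k)) \<longlonglongrightarrow> X n" using proj_tensor_approx by metis
    from LIMSEQ_D[OF this, of "inverse (Suc n)"] obtain k
      where "norm (proj_embed (f k) - X n) < inverse (Suc n)" by auto
    then show ?thesis by (metis norm_minus_commute)
  qed
  then obtain f where f: "\<And>n. norm (X n - proj_embed (f n)) < inverse (Suc n)" by metis
  have "(\<lambda>n. X n - proj_embed (f n)) \<longlonglongrightarrow> 0"
    by (rule Lim_null_comparison[OF _ LIMSEQ_inverse_real_of_nat])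
      (intro always_eventually allI less_imp_le f)
  then have d: "(\<lambda>n. proj_embed (f n) - X n) \<longlonglongrightarrow> 0"
    using tendsto_minus by fastforce
  have "proj_Cauchy f"
    unfolding proj_Cauchy_def
  proof (intro allI impI)
    fix e :: real assume "0 < e"
    then have e: "0 < e / 3" by simp
    from LIMSEQ_D[OF d e] obtain N
      where N: "\<And>n. n \<ge> N \<Longrightarrow> norm (proj_embed (f n) - X n) < e / 3" by auto
    from CauchyD[OF X e] obtain M
      where M: "\<And>m n. m \<ge> M \<Longrightarrow> n \<ge> M \<Longrightarrow> norm (X m - X n) < e / 3" by auto
    show "\<exists>N. \<forall>m\<ge>N. \<forall>n\<ge>N. proj_norm (f m - f n) < e"
    proof (intro exI[of _ "max N M"] allI impI)
      fix m n assume "max N M \<le> m" "max N M \<le> n"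
      then have "norm (proj_embed (f m) - X m) < e / 3" "norm (proj_embed (f n) - X n) < e / 3"
        "norm (X m - X n) < e / 3"
        using N M by auto
      moreover have "norm (proj_embed (f m) - proj_embed (f n)) \<le>
          norm (proj_embed (f m) - X m) + norm (X m - X n) + norm (proj_embed (f n) - X n)"
        using norm_triangle_ineq[of "proj_embed (f m) - X m" "X m - X n"]
          norm_triangle_ineq4[of "proj_embed (f m) - X n" "proj_embed (f n) - X n"] by simp
      ultimately show "proj_norm (f m - f n) < e"
        by (simp add: norm_proj_embed[symmetric] proj_embed_diff)
    qed
  qed
  from tendsto_diff[OF abs_proj_tensor_tendsto[OF this] d]
  show "convergent X" by (auto simp: convergent_def)
qed


subsection \<open>Linearisation of bounded bilinear maps\<close>

lemma bilinear_value_cong: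
  fixes B :: "'a::complex_vector \<Rightarrow> 'b::complex_vector \<Rightarrow> 'c::complex_vector"
  assumes B: "cbilinear B" and lm: "abs_alg_tensor l = abs_alg_tensor m"
  shows "bilinear_value B l = bilinear_value B m"
proof (rule ccontr)
  define z where "z = bilinear_value B l - bilinear_value B m"
  assume "bilinear_value B l \<noteq> bilinear_value B m"
  then have z: "z \<noteq> 0" by (simp add: z_def)
  interpret P: vector_space_pair "scaleC :: complex \<Rightarrow> 'c \<Rightarrow> 'c" "scaleC :: complex \<Rightarrow> complex \<Rightarrow> complex"
    by unfold_locales
  have ind: "\<not> complex_vector.dependent {z}"
    using z by (simp add: complex_vector.dependent_single)
  define \<phi> where "\<phi> = P.construct {z} (\<lambda>_. 1 :: complex)"
  have lin: "Vector_Spaces.linear scaleC scaleC \<phi>"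
    unfolding \<phi>_def by (rule P.linear_construct[OF ind])
  have \<phi>z: "\<phi> z = 1"
    unfolding \<phi>_def by (rule P.construct_basis[OF ind]) simp
  have add: "\<phi> (x + y) = \<phi> x + \<phi> y" and scale: "\<phi> (c *\<^sub>C x) = c *\<^sub>C \<phi> x" for x y c
    using lin by (auto simp: Vector_Spaces.linear_iff)
  have zero: "\<phi> 0 = 0" using scale[of 0 0] by simp
  have val: "bilinear_value (\<lambda>x y. \<phi> (B x y)) k = \<phi> (bilinear_value B k)" for k
    by (induction k) (auto simp: add zero)
  have "cbilinear (\<lambda>x y. \<phi> (B x y))"
    using B by (simp add: cbilinear_iff add scale)
  then have "\<phi> (bilinear_value B l) = \<phi> (bilinear_value B m)"
    using lm by (simp add: alg_tensor.abs_eq_iff flip: val)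
  moreover have "\<phi> (bilinear_value B l) = \<phi> z + \<phi> (bilinear_value B m)"
    by (simp add: z_def flip: add)
  ultimately show False using \<phi>z by simp
qed

lemma proj_tensor_lift_unique:
  fixes \<Phi> \<Psi> :: "('a::complex_normed_vector, 'b::complex_normed_vector) proj_tensor
      \<Rightarrow>\<^sub>C\<^sub>L 'c::complex_normed_vector"
  assumes "\<And>x y. \<Phi> (x \<otimes>\<^sub>\<pi> y) = \<Psi> (x \<otimes>\<^sub>\<pi> y)"
  shows "\<Phi> = \<Psi>"
proof (rule cblinfun_eqI)
  fix u :: "('a, 'b) proj_tensor"
  interpret \<Phi>: bounded_linear "cblinfun_apply \<Phi>" by (rule bounded_linear_cblinfun_apply)
  interpret \<Psi>: bounded_linear "cblinfun_apply \<Psi>" by (rule bounded_linear_cblinfun_apply)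
  have eq: "\<Phi> (proj_embed t) = \<Psi> (proj_embed t)" for t
  proof -
    obtain l where "abs_alg_tensor l = t" using ex_abs_alg_tensor by blast
    moreover have "\<Phi> (\<Sum>(x, y)\<leftarrow>l. x \<otimes>\<^sub>\<pi> y) = \<Psi> (\<Sum>(x, y)\<leftarrow>l. x \<otimes>\<^sub>\<pi> y)" for l
      by (induction l) (auto simp: \<Phi>.add \<Psi>.add \<Phi>.zero \<Psi>.zero assms)
    ultimately show ?thesis by (metis proj_embed_list)
  qed
  obtain f where f: "(\<lambda>n. proj_embed (f n)) \<longlonglongrightarrow> u" using proj_tensor_approx by metis
  from \<Phi>.tendsto[OF f] \<Psi>.tendsto[OF f] show "\<Phi> u = \<Psi> u"
    by (simp add: eq LIMSEQ_unique)
qed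

theorem proj_tensor_lift_exists:
  fixes B :: "'a::complex_normed_vector \<Rightarrow> 'b::complex_normed_vector \<Rightarrow> 'c::complex_banach"
  assumes B: "cbilinear B" and K: "\<And>x y. norm (B x y) \<le> K * (norm x * norm y)"
  shows "\<exists>\<Phi> :: ('a, 'b) proj_tensor \<Rightarrow>\<^sub>C\<^sub>L 'c. \<forall>x y. \<Phi> (x \<otimes>\<^sub>\<pi> y) = B x y"
proof -
  define K' where "K' = max K 0"
  have K': "0 \<le> K'" "\<And>x y. norm (B x y) \<le> K' * (norm x * norm y)"
  proof -
    show "norm (B x y) \<le> K' * (norm x * norm y)" for x y
      using K[of x y] mult_right_mono[of K K' "norm x * norm y"] by (simp add: K'_def)
  qed (simp add: K'_def)
  define L where "L t = bilinear_value B (rep_alg_tensor t)" for t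
  have L: "L (abs_alg_tensor l) = bilinear_value B l" for l
    unfolding L_def by (rule bilinear_value_cong[OF B]) (metis Quotient_abs_rep[OF Quotient_alg_tensor])
  have Ladd: "L (s + t) = L s + L t" for s t
  proof -
    obtain l m where "abs_alg_tensor l = s" "abs_alg_tensor m = t" using ex_abs_alg_tensor by metis
    then show ?thesis using L[of "l @ m"] L[of l] L[of m] by (auto simp: plus_alg_tensor.abs_eq)
  qed
  have Lscale: "L (c *\<^sub>C t) = c *\<^sub>C L t" for c t
  proof -
    obtain l where "abs_alg_tensor l = t" using ex_abs_alg_tensor by metis
    then show ?thesis
      using L[of "map (\<lambda>(x, y). (c *\<^sub>C x, y)) l"] L[of l]
      by (auto simp: scaleC_alg_tensor.abs_eq bilinear_value_scale[OF B])
  qed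
  have Ldiff: "L (s - t) = L s - L t" for s t
    using Ladd[of "s - t" t] by simp
  have Lbound: "norm (L t) \<le> K' * norm (proj_embed t)" for t
  proof (cases "K' = 0")
    case True
    obtain l where l: "abs_alg_tensor l = t" using ex_abs_alg_tensor by metis
    have "bilinear_value B l = 0" using K'(2) True by (induction l) auto
    then show ?thesis using L[of l] l True by simp
  next
    case False
    show ?thesis
    proof (rule field_le_epsilon)
      fix e :: real assume "0 < e"
      then have "0 < e / K'" using False K'(1) by simp
      then obtain l where l: "abs_alg_tensor l = t"
          "(\<Sum>(x, y)\<leftarrow>l. norm x * norm y) < proj_norm t + e / K'"
        by (rule proj_norm_approx)
      have "norm (bilinear_value B l) \<le> K' * (\<Sum>(x, y)\<leftarrow>l. norm x * norm y)"
      proof (induction l)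
        case (Cons p l)
        then show ?case
          using K'(2)[of "fst p" "snd p"] norm_triangle_ineq[of "B (fst p) (snd p)" "bilinear_value B l"]
          by (cases p) (simp add: distrib_left)
      qed simp
      also have "\<dots> \<le> K' * (proj_norm t + e / K')"
        using l K'(1) by (intro mult_left_mono) auto
      also have "\<dots> = K' * norm (proj_embed t) + e"
        using False by (simp add: norm_proj_embed distrib_left)
      finally show "norm (L t) \<le> K' * norm (proj_embed t) + e"
        using L[of l] l by simp
    qed
  qed
  have "\<exists>v. \<forall>f. (\<lambda>n. proj_embed (f n)) \<longlonglongrightarrow> u \<longrightarrow> (\<lambda>n. L (f n)) \<longlonglongrightarrow> v" for u
  proof -
    obtain f where f: "(\<lambda>n. proj_embed (f n)) \<longlonglongrightarrow> u" using proj_tensor_approx by metis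
    have "Cauchy (\<lambda>n. L (f n))"
    proof (rule CauchyI)
      fix e :: real assume "0 < e"
      then have "0 < e / (K' + 1)" using K'(1) by simp
      from CauchyD[OF LIMSEQ_imp_Cauchy[OF f] this] obtain N
        where N: "\<And>m n. m \<ge> N \<Longrightarrow> n \<ge> N \<Longrightarrow>
          norm (proj_embed (f m) - proj_embed (f n)) < e / (K' + 1)" by auto
      have "norm (L (f m) - L (f n)) < e" if "m \<ge> N" "n \<ge> N" for m n
      proof -
        have "norm (L (f m) - L (f n)) \<le> K' * norm (proj_embed (f m) - proj_embed (f n))"
          using Lbound[of "f m - f n"] by (simp add: Ldiff proj_embed_diff)
        also have "\<dots> \<le> (K' + 1) * norm (proj_embed (f m) - proj_embed (f n))"
          by (intro mult_right_mono) auto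
        also have "\<dots> < e"
          using N[OF that] K'(1) by (simp add: pos_less_divide_eq mult.commute)
        finally show ?thesis .
      qed
      then show "\<exists>M. \<forall>m\<ge>M. \<forall>n\<ge>M. norm (L (f m) - L (f n)) < e" by blast
    qed
    then obtain v where v: "(\<lambda>n. L (f n)) \<longlonglongrightarrow> v"
      using Cauchy_convergent_iff convergent_def by blast
    have "(\<lambda>n. L (g n)) \<longlonglongrightarrow> v" if g: "(\<lambda>n. proj_embed (g n)) \<longlonglongrightarrow> u" for g
    proof -
      have "(\<lambda>n. proj_embed (g n) - proj_embed (f n)) \<longlonglongrightarrow> 0"
        using tendsto_diff[OF g f] by simp
      then have "(\<lambda>n. K' * norm (proj_embed (g n) - proj_embed (f n))) \<longlonglongrightarrow> 0"
        by (intro tendsto_mult_right_zero tendsto_norm_zero)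
      then have "(\<lambda>n. L (g n) - L (f n)) \<longlonglongrightarrow> 0"
      proof (rule Lim_null_comparison[OF always_eventually, rotated], intro allI)
        show "norm (L (g n) - L (f n)) \<le> K' * norm (proj_embed (g n) - proj_embed (f n))" for n
          using Lbound[of "g n - f n"] by (simp add: Ldiff proj_embed_diff)
      qed
      from tendsto_add[OF this v] show ?thesis by simp
    qed
    then show ?thesis by blast
  qed
  then obtain F where F: "\<And>u f. (\<lambda>n. proj_embed (f n)) \<longlonglongrightarrow> u \<Longrightarrow> (\<lambda>n. L (f n)) \<longlonglongrightarrow> F u"
    by metis
  have Fadd: "F (u + w) = F u + F w" for u w
  proof -
    obtain f g where f: "(\<lambda>n. proj_embed (f n)) \<longlonglongrightarrow> u" and g: "(\<lambda>n. proj_embed (g n)) \<longlonglongrightarrow> w"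
      using proj_tensor_approx by metis
    have "(\<lambda>n. proj_embed (f n + g n)) \<longlonglongrightarrow> u + w"
      using tendsto_add[OF f g] by (simp add: proj_embed_add)
    from F[OF this] tendsto_add[OF F[OF f] F[OF g]] show ?thesis
      by (simp add: Ladd LIMSEQ_unique)
  qed
  have Fscale: "F (c *\<^sub>C u) = c *\<^sub>C F u" for c u
  proof -
    obtain f where f: "(\<lambda>n. proj_embed (f n)) \<longlonglongrightarrow> u" using proj_tensor_approx by metis
    have "(\<lambda>n. proj_embed (c *\<^sub>C f n)) \<longlonglongrightarrow> c *\<^sub>C u"
      using tendsto_scaleC[OF f] by (simp add: proj_embed_scale)
    from F[OF this] tendsto_scaleC[OF F[OF f]] show ?thesis
      by (simp add: Lscale LIMSEQ_unique)
  qed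
  have Fbound: "norm (F u) \<le> K' * norm u" for u
  proof -
    obtain f where f: "(\<lambda>n. proj_embed (f n)) \<longlonglongrightarrow> u" using proj_tensor_approx by metis
    show ?thesis
      by (rule LIMSEQ_le[OF tendsto_norm[OF F[OF f]] tendsto_mult_left[OF tendsto_norm[OF f]]])
        (auto simp: Lbound)
  qed
  have "bounded_linear F"
    by (rule bounded_linear_intro[where K = K'])
      (use Fbound in \<open>simp_all add: Fadd Fscale scaleR_scaleC mult.commute\<close>)
  then have "cblinfun_apply (CBlinfun F) = F"
    by (intro CBlinfun_inverse) (simp add: Fscale)
  moreover have "F (x \<otimes>\<^sub>\<pi> y) = B x y" for x y
  proof -
    have "(\<lambda>n. L (abs_alg_tensor [(x, y)])) \<longlonglongrightarrow> F (x \<otimes>\<^sub>\<pi> y)"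
      by (rule F) (simp add: ptensor_def)
    then show ?thesis by (simp add: L LIMSEQ_const_iff)
  qed
  ultimately show ?thesis by metis
qed


section \<open>Nuclear operators and traces\<close>

lift_definition rank_one ::
  "'a::complex_normed_vector dual \<Rightarrow> 'b::complex_normed_vector \<Rightarrow> 'a \<Rightarrow>\<^sub>C\<^sub>L 'b"
  is "\<lambda>x' x z. x' z *\<^sub>C x"
proof (intro conjI allI)
  fix x' :: "'a \<Rightarrow> complex" and x :: 'b
  assume x': "bounded_linear x' \<and> (\<forall>c z. x' (c *\<^sub>C z) = c *\<^sub>C x' z)"
  then interpret bounded_linear x' by simp
  obtain K where K: "\<And>z. norm (x' z) \<le> norm z * K" using bounded by blast
  show "bounded_linear (\<lambda>z. x' z *\<^sub>C x)"
  proof (rule bounded_linear_intro[where K = "K * norm x"])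
    show "x' (y + z) *\<^sub>C x = x' y *\<^sub>C x + x' z *\<^sub>C x" for y z
      by (simp add: add scaleC_add_left)
    show "x' (r *\<^sub>R z) *\<^sub>C x = r *\<^sub>R (x' z *\<^sub>C x)" for r z
      by (subst scaleR) (simp add: scaleR_scaleC scaleC_complex_def)
    show "norm (x' z *\<^sub>C x) \<le> norm z * (K * norm x)" for z
      using mult_right_mono[OF K[of z], of "norm x"] by (simp add: norm_scaleC mult.assoc)
  qed
  show "x' (c *\<^sub>C z) *\<^sub>C x = c *\<^sub>C x' z *\<^sub>C x" for c z
    using x' by (simp add: scaleC_complex_def)
qed

text \<open>The map \<open>u \<mapsto> \<^emph>\<open>the operator generated by\<close> u\<close>; see \<open>tensor_operator_sums\<close> for its value on
  a series representation of \<open>u\<close>.\<close>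

definition tensor_operator ::
  "('a dual, 'a::complex_banach) proj_tensor \<Rightarrow>\<^sub>C\<^sub>L ('a \<Rightarrow>\<^sub>C\<^sub>L 'a)"
  where "tensor_operator = (THE \<Phi>. \<forall>x' x. cblinfun_apply \<Phi> (x' \<otimes>\<^sub>\<pi> x) = rank_one x' x)"

definition tensor_trace :: "('a dual, 'a::complex_banach) proj_tensor \<Rightarrow>\<^sub>C\<^sub>L complex"
  where "tensor_trace = (THE \<tau>. \<forall>x' x. cblinfun_apply \<tau> (x' \<otimes>\<^sub>\<pi> x) = cblinfun_apply x' x)"

lemma tensor_operator_ptensor: "tensor_operator (x' \<otimes>\<^sub>\<pi> x) = rank_one x' x"
proof -
  have "norm (rank_one y' y) \<le> 1 * (norm y' * norm y)" for y' :: "'a dual" and y :: 'a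
    using mult_right_mono[OF norm_cblinfun[of y'], of "norm y"]
    by (intro norm_cblinfun_bound) (auto simp: rank_one.rep_eq norm_scaleC ac_simps)
  moreover have "cbilinear (rank_one :: 'a dual \<Rightarrow> 'a \<Rightarrow> _)"
    unfolding cbilinear_iff
    by (intro conjI allI cblinfun_eqI)
      (simp_all add: rank_one.rep_eq plus_cblinfun.rep_eq scaleC_cblinfun.rep_eq scaleC_add_left
        scaleC_add_right scaleC_scaleC scaleC_complex_def mult.commute)
  ultimately obtain \<Phi> :: "('a dual, 'a) proj_tensor \<Rightarrow>\<^sub>C\<^sub>L ('a \<Rightarrow>\<^sub>C\<^sub>L 'a)"
    where *: "\<forall>x' x. \<Phi> (x' \<otimes>\<^sub>\<pi> x) = rank_one x' x"
    using proj_tensor_lift_exists by metis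
  have "\<forall>x' x :: 'a. tensor_operator (x' \<otimes>\<^sub>\<pi> x) = rank_one x' x"
    unfolding tensor_operator_def by (rule theI, rule *) (rule proj_tensor_lift_unique, simp add: *)
  then show ?thesis by blast
qed

lemma tensor_trace_ptensor: "tensor_trace (x' \<otimes>\<^sub>\<pi> x) = cblinfun_apply x' x"
proof -
  have "norm (cblinfun_apply y' y) \<le> 1 * (norm y' * norm y)" for y' :: "'a dual" and y :: 'a
    by (simp add: norm_cblinfun)
  moreover have "cbilinear (cblinfun_apply :: 'a dual \<Rightarrow> 'a \<Rightarrow> complex)"
    unfolding cbilinear_iff
    by (simp add: plus_cblinfun.rep_eq scaleC_cblinfun.rep_eq cblinfun_scaleC_right
        linear_simps[OF bounded_linear_cblinfun_apply])
  ultimately obtain \<tau> :: "('a dual, 'a) proj_tensor \<Rightarrow>\<^sub>C\<^sub>L complex"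
    where *: "\<forall>x' x. \<tau> (x' \<otimes>\<^sub>\<pi> x) = cblinfun_apply x' x"
    using proj_tensor_lift_exists by metis
  have "\<forall>x' x :: 'a. tensor_trace (x' \<otimes>\<^sub>\<pi> x) = cblinfun_apply x' x"
    unfolding tensor_trace_def by (rule theI, rule *) (rule proj_tensor_lift_unique, simp add: *)
  then show ?thesis by blast
qed

lemma tensor_operator_sums:
  assumes "(\<lambda>k. x' k \<otimes>\<^sub>\<pi> x k) sums u"
  shows "(\<lambda>k. cblinfun_apply (x' k) z *\<^sub>C x k) sums tensor_operator u z"
  using bounded_linear.sums[OF bounded_linear_cblinfun_eval[of z]
      bounded_linear.sums[OF bounded_linear_cblinfun_apply[of tensor_operator] assms]]
  by (simp add: tensor_operator_ptensor rank_one.rep_eq)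

lemma tensor_trace_sums:
  assumes "(\<lambda>k. x' k \<otimes>\<^sub>\<pi> x k) sums u"
  shows "(\<lambda>k. cblinfun_apply (x' k) (x k)) sums tensor_trace u"
  using bounded_linear.sums[OF bounded_linear_cblinfun_apply[of tensor_trace] assms]
  by (simp add: tensor_trace_ptensor)

definition s_tensors :: "real \<Rightarrow> ('a dual, 'a::complex_banach) proj_tensor set"
  where "s_tensors s = {u. \<exists>x' x.
    summable (\<lambda>k. norm (x' k) powr s * norm (x k) powr s) \<and> (\<lambda>k. x' k \<otimes>\<^sub>\<pi> x k) sums u}"

definition s_nuclear :: "real \<Rightarrow> ('a::complex_banach \<Rightarrow>\<^sub>C\<^sub>L 'a) \<Rightarrow> bool"
  where "s_nuclear s S \<longleftrightarrow> S \<in> cblinfun_apply tensor_operator ` s_tensors s"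

abbreviation nuclear :: "('a::complex_banach \<Rightarrow>\<^sub>C\<^sub>L 'a) \<Rightarrow> bool"
  where "nuclear \<equiv> s_nuclear 1"

definition approx_property :: "'a::complex_banach itself \<Rightarrow> real \<Rightarrow> bool"
  where "approx_property _ s \<longleftrightarrow>
    inj_on (cblinfun_apply (tensor_operator :: ('a dual, 'a) proj_tensor \<Rightarrow>\<^sub>C\<^sub>L _)) (s_tensors s)"

definition trace_well_defined :: "('a::complex_banach \<Rightarrow>\<^sub>C\<^sub>L 'a) \<Rightarrow> bool"
  where "trace_well_defined S \<longleftrightarrow>
    (\<exists>s. 0 < s \<and> s \<le> 1 \<and> approx_property TYPE('a) s \<and> s_nuclear s S)"

definition op_trace :: "('a::complex_banach \<Rightarrow>\<^sub>C\<^sub>L 'a) \<Rightarrow> complex"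
  where "op_trace S = (THE c. \<exists>s u. 0 < s \<and> s \<le> 1 \<and> approx_property TYPE('a) s \<and>
    u \<in> s_tensors s \<and> tensor_operator u = S \<and> c = tensor_trace u)"

lemma s_tensors_mono:
  assumes "0 < s" "s \<le> t"
  shows "s_tensors s \<subseteq> s_tensors t"
proof
  fix u :: "('a dual, 'a) proj_tensor"
  assume "u \<in> s_tensors s"
  then obtain x' x where sm: "summable (\<lambda>k. norm (x' k) powr s * norm (x k) powr s)"
    and u: "(\<lambda>k. x' k \<otimes>\<^sub>\<pi> x k) sums u"
    unfolding s_tensors_def by blast
  define a where "a k = norm (x' k) * norm (x k)" for k
  have a: "0 \<le> a k" for k by (simp add: a_def)
  have sm: "summable (\<lambda>k. a k powr s)" using sm by (simp add: a_def powr_mult)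
  have "\<forall>\<^sub>F k in sequentially. a k powr s < 1"
    using summable_LIMSEQ_zero[OF sm] by (rule order_tendstoD) simp
  then have "\<forall>\<^sub>F k in sequentially. norm (a k powr t) \<le> a k powr s"
  proof eventually_elim
    case (elim k)
    have "a k \<le> 1"
      using elim ge_one_powr_ge_zero[of "a k" s] assms by fastforce
    then show ?case using a[of k] assms by (cases "a k = 0") (auto intro: powr_mono')
  qed
  then have "summable (\<lambda>k. a k powr t)"
    using sm by (rule summable_comparison_test_ev)
  then show "u \<in> s_tensors t"
    unfolding s_tensors_def using u by (auto simp: a_def powr_mult)
qed

lemma op_trace_eq:
  fixes u :: "('a dual, 'a::complex_banach) proj_tensor"
  assumes s: "0 < s" "s \<le> 1" and AP: "approx_property TYPE('a) s" and u: "u \<in> s_tensors s"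
  shows "op_trace (tensor_operator u) = tensor_trace u"
  unfolding op_trace_def
proof (rule the_equality)
  show "\<exists>t v. 0 < t \<and> t \<le> 1 \<and> approx_property TYPE('a) t \<and> v \<in> s_tensors t \<and>
      tensor_operator v = tensor_operator u \<and> tensor_trace u = tensor_trace v"
    using assms by blast
next
  fix c
  assume "\<exists>t v. 0 < t \<and> t \<le> 1 \<and> approx_property TYPE('a) t \<and> v \<in> s_tensors t \<and>
      tensor_operator v = tensor_operator u \<and> c = tensor_trace v"
  then obtain t v where t: "0 < t" "approx_property TYPE('a) t" "v \<in> s_tensors t"
    and v: "tensor_operator v = tensor_operator u" "c = tensor_trace v" by blast
  have "v = u"
  proof (cases "s \<le> t")
    case True
    then have "u \<in> s_tensors t" using s_tensors_mono s(1) u by blast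
    then show ?thesis using t v by (auto simp: approx_property_def dest: inj_onD)
  next
    case False
    then have "v \<in> s_tensors s" using s_tensors_mono[of t s] t by auto
    then show ?thesis using AP u v by (auto simp: approx_property_def dest: inj_onD)
  qed
  then show "c = tensor_trace u" using v by simp
qed


section \<open>Spectral symmetry\<close>

definition eigenvalue :: "('a::complex_normed_vector \<Rightarrow>\<^sub>C\<^sub>L 'a) \<Rightarrow> complex \<Rightarrow> bool"
  where "eigenvalue T \<mu> \<longleftrightarrow> (\<exists>x. x \<noteq> 0 \<and> T x = \<mu> *\<^sub>C x)"

text \<open>The library dimension of an infinite-dimensional space is \<open>0\<close>; algebraic multiplicities are
  only used below for nonzero eigenvalues of operators with a nuclear power, where they are
  finite.\<close>

definition alg_multiplicity :: "('a::complex_normed_vector \<Rightarrow>\<^sub>C\<^sub>L 'a) \<Rightarrow> complex \<Rightarrow> nat"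
  where "alg_multiplicity T \<mu> =
    complex_vector.dim (\<Union>n. {x. cblinfun_power (T - \<mu> *\<^sub>C id_cblinfun) n x = 0})"

definition Zd_symmetric_spectrum :: "nat \<Rightarrow> ('a::complex_normed_vector \<Rightarrow>\<^sub>C\<^sub>L 'a) \<Rightarrow> bool"
  where "Zd_symmetric_spectrum d T \<longleftrightarrow>
    (\<forall>\<mu> t. \<mu> \<noteq> 0 \<and> eigenvalue T \<mu> \<and> t ^ d = 1 \<longrightarrow>
      eigenvalue T (t * \<mu>) \<and> alg_multiplicity T (t * \<mu>) = alg_multiplicity T \<mu>)"

end

theory Submission
  imports Defs "Jordan_Normal_Form.Schur_Decomposition" "HOL-Library.Diagonal_Subsequence"
begin

text \<open>Let \<open>T\<^sup>M\<close> be nuclear. The proof rests on Lidskii's formula: for all large \<open>n\<close> the trace of \<open>T\<^sup>n\<close> is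
  the sum of \<open>\<mu>\<^sup>n\<close> over the nonzero eigenvalues \<open>\<mu>\<close>, counted with algebraic multiplicity. Symmetry under
  a primitive \<open>d\<close>-th root of unity \<open>w\<close> multiplies this sum by \<open>w\<^sup>n\<close>, so it vanishes unless \<open>d\<close> divides \<open>n\<close>;
  conversely, if these traces vanish, then the families \<open>\<mu>\<close> and \<open>t \<mu>\<close> with \<open>t\<^sup>d = 1\<close> have the same large
  power sums, and power sums determine multiplicities.

  Traces are well defined because every Banach space has \<open>AP\<^sub>1\<^sub>/\<^sub>3\<close> (projections of norm \<open>O(n)\<close> onto
  \<open>n\<close>-dimensional spaces of functionals) and \<open>T\<^sup>1\<^sup>0\<^sup>M\<close> is one-third nuclear (a nuclear operator factors
  through a Hilbert--Schmidt operator, whose approximation numbers are \<open>O(n\<^sup>-\<^sup>1\<^sup>/\<^sup>2)\<close>).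

  For the formula, truncate a nuclear operator \<open>S\<close> to finite rank. By Schur's inequality the eigenvalues of
  the truncations are uniformly square summable, so along a subsequence they converge to a sequence \<open>\<mu>\<close> of
  eigenvalues of \<open>S\<close> with \<open>trace S\<^sup>j = \<Sum> \<mu>\<^sub>i\<^sup>j\<close> for \<open>j \<ge> 3\<close>. That \<open>\<mu>\<close> takes each value as often as its
  multiplicity is seen by splitting off one eigenvector at a time, which lowers the trace of the \<open>j\<close>-th power
  by \<open>\<mu>\<^sup>j\<close> and the multiplicity by one. Applying this to \<open>S = f(T)\<close> for polynomials \<open>f\<close> gives the formula for
  all large exponents.\<close>

text \<open>The order 1/3 is a matter of convenience: powers of T can be raised at will, and at this
  order a projection norm O(n) is already beaten by the tail of the series.

  The passage to the limit controls eigenvalues only through |mu_i|^2 <= C^2 / (i + 1). Hence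
  exponents below 3 are lost, and the limiting sequence might list an eigenvalue a wrong number of
  times. Multiplicity is therefore read off from traces: deflation changes the trace and the
  generalised eigenspace in step, and large power sums determine a sequence up to order and zeros.
  The same count shows that deflation stops, which is how multiplicities are seen to be finite.

  With S = T^m and m >= 10 M alone, the formula would reach only the exponents 3 m, 4 m, ..., which
  miss all primes. Polynomials fill the gap: X^n = a^2 b with monomials a, b of degree at least 10 M
  is a combination of cubes f^3, and the cube is the first power for which the limit is under
  control.\<close>

hide_const (open) Char_Poly.eigenvalue

section \<open>Operator calculus\<close>

notation cblinfun_compose (infixl "\<circ>\<^sub>L" 67)

lemmas cblinfun_rep_simps =
  plus_cblinfun.rep_eq minus_cblinfun.rep_eq uminus_cblinfun.rep_eq zero_cblinfun.rep_eq
  scaleC_cblinfun.rep_eq id_cblinfun.rep_eq cblinfun_compose.rep_eq rank_one.rep_eq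

lemmas cblinfun_linear_simps =
  linear_simps[OF bounded_linear_cblinfun_apply] cblinfun_scaleC_right

lemma cblinfun_apply_sum: "cblinfun_apply T (sum f I) = (\<Sum>i\<in>I. cblinfun_apply T (f i))"
  by (induction I rule: infinite_finite_induct) (auto simp: cblinfun_linear_simps)

lemma sum_cblinfun_apply: "cblinfun_apply (sum f I) x = (\<Sum>i\<in>I. cblinfun_apply (f i) x)"
  by (induction I rule: infinite_finite_induct) (auto simp: cblinfun_rep_simps)

lemma cblinfun_apply_sums: "f sums v \<Longrightarrow> (\<lambda>k. cblinfun_apply T (f k)) sums cblinfun_apply T v"
  by (rule bounded_linear.sums[OF bounded_linear_cblinfun_apply])

lemma sums_cblinfun_apply: "f sums T \<Longrightarrow> (\<lambda>k. cblinfun_apply (f k) x) sums cblinfun_apply T x"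
  by (rule bounded_linear.sums[OF bounded_linear_cblinfun_eval])

lemma cblinfun_compose_assoc: "(A \<circ>\<^sub>L B) \<circ>\<^sub>L C = A \<circ>\<^sub>L (B \<circ>\<^sub>L C)"
  by (rule cblinfun_eqI) (simp add: cblinfun_rep_simps)

lemma cblinfun_compose_id [simp]: "id_cblinfun \<circ>\<^sub>L A = A" "A \<circ>\<^sub>L id_cblinfun = A"
  by (auto intro!: cblinfun_eqI simp: cblinfun_rep_simps)

lemma cblinfun_compose_add:
  "(A + B) \<circ>\<^sub>L C = A \<circ>\<^sub>L C + B \<circ>\<^sub>L C" "A \<circ>\<^sub>L (C + D) = A \<circ>\<^sub>L C + A \<circ>\<^sub>L D"
  by (auto intro!: cblinfun_eqI simp: cblinfun_rep_simps cblinfun_linear_simps)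

lemma cblinfun_compose_scaleC:
  "(c *\<^sub>C A) \<circ>\<^sub>L C = c *\<^sub>C (A \<circ>\<^sub>L C)" "A \<circ>\<^sub>L (c *\<^sub>C C) = c *\<^sub>C (A \<circ>\<^sub>L C)"
  by (auto intro!: cblinfun_eqI simp: cblinfun_rep_simps cblinfun_linear_simps)

lemma norm_cblinfun_compose: "norm (A \<circ>\<^sub>L B) \<le> norm A * norm B"
proof (rule norm_cblinfun_bound)
  fix x
  have "norm (A (B x)) \<le> norm A * (norm B * norm x)"
    by (meson norm_cblinfun mult_left_mono norm_ge_zero order_trans)
  then show "norm ((A \<circ>\<^sub>L B) x) \<le> norm A * norm B * norm x"
    by (simp add: cblinfun_rep_simps mult.assoc)
qed simp

lemma bounded_bilinear_cblinfun_compose: "bounded_bilinear cblinfun_compose"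
proof
  show "\<exists>K. \<forall>A B. norm (A \<circ>\<^sub>L B) \<le> norm A * norm B * K"
    by (rule exI[of _ 1]) (simp add: norm_cblinfun_compose)
qed (simp_all add: cblinfun_compose_add scaleR_scaleC cblinfun_compose_scaleC)

lemma bounded_bilinear_cblinfun_apply: "bounded_bilinear cblinfun_apply"
proof
  show "\<exists>K. \<forall>A x. norm (cblinfun_apply A x) \<le> norm A * norm x * K"
    by (rule exI[of _ 1]) (simp add: norm_cblinfun)
qed (simp_all add: cblinfun_linear_simps cblinfun_rep_simps scaleR_scaleC)

lemma cblinfun_compose_sum_left: "sum f I \<circ>\<^sub>L A = (\<Sum>i\<in>I. f i \<circ>\<^sub>L A)"
  by (rule bounded_bilinear.sum_left[OF bounded_bilinear_cblinfun_compose])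

lemma cblinfun_compose_sum_right: "A \<circ>\<^sub>L sum f I = (\<Sum>i\<in>I. A \<circ>\<^sub>L f i)"
  by (rule bounded_bilinear.sum_right[OF bounded_bilinear_cblinfun_compose])

lemma cblinfun_power_add:
  "cblinfun_power T (m + n) = cblinfun_power T m \<circ>\<^sub>L cblinfun_power T n"
  by (induction m) (simp_all add: cblinfun_compose_assoc)

lemma cblinfun_power_1 [simp]: "cblinfun_power T (Suc 0) = T"
  by simp

lemma cblinfun_power_Suc2: "cblinfun_power T (Suc n) = cblinfun_power T n \<circ>\<^sub>L T"
  using cblinfun_power_add[of T n 1] by simp

lemma cblinfun_power_mult: "cblinfun_power (cblinfun_power T m) n = cblinfun_power T (m * n)"
  by (induction n) (simp_all add: cblinfun_power_add)

lemma cblinfun_power_Suc_apply: "cblinfun_power T (Suc n) x = T (cblinfun_power T n x)"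
  "cblinfun_power T (Suc n) x = cblinfun_power T n (T x)"
  by (simp only: cblinfun_power.simps cblinfun_compose.rep_eq)
    (simp only: cblinfun_power_Suc2 cblinfun_compose.rep_eq)

lemma tendsto_cblinfun_power:
  "(F \<longlongrightarrow> T) net \<Longrightarrow> ((\<lambda>n. cblinfun_power (F n) j) \<longlongrightarrow> cblinfun_power T j) net"
  by (induction j) (auto intro: bounded_bilinear.tendsto[OF bounded_bilinear_cblinfun_compose])

lemma norm_rank_one: "norm (rank_one x' x) \<le> norm x' * norm x"
  using mult_right_mono[OF norm_cblinfun[of x'], of "norm x"]
  by (intro norm_cblinfun_bound) (auto simp: rank_one.rep_eq norm_scaleC ac_simps)

lemma compose_rank_one: "A \<circ>\<^sub>L rank_one x' x = rank_one x' (A x)"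
  by (rule cblinfun_eqI) (simp add: cblinfun_rep_simps cblinfun_linear_simps)

lemma rank_one_compose: "rank_one x' x \<circ>\<^sub>L A = rank_one (x' \<circ>\<^sub>L A) x"
  by (rule cblinfun_eqI) (simp add: cblinfun_rep_simps)


section \<open>Nuclear representations\<close>

lemma norm_ptensor: "norm (x \<otimes>\<^sub>\<pi> y) \<le> norm x * norm y"
  using proj_norm_le[of "[(x, y)]"] by (simp add: ptensor_def norm_proj_embed)

text \<open>A representation at the level of operators, convergent in operator norm; the tensor
  behind it is recovered by \<open>nuclear_rep_tensor\<close>.\<close>

definition nuclear_rep ::
  "real \<Rightarrow> (nat \<Rightarrow> 'a dual) \<Rightarrow> (nat \<Rightarrow> 'a::complex_banach) \<Rightarrow> ('a \<Rightarrow>\<^sub>C\<^sub>L 'a) \<Rightarrow> bool"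
  where "nuclear_rep s x' x S \<longleftrightarrow>
    summable (\<lambda>k. norm (x' k) powr s * norm (x k) powr s) \<and> (\<lambda>k. rank_one (x' k) (x k)) sums S"

lemma summable_of_summable_powr:
  fixes a :: "nat \<Rightarrow> real"
  assumes a: "\<And>k. 0 \<le> a k" and s: "0 < s" "s \<le> 1" and sm: "summable (\<lambda>k. a k powr s)"
  shows "summable a"
proof -
  have "\<forall>\<^sub>F k in sequentially. a k powr s < 1"
    using summable_LIMSEQ_zero[OF sm] by (rule order_tendstoD) simp
  then have "\<forall>\<^sub>F k in sequentially. norm (a k) \<le> a k powr s"
  proof eventually_elim
    case (elim k)
    have "a k \<le> 1"
      using elim ge_one_powr_ge_zero[of "a k" s] s by fastforce
    then show ?case
      using a[of k] s powr_mono'[of s 1 "a k"] by (cases "a k = 0") auto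
  qed
  then show ?thesis
    using sm by (rule summable_comparison_test_ev)
qed

lemma nuclear_rep_summable:
  assumes "0 < s" "s \<le> 1" "nuclear_rep s x' x S"
  shows "summable (\<lambda>k. norm (x' k) * norm (x k))"
proof (rule summable_of_summable_powr[OF _ assms(1,2)])
  show "summable (\<lambda>k. (norm (x' k) * norm (x k)) powr s)"
    using assms(3) unfolding nuclear_rep_def powr_mult by (rule conjunct1)
qed simp

lemma nuclear_rep_1_iff:
  "nuclear_rep 1 x' x S \<longleftrightarrow>
    summable (\<lambda>k. norm (x' k) * norm (x k)) \<and> (\<lambda>k. rank_one (x' k) (x k)) sums S"
  by (simp add: nuclear_rep_def)

lemma nuclear_rep_apply:
  "nuclear_rep s x' x S \<Longrightarrow> (\<lambda>k. cblinfun_apply (x' k) z *\<^sub>C x k) sums S z"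
  using sums_cblinfun_apply[of "\<lambda>k. rank_one (x' k) (x k)" S z]
  by (simp add: nuclear_rep_def rank_one.rep_eq)

lemma summable_rank_one:
  fixes x :: "nat \<Rightarrow> 'b::complex_banach"
  shows "summable (\<lambda>k. norm (x' k) * norm (x k)) \<Longrightarrow> summable (\<lambda>k. rank_one (x' k) (x k))"
  by (rule summable_comparison_test'[where N = 0]) (auto intro: norm_rank_one)

lemma summable_ptensor:
  fixes x :: "nat \<Rightarrow> 'b::complex_banach" and x' :: "nat \<Rightarrow> 'a::complex_normed_vector"
  shows "summable (\<lambda>k. norm (x' k) * norm (x k)) \<Longrightarrow> summable (\<lambda>k. x' k \<otimes>\<^sub>\<pi> x k)"
  by (rule summable_comparison_test'[where N = 0]) (auto intro: norm_ptensor)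

lemma nuclear_rep_of_sums:
  assumes "summable (\<lambda>k. norm (x' k) powr s * norm (x k) powr s)" "(\<lambda>k. x' k \<otimes>\<^sub>\<pi> x k) sums u"
  shows "nuclear_rep s x' x (tensor_operator u)"
  using assms cblinfun_apply_sums[OF assms(2), of tensor_operator]
  by (simp add: nuclear_rep_def tensor_operator_ptensor)

text \<open>For s \<le> 1 an s-summable series is absolutely summable, so the tensor series
  converges by completeness; its operator is S because sums are unique.\<close>

lemma nuclear_rep_tensor:
  assumes "0 < s" "s \<le> 1" "nuclear_rep s x' x S"
  obtains u where "u \<in> s_tensors s" "tensor_operator u = S" "(\<lambda>k. x' k \<otimes>\<^sub>\<pi> x k) sums u"
proof -
  obtain u where u: "(\<lambda>k. x' k \<otimes>\<^sub>\<pi> x k) sums u"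
    using summable_ptensor[OF nuclear_rep_summable[OF assms]] by (auto simp: summable_def)
  have "nuclear_rep s x' x (tensor_operator u)"
    using assms(3) u by (intro nuclear_rep_of_sums) (auto simp: nuclear_rep_def)
  then have "tensor_operator u = S"
    using assms(3) sums_unique2 by (auto simp: nuclear_rep_def)
  then show ?thesis
    using that u assms(3) by (auto simp: s_tensors_def nuclear_rep_def)
qed

lemma s_nuclear_iff:
  assumes "0 < s" "s \<le> 1"
  shows "s_nuclear s S \<longleftrightarrow> (\<exists>x' x. nuclear_rep s x' x S)"
proof
  assume "s_nuclear s S"
  then show "\<exists>x' x. nuclear_rep s x' x S"
    unfolding s_nuclear_def s_tensors_def using nuclear_rep_of_sums by blast
next
  assume "\<exists>x' x. nuclear_rep s x' x S"
  then show "s_nuclear s S"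
    using nuclear_rep_tensor[OF assms] unfolding s_nuclear_def image_def by blast
qed

text \<open>The working description of \<open>op_trace\<close>: once AP_s is known, any s-summable
  representation may be used to compute it.\<close>

lemma op_trace_sums:
  assumes "0 < s" "s \<le> 1" "approx_property TYPE('a::complex_banach) s"
    and "nuclear_rep s x' (x :: nat \<Rightarrow> 'a) S"
  shows "(\<lambda>k. cblinfun_apply (x' k) (x k)) sums op_trace S"
proof -
  obtain u where u: "u \<in> s_tensors s" "tensor_operator u = S" "(\<lambda>k. x' k \<otimes>\<^sub>\<pi> x k) sums u"
    using nuclear_rep_tensor[OF assms(1,2,4)] .
  then show ?thesis
    using op_trace_eq[OF assms(1-3) u(1)] tensor_trace_sums[OF u(3)] by simp
qed

lemma nuclear_rep_compose_left:
  fixes A S :: "'a::complex_banach \<Rightarrow>\<^sub>C\<^sub>L 'a"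
  assumes "0 < s" "nuclear_rep s x' x S"
  shows "nuclear_rep s x' (\<lambda>k. A (x k)) (A \<circ>\<^sub>L S)"
  unfolding nuclear_rep_def
proof
  have sm: "summable (\<lambda>k. norm A powr s * (norm (x' k) powr s * norm (x k) powr s))"
    using assms by (intro summable_mult) (simp add: nuclear_rep_def)
  show "summable (\<lambda>k. norm (x' k) powr s * norm (A (x k)) powr s)"
  proof (rule summable_comparison_test'[OF sm, where N = 0])
    fix k
    have "norm (A (x k)) powr s \<le> norm A powr s * norm (x k) powr s"
      using assms(1) by (auto simp: powr_mult[symmetric] intro!: powr_mono2 norm_cblinfun)
    then have "norm (x' k) powr s * norm (A (x k)) powr s
        \<le> norm (x' k) powr s * (norm A powr s * norm (x k) powr s)"
      by (rule mult_left_mono) simp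
    then show "norm (norm (x' k) powr s * norm (A (x k)) powr s)
        \<le> norm A powr s * (norm (x' k) powr s * norm (x k) powr s)"
      by (simp add: ac_simps)
  qed
  show "(\<lambda>k. rank_one (x' k) (A (x k))) sums (A \<circ>\<^sub>L S)"
    using bounded_linear.sums[OF bounded_bilinear.bounded_linear_right[OF bounded_bilinear_cblinfun_compose]]
      assms(2) by (fastforce simp: nuclear_rep_def compose_rank_one)
qed

lemma nuclear_rep_compose_right:
  fixes A S :: "'a::complex_banach \<Rightarrow>\<^sub>C\<^sub>L 'a"
  assumes "0 < s" "nuclear_rep s x' x S"
  shows "nuclear_rep s (\<lambda>k. x' k \<circ>\<^sub>L A) x (S \<circ>\<^sub>L A)"
  unfolding nuclear_rep_def
proof
  have sm: "summable (\<lambda>k. norm A powr s * (norm (x' k) powr s * norm (x k) powr s))"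
    using assms by (intro summable_mult) (simp add: nuclear_rep_def)
  show "summable (\<lambda>k. norm (x' k \<circ>\<^sub>L A) powr s * norm (x k) powr s)"
  proof (rule summable_comparison_test'[OF sm, where N = 0])
    fix k
    have "norm (x' k \<circ>\<^sub>L A) powr s \<le> norm (x' k) powr s * norm A powr s"
      using assms(1) by (auto simp: powr_mult[symmetric] intro!: powr_mono2 norm_cblinfun_compose)
    then have "norm (x' k \<circ>\<^sub>L A) powr s * norm (x k) powr s
        \<le> norm (x' k) powr s * norm A powr s * norm (x k) powr s"
      by (rule mult_right_mono) simp
    then show "norm (norm (x' k \<circ>\<^sub>L A) powr s * norm (x k) powr s)
        \<le> norm A powr s * (norm (x' k) powr s * norm (x k) powr s)"
      by (simp add: ac_simps)
  qed
  show "(\<lambda>k. rank_one (x' k \<circ>\<^sub>L A) (x k)) sums (S \<circ>\<^sub>L A)"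
    using bounded_linear.sums[OF bounded_bilinear.bounded_linear_left[OF bounded_bilinear_cblinfun_compose]]
      assms(2) by (fastforce simp: nuclear_rep_def rank_one_compose[symmetric])
qed

lemma s_nuclear_compose:
  fixes A S :: "'a::complex_banach \<Rightarrow>\<^sub>C\<^sub>L 'a"
  assumes "0 < s" "s \<le> 1" "s_nuclear s S"
  shows "s_nuclear s (A \<circ>\<^sub>L S)" "s_nuclear s (S \<circ>\<^sub>L A)"
  using assms nuclear_rep_compose_left nuclear_rep_compose_right by (metis s_nuclear_iff)+

lemma s_nuclear_power_mono:
  assumes "0 < s" "s \<le> 1" "s_nuclear s (cblinfun_power T m)" "m \<le> n"
  shows "s_nuclear s (cblinfun_power T n)"
  using s_nuclear_compose(2)[OF assms(1-3), of "cblinfun_power T (n - m)"] assms(4)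
  by (simp flip: cblinfun_power_add)

text \<open>Rescaling moves half of the weight of each term to either side. Summability of the
  products becomes square summability of the vectors, which is the factorisation through a
  Hilbert-Schmidt operator.\<close>

lemma nuclear_balanced_rep:
  fixes S :: "'a::complex_banach \<Rightarrow>\<^sub>C\<^sub>L 'a"
  assumes "nuclear S"
  obtains x' :: "nat \<Rightarrow> 'a dual" and x :: "nat \<Rightarrow> 'a"
  where "\<And>k. norm (x' k) = norm (x k)" "summable (\<lambda>k. (norm (x k))\<^sup>2)"
    "(\<lambda>k. rank_one (x' k) (x k)) sums S"
proof -
  obtain y' :: "nat \<Rightarrow> 'a dual" and y :: "nat \<Rightarrow> 'a" where y: "nuclear_rep 1 y' y S"
    using assms s_nuclear_iff[of 1 S] by auto
  define c where "c k = sqrt (norm (y k) / norm (y' k))" for k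
  define d where "d k = sqrt (norm (y' k) / norm (y k))" for k
  define x' where "x' k = complex_of_real (c k) *\<^sub>C y' k" for k
  define x where "x k = complex_of_real (d k) *\<^sub>C y k" for k
  have c: "0 \<le> c k" and d: "0 \<le> d k" for k by (auto simp: c_def d_def)
  have sq: "a / sqrt a = sqrt a" if "0 \<le> a" for a :: real
    using that by (metis real_div_sqrt)
  have nx': "norm (x' k) = sqrt (norm (y' k) * norm (y k))" for k
  proof -
    have "norm (x' k) = c k * norm (y' k)" using c[of k] by (simp add: x'_def norm_scaleC)
    also have "\<dots> = sqrt (norm (y k)) * (norm (y' k) / sqrt (norm (y' k)))"
      by (simp add: c_def real_sqrt_divide)
    finally show ?thesis by (simp add: sq real_sqrt_mult mult.commute)
  qed
  have nx: "norm (x k) = sqrt (norm (y' k) * norm (y k))" for k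
  proof -
    have "norm (x k) = d k * norm (y k)" using d[of k] by (simp add: x_def norm_scaleC)
    also have "\<dots> = sqrt (norm (y' k)) * (norm (y k) / sqrt (norm (y k)))"
      by (simp add: d_def real_sqrt_divide)
    finally show ?thesis by (simp add: sq real_sqrt_mult)
  qed
  have "rank_one (x' k) (x k) = rank_one (y' k) (y k)" for k
  \<comment> \<open>Since x / 0 = 0, both \<open>c k\<close> and \<open>d k\<close> vanish as soon
    as one factor is zero, and then both rescaled factors are zero.\<close>
  proof (cases "y' k = 0 \<or> y k = 0")
    case True
    then show ?thesis
      by (intro cblinfun_eqI) (auto simp: x'_def x_def cblinfun_rep_simps cblinfun_linear_simps)
  next
    case False
    then have "c k * d k = 1"
      by (simp add: c_def d_def real_sqrt_mult[symmetric])
    then have "complex_of_real (c k) * complex_of_real (d k) = 1"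
      by (metis of_real_1 of_real_mult)
    then show ?thesis
      by (intro cblinfun_eqI) (auto simp: x'_def x_def cblinfun_rep_simps cblinfun_linear_simps
          scaleC_scaleC scaleC_complex_def ac_simps)
  qed
  then have "(\<lambda>k. rank_one (x' k) (x k)) sums S"
    using y by (simp add: nuclear_rep_def)
  moreover have "summable (\<lambda>k. (norm (x k))\<^sup>2)"
    using y by (simp add: nx nuclear_rep_def)
  ultimately show ?thesis
    using that nx nx' by metis
qed

text \<open>The two iterated sums of \<open>x'\<^sub>k(y\<^sub>j) y'\<^sub>j(x\<^sub>k)\<close> compute the trace of the product from a
  representation of either factor, although the first one need not be \<open>s\<close>-summable.\<close>

lemma op_trace_compose_sums:
  fixes S R :: "'a::complex_banach \<Rightarrow>\<^sub>C\<^sub>L 'a"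
  assumes s: "0 < s" "s \<le> 1" and AP: "approx_property TYPE('a) s"
    and S: "nuclear_rep 1 x' x S" and R: "s_nuclear s R"
  shows "(\<lambda>k. cblinfun_apply (x' k) (R (x k))) sums op_trace (S \<circ>\<^sub>L R)"
proof -
  obtain y' y where y: "nuclear_rep s y' y R" using R s s_nuclear_iff by blast
  define f where "f = (\<lambda>(j, k). cblinfun_apply (x' k) (y j) * cblinfun_apply (y' j) (x k))"
  have sx: "(\<lambda>k. norm (x' k) * norm (x k)) summable_on UNIV"
    using S by (intro norm_summable_imp_summable_on) (simp add: nuclear_rep_1_iff)
  have sy: "(\<lambda>k. norm (y' k) * norm (y k)) summable_on UNIV"
    using nuclear_rep_summable[OF s y] by (intro norm_summable_imp_summable_on) simp
  have "(\<lambda>(j, k). (norm (y' j) * norm (y j)) * (norm (x' k) * norm (x k))) summable_on UNIV \<times> UNIV"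
    using sx sy
    by (intro summable_on_SigmaI[where g = "\<lambda>j. norm (y' j) * norm (y j) * (\<Sum>\<^sub>\<infinity>k. norm (x' k) * norm (x k))"])
      (auto intro!: has_sum_cmult_right summable_on_cmult_left)
  then have "(\<lambda>p. norm (f p)) summable_on UNIV \<times> UNIV"
  proof (rule summable_on_comparison_test)
    fix p :: "nat \<times> nat" assume "p \<in> UNIV \<times> UNIV"
    obtain j k where p: "p = (j, k)" by (cases p)
    have "norm (cblinfun_apply (x' k) (y j)) * norm (cblinfun_apply (y' j) (x k))
        \<le> (norm (x' k) * norm (y j)) * (norm (y' j) * norm (x k))"
      by (intro mult_mono norm_cblinfun) auto
    then show "norm (f p) \<le> (case p of (j, k) \<Rightarrow> (norm (y' j) * norm (y j)) * (norm (x' k) * norm (x k)))"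
      by (simp add: f_def p norm_mult ac_simps)
  qed simp
  then have f: "f summable_on UNIV \<times> UNIV"
    by (rule abs_summable_summable)
  then obtain c where c: "(f has_sum c) (UNIV \<times> UNIV)"
    by (auto simp: summable_on_def)
  then have c': "((\<lambda>(k, j). f (j, k)) has_sum c) (UNIV \<times> UNIV)"
    by (subst (asm) has_sum_swap) 
  have row: "((\<lambda>k. f (j, k)) has_sum cblinfun_apply (y' j) (S (y j))) UNIV" for j
  proof -
    have "(\<lambda>k. f (j, k)) summable_on UNIV"
      using f summable_on_SigmaD1[of "\<lambda>j k. f (j, k)" UNIV "\<lambda>_. UNIV" j] by auto
    moreover have "(\<lambda>k. f (j, k)) sums cblinfun_apply (y' j) (S (y j))"
      using cblinfun_apply_sums[OF nuclear_rep_apply[OF S], of "y' j" "y j"]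
      by (simp add: f_def cblinfun_linear_simps scaleC_complex_def)
    ultimately show ?thesis
      by (metis has_sum_imp_sums has_sum_infsum sums_unique2)
  qed
  have col: "((\<lambda>j. f (j, k)) has_sum cblinfun_apply (x' k) (R (x k))) UNIV" for k
  proof -
    have "(\<lambda>j. f (j, k)) summable_on UNIV"
      using c' summable_on_SigmaD1[of "\<lambda>k j. f (j, k)" UNIV "\<lambda>_. UNIV" k]
      by (auto simp: summable_on_def)
    moreover have "(\<lambda>j. f (j, k)) sums cblinfun_apply (x' k) (R (x k))"
      using cblinfun_apply_sums[OF nuclear_rep_apply[OF y], of "x' k" "x k"]
      by (simp add: f_def cblinfun_linear_simps scaleC_complex_def mult.commute)
    ultimately show ?thesis
      by (metis has_sum_imp_sums has_sum_infsum sums_unique2)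
  qed
  have "(\<lambda>j. cblinfun_apply (y' j) (S (y j))) sums c"
    using has_sum_imp_sums[OF has_sum_SigmaD[OF c row]] .
  then have "c = op_trace (S \<circ>\<^sub>L R)"
    using op_trace_sums[OF s AP nuclear_rep_compose_left[OF s(1) y, of S]] sums_unique2 by blast
  moreover have "(\<lambda>k. cblinfun_apply (x' k) (R (x k))) sums c"
    using has_sum_imp_sums[OF has_sum_SigmaD[OF c', of "\<lambda>k. cblinfun_apply (x' k) (R (x k))"]] col
    by simp
  ultimately show ?thesis by simp
qed


section \<open>Auerbach systems in the dual\<close>

text \<open>The points \<open>e\<close> almost maximise the determinant of \<open>(g\<^sub>j(e\<^sub>i))\<close>; by Cramer's rule the dual
  functions are quotients of such determinants, hence bounded by \<open>2\<close> on \<open>V\<close>.\<close>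

lemma max_volume_points:
  fixes g :: "nat \<Rightarrow> 'a \<Rightarrow> complex" and e0 :: "nat \<Rightarrow> 'a"
  assumes bnd: "\<And>j x. j < n \<Longrightarrow> x \<in> V \<Longrightarrow> cmod (g j x) \<le> B"
    and e0: "\<And>i. i < n \<Longrightarrow> e0 i \<in> V"
    and ge0: "\<And>i j. i < n \<Longrightarrow> j < n \<Longrightarrow> g j (e0 i) = (if i = j then c0 i else 0)"
    and c0: "\<And>i. i < n \<Longrightarrow> c0 i \<noteq> 0"
  obtains e :: "nat \<Rightarrow> 'a" and c :: "nat \<Rightarrow> nat \<Rightarrow> complex"
  where "\<And>i. i < n \<Longrightarrow> e i \<in> V"
    and "\<And>i x. i < n \<Longrightarrow> x \<in> V \<Longrightarrow> cmod (\<Sum>k<n. c i k * g k x) \<le> 2"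
    and "\<And>j x. j < n \<Longrightarrow> (\<Sum>i<n. g j (e i) * (\<Sum>k<n. c i k * g k x)) = g j x"
proof -
  define A where "A e = mat n n (\<lambda>(i, j). g j (e i))" for e :: "nat \<Rightarrow> 'a"
  have A [simp]: "A e \<in> carrier_mat n n" "i < n \<Longrightarrow> j < n \<Longrightarrow> A e $$ (i, j) = g j (e i)" for e i j
    by (auto simp: A_def)
  define D where "D = {cmod (Determinant.det (A e)) | e. \<forall>i<n. e i \<in> V}"
  have detbound: "cmod (Determinant.det (A e)) \<le> (\<Sum>p | p permutes {0..<n}. \<bar>B\<bar> ^ n)"
    if e: "\<forall>i<n. e i \<in> V" for e
  proof -
    have "cmod (Determinant.det (A e)) \<le>
        (\<Sum>p | p permutes {0..<n}. cmod (signof p * (\<Prod>i = 0..<n. A e $$ (i, p i))))"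
      unfolding det_def'[OF A(1)] by (rule norm_sum)
    also have "\<dots> \<le> (\<Sum>p | p permutes {0..<n}. \<bar>B\<bar> ^ n)"
    proof (rule sum_mono)
      fix p assume "p \<in> {p. p permutes {0..<n}}"
      then have p: "i < n \<Longrightarrow> p i < n" for i by (auto dest: permutes_in_image)
      have "cmod (\<Prod>i = 0..<n. A e $$ (i, p i)) = (\<Prod>i = 0..<n. cmod (g (p i) (e i)))"
        using p by (simp add: prod_norm[symmetric])
      also have "\<dots> \<le> (\<Prod>i = 0..<n. \<bar>B\<bar>)"
        using e p bnd by (intro prod_mono) (fastforce intro: order_trans[OF _ abs_ge_self])
      finally have "cmod (\<Prod>i = 0..<n. A e $$ (i, p i)) \<le> \<bar>B\<bar> ^ n" by simp
      then show "cmod (signof p * (\<Prod>i = 0..<n. A e $$ (i, p i))) \<le> \<bar>B\<bar> ^ n"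
        by (simp add: norm_mult sign_def)
    qed
    finally show ?thesis .
  qed
  then have bdd: "bdd_above D" unfolding D_def by (intro bdd_aboveI) auto
  define S where "S = Sup D"
  have D_le: "cmod (Determinant.det (A e)) \<le> S" if "\<forall>i<n. e i \<in> V" for e
    unfolding S_def using that bdd by (intro cSup_upper) (auto simp: D_def)
  have "Determinant.det (A e0) = prod_list (diag_mat (A e0))"
    using ge0 by (intro det_upper_triangular[of _ n] upper_triangularI) (auto simp: A_def)
  also have "\<dots> = (\<Prod>i = 0..<n. c0 i)"
    unfolding prod_list_diag_prod by (rule prod.cong) (auto simp: A_def ge0)
  finally have "Determinant.det (A e0) \<noteq> 0" using c0 by simp
  then have S: "0 < S"
    using D_le[of e0] e0 zero_less_norm_iff by (metis order_less_le_trans)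
  have "D \<noteq> {}" using e0 by (auto simp: D_def)
  \<comment> \<open>The supremum need not be attained, as V need not be compact; a point within a
    factor 2 of it gives the bound 2 in place of 1.\<close>
  then obtain z where "z \<in> D" "S / 2 < z"
    using S less_cSup_iff[OF _ bdd, of "S / 2"] by (auto simp: S_def)
  then obtain e where e: "\<forall>i<n. e i \<in> V" and eS: "S / 2 < cmod (Determinant.det (A e))"
    by (auto simp: D_def)
  define \<Delta> where "\<Delta> = Determinant.det (A e)"
  have \<Delta>: "\<Delta> \<noteq> 0" using eS S by (auto simp: \<Delta>_def)
  define c where "c i k = cofactor (A e) i k / \<Delta>" for i k
  \<comment> \<open>Cramer's rule: replacing the point \<open>e i\<close> changes row i only, hence
    none of the cofactors along that row.\<close>
  have h: "(\<Sum>k<n. c i k * g k x) = Determinant.det (A (e(i := x))) / \<Delta>" if i: "i < n" for i x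
  proof -
    have "cofactor (A (e(i := x))) i k = cofactor (A e) i k" for k
      unfolding cofactor_def mat_delete_def using i
      by (intro arg_cong2[where f = "(*)"] refl arg_cong[where f = Determinant.det] eq_matI) (auto simp: A_def)
    then show ?thesis
      unfolding laplace_expansion_row[OF A(1) i, of "e(i := x)"] using i
      by (simp add: c_def sum_divide_distrib mult.commute)
  qed
  show ?thesis
  proof (rule that[of e c])
    show "i < n \<Longrightarrow> e i \<in> V" for i using e by blast
    show "cmod (\<Sum>k<n. c i k * g k x) \<le> 2" if "i < n" "x \<in> V" for i x
    proof -
      have "cmod (Determinant.det (A (e(i := x)))) \<le> S" using e that by (intro D_le) auto
      then show ?thesis
        using eS \<Delta> by (simp add: h[OF that(1)] norm_divide divide_le_eq flip: \<Delta>_def)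
    qed
    show "(\<Sum>i<n. g j (e i) * (\<Sum>k<n. c i k * g k x)) = g j x" if j: "j < n" for j x
    proof -
      \<comment> \<open>The adjugate inverts the matrix up to \<Delta>, so the dual functions
        reproduce every \<open>g j\<close>.\<close>
      have adj: "(\<Sum>i<n. cofactor (A e) i k * g j (e i)) = (if k = j then \<Delta> else 0)" if k: "k < n" for k
      proof -
        have "(adj_mat (A e) * A e) $$ (k, j) = (\<Delta> \<cdot>\<^sub>m 1\<^sub>m n) $$ (k, j)"
          using adj_mat(3)[OF A(1)] by (simp add: \<Delta>_def)
        moreover have "(adj_mat (A e) * A e) $$ (k, j) = (\<Sum>i<n. cofactor (A e) i k * g j (e i))"
          using j k adj_mat(1)[OF A(1), of e]
          by (subst index_mult_mat) (auto simp: scalar_prod_def adj_mat_def A_def atLeast0LessThan)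
        ultimately show ?thesis using j k by simp
      qed
      have "(\<Sum>i<n. g j (e i) * (\<Sum>k<n. c i k * g k x))
          = (\<Sum>k<n. (\<Sum>i<n. cofactor (A e) i k * g j (e i)) * g k x / \<Delta>)"
        unfolding c_def sum_distrib_left sum_distrib_right sum_divide_distrib
        by (subst sum.swap) (simp add: ac_simps)
      also have "\<dots> = (\<Sum>k<n. if k = j then g j x else 0)"
        using \<Delta> by (intro sum.cong) (auto simp: adj)
      finally show ?thesis using j by simp
    qed
  qed
qed

text \<open>Induction on the set. Subtracting from b its part along B leaves a nonzero functional f;
  a point where f does not vanish, moved into the common kernel of B, is seen by b alone.\<close>

lemma independent_functionals_dual_points:
  fixes B :: "'a::complex_normed_vector dual set"
  assumes "finite B" "complex_vector.independent B"
  shows "\<exists>e. \<forall>f\<in>B. \<forall>g\<in>B. cblinfun_apply g (e f) = (if f = g then 1 else 0)"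
  using assms
proof (induction B rule: finite_induct)
  case (insert b B)
  then have "complex_vector.independent B" and nspan: "b \<notin> complex_vector.span B"
    by (auto simp: complex_vector.independent_insert)
  then obtain e where e: "\<And>f g. f \<in> B \<Longrightarrow> g \<in> B \<Longrightarrow> cblinfun_apply g (e f) = (if f = g then 1 else 0)"
    using insert.IH by blast
  define f where "f = b - (\<Sum>g\<in>B. cblinfun_apply b (e g) *\<^sub>C g)"
  have "(\<Sum>g\<in>B. cblinfun_apply b (e g) *\<^sub>C g) \<in> complex_vector.span B"
    by (intro complex_vector.span_sum complex_vector.span_scale complex_vector.span_base)
  then have "f \<noteq> 0" using nspan by (auto simp: f_def)
  then obtain x where x: "f x \<noteq> 0"
    by (metis cblinfun_eqI zero_cblinfun.rep_eq)
  define y where "y = x - (\<Sum>g\<in>B. cblinfun_apply g x *\<^sub>C e g)"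
  have gy: "g y = 0" if "g \<in> B" for g
  proof -
    have "g (\<Sum>g\<in>B. cblinfun_apply g x *\<^sub>C e g) = (\<Sum>g'\<in>B. cblinfun_apply g' x * (if g' = g then 1 else 0))"
      using that e by (simp add: cblinfun_apply_sum cblinfun_linear_simps scaleC_complex_def)
    also have "\<dots> = g x" using that insert.hyps by (simp add: if_distrib[of "\<lambda>c. _ * c"] cong: if_cong)
    finally show ?thesis by (simp add: y_def cblinfun_linear_simps)
  qed
  have "b y = f x"
    by (simp add: y_def f_def cblinfun_linear_simps cblinfun_rep_simps cblinfun_apply_sum
        sum_cblinfun_apply scaleC_complex_def mult.commute)
  then have by0: "b y \<noteq> 0" using x by simp
  define z where "z = inverse (b y) *\<^sub>C y"
  have z: "b z = 1" "\<And>g. g \<in> B \<Longrightarrow> g z = 0"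
    using by0 gy by (auto simp: z_def cblinfun_linear_simps scaleC_complex_def)
  \<comment> \<open>The old points are corrected along z so that b vanishes on them.\<close>
  define e' where "e' f = (if f = b then z else e f - b (e f) *\<^sub>C z)" for f
  have "cblinfun_apply g (e' f) = (if f = g then 1 else 0)" if "f \<in> insert b B" "g \<in> insert b B" for f g
    using that z e insert.hyps
    by (auto simp: e'_def cblinfun_linear_simps scaleC_complex_def)
  then show ?case by blast
qed simp

lemma dual_norm_le_of_unit_ball:
  fixes h :: "'a::complex_normed_vector dual"
  assumes "0 \<le> b" "\<And>x. norm x \<le> 1 \<Longrightarrow> cmod (h x) \<le> b"
  shows "norm h \<le> b"
proof (rule norm_cblinfun_bound[OF assms(1)])
  fix x
  show "norm (h x) \<le> b * norm x"
  proof (cases "x = 0")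
    case False
    have "cmod (h (complex_of_real (inverse (norm x)) *\<^sub>C x)) \<le> b"
      using False by (intro assms(2)) (simp add: norm_scaleC norm_inverse)
    then show ?thesis
      using False by (simp add: cblinfun_linear_simps scaleC_complex_def norm_divide divide_le_eq field_simps)
  qed (simp add: cblinfun_linear_simps)
qed

text \<open>The last identity says that sending f to the sum of the f (e i) h i is the identity on
  G, hence on its span; the bounds 1 and 2 give this map norm at most 2 n on the dual.\<close>

lemma auerbach_system:
  fixes G :: "'a::complex_normed_vector dual set"
  assumes "finite G"
  obtains n and e :: "nat \<Rightarrow> 'a" and h :: "nat \<Rightarrow> 'a dual"
  where "n \<le> card G" "\<And>i. i < n \<Longrightarrow> norm (e i) \<le> 1" "\<And>i. i < n \<Longrightarrow> norm (h i) \<le> 2"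
    "\<And>g. g \<in> G \<Longrightarrow> g = (\<Sum>i<n. g (e i) *\<^sub>C h i)"
proof -
  obtain B where B: "B \<subseteq> G" "complex_vector.independent B" "G \<subseteq> complex_vector.span B"
    using complex_vector.maximal_independent_subset[of G] by blast
  then have fin: "finite B" using assms finite_subset by blast
  define n where "n = card B"
  obtain g where g: "bij_betw g {..<n} B"
    using fin ex_bij_betw_nat_finite[of B] by (auto simp: n_def atLeast0LessThan)
  then have gB: "i < n \<Longrightarrow> g i \<in> B" for i by (auto simp: bij_betw_def)
  have ginj: "i < n \<Longrightarrow> j < n \<Longrightarrow> g i = g j \<longleftrightarrow> i = j" for i j
    using g by (auto simp: bij_betw_def inj_on_def)
  obtain \<epsilon> where \<epsilon>: "\<And>f g. f \<in> B \<Longrightarrow> g \<in> B \<Longrightarrow> cblinfun_apply g (\<epsilon> f) = (if f = g then 1 else 0)"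
    using independent_functionals_dual_points[OF fin B(2)] by blast
  define r where "r i = inverse (norm (\<epsilon> (g i)) + 1)" for i
  define V where "V = {x :: 'a. norm x \<le> 1}"
  define M where "M = (\<Sum>i<n. norm (g i))"
  obtain e c where e: "\<And>i. i < n \<Longrightarrow> e i \<in> V"
    and bound: "\<And>i x. i < n \<Longrightarrow> x \<in> V \<Longrightarrow> cmod (\<Sum>k<n. c i k * g k x) \<le> 2"
    and rep: "\<And>j x. j < n \<Longrightarrow> (\<Sum>i<n. g j (e i) * (\<Sum>k<n. c i k * g k x)) = g j x"
  proof (rule max_volume_points[of n V "\<lambda>j. cblinfun_apply (g j)" M
        "\<lambda>i. complex_of_real (r i) *\<^sub>C \<epsilon> (g i)" "\<lambda>i. complex_of_real (r i)"])
    have r0: "0 < r i" for i by (simp add: r_def add_nonneg_pos)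
    show "cmod (g j x) \<le> M" if "j < n" "x \<in> V" for j x
    proof -
      have "cmod (g j x) \<le> norm (g j) * norm x" by (rule norm_cblinfun)
      also have "\<dots> \<le> norm (g j)" using that by (simp add: V_def mult_left_le)
      also have "\<dots> \<le> M" unfolding M_def using that by (intro member_le_sum) auto
      finally show ?thesis .
    qed
    show "complex_of_real (r i) *\<^sub>C \<epsilon> (g i) \<in> V" for i
    proof -
      have "norm (complex_of_real (r i) *\<^sub>C \<epsilon> (g i)) = r i * norm (\<epsilon> (g i))"
        using r0[of i] by (simp add: norm_scaleC)
      also have "\<dots> \<le> 1" using norm_ge_zero[of "\<epsilon> (g i)"]
        unfolding r_def by (subst mult.commute, subst divide_inverse[symmetric], subst pos_divide_le_eq) (auto intro: add_nonneg_pos)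
      finally show ?thesis by (simp add: V_def)
    qed
    show "g j (complex_of_real (r i) *\<^sub>C \<epsilon> (g i)) = (if i = j then complex_of_real (r i) else 0)"
      if "i < n" "j < n" for i j
      using that by (simp add: cblinfun_linear_simps \<epsilon> gB ginj scaleC_complex_def)
    show "complex_of_real (r i) \<noteq> 0" for i using r0[of i] by simp
  qed blast
  define h where "h i = (\<Sum>k<n. c i k *\<^sub>C g k)" for i
  have hx: "h i x = (\<Sum>k<n. c i k * g k x)" for i x
    by (simp add: h_def sum_cblinfun_apply scaleC_cblinfun.rep_eq scaleC_complex_def)
  have gspan: "f = (\<Sum>i<n. f (e i) *\<^sub>C h i)" if "f \<in> complex_vector.span B" for f
    using that
  proof (induction rule: complex_vector.span_induct_alt)
    case base
    then show ?case by (simp add: zero_cblinfun.rep_eq)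
  next
    case (step a f f')
    obtain j where j: "j < n" "f = g j" using step(1) g by (auto simp: bij_betw_def)
    have "f = (\<Sum>i<n. f (e i) *\<^sub>C h i)"
      by (rule cblinfun_eqI)
        (simp add: sum_cblinfun_apply scaleC_cblinfun.rep_eq scaleC_complex_def hx rep j)
    then have "a *\<^sub>C f + f' = a *\<^sub>C (\<Sum>i<n. f (e i) *\<^sub>C h i) + (\<Sum>i<n. f' (e i) *\<^sub>C h i)"
      using step(2) by simp
    also have "\<dots> = (\<Sum>i<n. (a *\<^sub>C f + f') (e i) *\<^sub>C h i)"
      by (simp add: complex_vector.scale_sum_right sum.distrib scaleC_add_left scaleC_scaleC
          scaleC_complex_def cblinfun_rep_simps)
    finally show ?case .
  qed
  show ?thesis
  proof (rule that[of n e h])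
    show "n \<le> card G" using B(1) assms by (simp add: n_def card_mono)
    show "norm (e i) \<le> 1" if "i < n" for i using e[OF that] by (simp add: V_def)
    show "norm (h i) \<le> 2" if "i < n" for i
      using bound[OF that] by (intro dual_norm_le_of_unit_ball) (auto simp: hx V_def)
    show "f = (\<Sum>i<n. f (e i) *\<^sub>C h i)" if "f \<in> G" for f using gspan B(3) that by blast
  qed
qed


section \<open>The approximation property of order one third\<close>

lemma ptensor_add_left: "(x + x') \<otimes>\<^sub>\<pi> y = x \<otimes>\<^sub>\<pi> y + x' \<otimes>\<^sub>\<pi> y"
proof -
  have "abs_alg_tensor [(x + x', y)] = abs_alg_tensor [(x, y)] + abs_alg_tensor [(x', y)]"
    by (auto simp: plus_alg_tensor.abs_eq alg_tensor.abs_eq_iff cbilinear_iff)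
  then show ?thesis by (simp add: ptensor_def flip: proj_embed_add)
qed

lemma ptensor_add_right: "x \<otimes>\<^sub>\<pi> (y + y') = x \<otimes>\<^sub>\<pi> y + x \<otimes>\<^sub>\<pi> y'"
proof -
  have "abs_alg_tensor [(x, y + y')] = abs_alg_tensor [(x, y)] + abs_alg_tensor [(x, y')]"
    by (auto simp: plus_alg_tensor.abs_eq alg_tensor.abs_eq_iff cbilinear_iff)
  then show ?thesis by (simp add: ptensor_def flip: proj_embed_add)
qed

lemma ptensor_scaleC_left: "(c *\<^sub>C x) \<otimes>\<^sub>\<pi> y = c *\<^sub>C (x \<otimes>\<^sub>\<pi> y)"
  by (simp add: ptensor_def scaleC_alg_tensor.abs_eq flip: proj_embed_scale)

lemma ptensor_scaleC_right: "x \<otimes>\<^sub>\<pi> (c *\<^sub>C y) = c *\<^sub>C (x \<otimes>\<^sub>\<pi> y)"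
proof -
  have "abs_alg_tensor [(x, c *\<^sub>C y)] = abs_alg_tensor [(c *\<^sub>C x, y)]"
    by (auto simp: alg_tensor.abs_eq_iff cbilinear_iff)
  then have "x \<otimes>\<^sub>\<pi> (c *\<^sub>C y) = (c *\<^sub>C x) \<otimes>\<^sub>\<pi> y" by (simp add: ptensor_def)
  then show ?thesis by (simp add: ptensor_scaleC_left)
qed

lemma bounded_bilinear_ptensor: "bounded_bilinear ptensor"
proof
  show "\<exists>K. \<forall>x y. norm (x \<otimes>\<^sub>\<pi> y) \<le> norm x * norm y * K"
    by (rule exI[of _ 1]) (simp add: norm_ptensor)
qed (simp_all add: ptensor_add_left ptensor_add_right ptensor_scaleC_left ptensor_scaleC_right scaleR_scaleC)

lemmas ptensor_diff_left = bounded_bilinear.diff_left[OF bounded_bilinear_ptensor]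
lemmas ptensor_sum_left = bounded_bilinear.sum_left[OF bounded_bilinear_ptensor]

text \<open>The first factors are projected: terms in F cancel, the others are multiplied by at most
  1 + 2 n. The subtracted tensor depends on u only through its operator, which makes tensors with
  the same operator comparable.\<close>

lemma tensor_minus_projection_bound:
  fixes x' :: "nat \<Rightarrow> 'a::complex_banach dual" and x :: "nat \<Rightarrow> 'a" and h :: "nat \<Rightarrow> 'a dual"
  assumes sm: "summable (\<lambda>k. norm (x' k) * norm (x k))" and u: "(\<lambda>k. x' k \<otimes>\<^sub>\<pi> x k) sums u"
    and e: "\<And>i. i < n \<Longrightarrow> norm (e i) \<le> 1" and h: "\<And>i. i < n \<Longrightarrow> norm (h i) \<le> 2"
    and rep: "\<And>k. k \<in> F \<Longrightarrow> x' k = (\<Sum>i<n. x' k (e i) *\<^sub>C h i)"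
  shows "norm (u - (\<Sum>i<n. h i \<otimes>\<^sub>\<pi> tensor_operator u (e i)))
    \<le> (1 + 2 * real n) * (\<Sum>k. if k \<in> F then 0 else norm (x' k) * norm (x k))"
proof -
  define R where "R f = (\<Sum>i<n. f (e i) *\<^sub>C h i)" for f :: "'a dual"
  have R: "norm (R f) \<le> 2 * real n * norm f" for f
  proof -
    have "norm (R f) \<le> (\<Sum>i<n. norm (f (e i) *\<^sub>C h i))" unfolding R_def by (rule norm_sum)
    also have "\<dots> \<le> (\<Sum>i<n. norm f * 2)"
    proof (intro sum_mono)
      fix i assume "i \<in> {..<n}"
      then have "cmod (f (e i)) \<le> norm f * 1" "norm (h i) \<le> 2"
        using norm_cblinfun[of f "e i"] mult_left_mono[OF e[of i], of "norm f"] h by auto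
      then show "norm (f (e i) *\<^sub>C h i) \<le> norm f * 2"
        unfolding norm_scaleC by (intro mult_mono) auto
    qed
    finally show ?thesis by (simp add: ac_simps)
  qed
  have "(\<lambda>k. \<Sum>i<n. h i \<otimes>\<^sub>\<pi> (x' k (e i) *\<^sub>C x k)) sums (\<Sum>i<n. h i \<otimes>\<^sub>\<pi> tensor_operator u (e i))"
    by (intro sums_sum bounded_linear.sums[OF bounded_bilinear.bounded_linear_right[OF bounded_bilinear_ptensor]]
        tensor_operator_sums u)
  then have "(\<lambda>k. R (x' k) \<otimes>\<^sub>\<pi> x k) sums (\<Sum>i<n. h i \<otimes>\<^sub>\<pi> tensor_operator u (e i))"
    by (simp add: R_def ptensor_sum_left ptensor_scaleC_left ptensor_scaleC_right)
  from sums_diff[OF u this]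
  have s: "(\<lambda>k. (x' k - R (x' k)) \<otimes>\<^sub>\<pi> x k) sums (u - (\<Sum>i<n. h i \<otimes>\<^sub>\<pi> tensor_operator u (e i)))"
    by (simp add: ptensor_diff_left)
  define t where "t k = (if k \<in> F then 0 else norm (x' k) * norm (x k))" for k
  have st: "summable t"
    by (rule summable_comparison_test'[OF sm, of 0]) (simp add: t_def)
  have bound: "norm ((x' k - R (x' k)) \<otimes>\<^sub>\<pi> x k) \<le> (1 + 2 * real n) * t k" for k
  proof (cases "k \<in> F")
    case True
    then have "x' k - R (x' k) = 0" using rep by (simp add: R_def)
    then have "norm ((x' k - R (x' k)) \<otimes>\<^sub>\<pi> x k) \<le> 0"
      using norm_ptensor[of "x' k - R (x' k)" "x k"] by simp
    then show ?thesis using True by (simp add: t_def)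
  next
    case False
    have "norm (x' k - R (x' k)) \<le> norm (x' k) + 2 * real n * norm (x' k)"
      using norm_triangle_ineq4[of "x' k" "R (x' k)"] R[of "x' k"] by linarith
    then have "norm (x' k - R (x' k)) * norm (x k) \<le> (norm (x' k) + 2 * real n * norm (x' k)) * norm (x k)"
      by (rule mult_right_mono) simp
    with False norm_ptensor[of "x' k - R (x' k)" "x k"] show ?thesis
      by (simp add: t_def algebra_simps)
  qed
  have smn: "summable (\<lambda>k. norm ((x' k - R (x' k)) \<otimes>\<^sub>\<pi> x k))"
    by (rule summable_comparison_test'[OF summable_mult[OF st, of "1 + 2 * real n"], of 0])
      (use bound in auto)
  have "norm (u - (\<Sum>i<n. h i \<otimes>\<^sub>\<pi> tensor_operator u (e i))) \<le> (\<Sum>k. norm ((x' k - R (x' k)) \<otimes>\<^sub>\<pi> x k))"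
    using summable_norm[OF smn] sums_unique[OF s] by simp
  also have "\<dots> \<le> (\<Sum>k. (1 + 2 * real n) * t k)"
    by (rule suminf_le[OF bound smn summable_mult[OF st]])
  also have "\<dots> = (1 + 2 * real n) * (\<Sum>k. t k)" by (rule suminf_mult[OF st])
  finally show ?thesis by (simp add: t_def)
qed

text \<open>Let B k be the cube root of b k and A the sum of B. At most A / \<delta> terms have B k
  \<ge> \<delta>, and all others satisfy b k = (B k)^3 \<le> \<delta>^2 B k. The number of large
  terms times the tail is thus O(\<delta>), which beats projections of norm O(n).\<close>

lemma large_terms_and_tail:
  fixes b :: "nat \<Rightarrow> real"
  assumes b: "\<And>k. 0 \<le> b k" and sm: "summable (\<lambda>k. b k powr (1/3))" and "0 < \<delta>"
  shows "finite {k. \<delta> \<le> b k powr (1/3)}"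
    and "real (card {k. \<delta> \<le> b k powr (1/3)}) \<le> (\<Sum>k. b k powr (1/3)) / \<delta>"
    and "(\<Sum>k. if k \<in> {k. \<delta> \<le> b k powr (1/3)} then 0 else b k) \<le> \<delta>\<^sup>2 * (\<Sum>k. b k powr (1/3))"
proof -
  define B where "B k = b k powr (1/3)" for k
  have smB: "summable B" using sm by (simp add: B_def[abs_def])
  have B0: "0 \<le> B k" for k by (simp add: B_def)
  have bB: "b k = (B k)\<^sup>2 * B k" for k
    using b[of k] by (cases "b k = 0")
      (simp_all add: B_def power2_eq_square powr_add[symmetric])
  let ?F = "{k. \<delta> \<le> B k}"
  have card_le: "real (card G) * \<delta> \<le> suminf B" if "finite G" "G \<subseteq> ?F" for G
  proof -
    have "real (card G) * \<delta> = (\<Sum>k\<in>G. \<delta>)" by simp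
    also have "\<dots> \<le> sum B G" using that by (intro sum_mono) auto
    also have "\<dots> \<le> suminf B" using that B0 by (intro sum_le_suminf smB) auto
    finally show ?thesis .
  qed
  have "\<forall>\<^sub>F k in sequentially. B k < \<delta>"
    using summable_LIMSEQ_zero[OF smB] \<open>0 < \<delta>\<close> by (rule order_tendstoD)
  then obtain N where N: "\<And>k. k \<ge> N \<Longrightarrow> B k < \<delta>" by (auto simp: eventually_sequentially)
  have "?F \<subseteq> {..<N}"
  proof
    fix k assume "k \<in> ?F"
    then have "\<not> N \<le> k" using N[of k] by auto
    then show "k \<in> {..<N}" by simp
  qed
  then show fin: "finite {k. \<delta> \<le> b k powr (1/3)}"
    unfolding B_def[symmetric] by (rule finite_subset) simp
  show "real (card {k. \<delta> \<le> b k powr (1/3)}) \<le> (\<Sum>k. b k powr (1/3)) / \<delta>"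
    using card_le[of ?F] fin \<open>0 < \<delta>\<close> by (simp add: pos_le_divide_eq B_def[abs_def])
  define t where "t k = (if k \<in> ?F then 0 else b k)" for k
  have t: "t k \<le> \<delta>\<^sup>2 * B k" for k
  proof (cases "k \<in> ?F")
    case False
    then have "(B k)\<^sup>2 \<le> \<delta>\<^sup>2" using B0 by (intro power_mono) auto
    then show ?thesis using False B0[of k] by (simp add: t_def bB mult_right_mono)
  qed (simp add: t_def B0)
  have "summable t"
    by (rule summable_comparison_test'[OF summable_mult[OF smB, of "\<delta>\<^sup>2"], of 0])
      (use t b in \<open>auto simp: t_def\<close>)
  then have "suminf t \<le> (\<Sum>k. \<delta>\<^sup>2 * B k)"
    by (rule suminf_le[OF t _ summable_mult[OF smB]])
  also have "\<dots> = \<delta>\<^sup>2 * suminf B" by (rule suminf_mult[OF smB])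
  finally show "(\<Sum>k. if k \<in> {k. \<delta> \<le> b k powr (1/3)} then 0 else b k) \<le> \<delta>\<^sup>2 * (\<Sum>k. b k powr (1/3))"
    unfolding t_def B_def .
qed

text \<open>One Auerbach system serves the large terms of both representations at once, so u and v
  are within O(\<delta>) of the same finite tensor.\<close>

theorem approx_property_third: "approx_property TYPE('a::complex_banach) (1/3)"
  unfolding approx_property_def
proof (rule inj_onI)
  fix u v :: "('a dual, 'a) proj_tensor"
  assume "u \<in> s_tensors (1/3)" "v \<in> s_tensors (1/3)" and uv: "tensor_operator u = tensor_operator v"
  then obtain x' x y' y where
    smx: "summable (\<lambda>k. norm (x' k) powr (1/3) * norm (x k) powr (1/3))" and u: "(\<lambda>k. x' k \<otimes>\<^sub>\<pi> x k) sums u"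
    and smy: "summable (\<lambda>k. norm (y' k) powr (1/3) * norm (y k) powr (1/3))" and v: "(\<lambda>k. y' k \<otimes>\<^sub>\<pi> y k) sums v"
    unfolding s_tensors_def by blast
  define a where "a k = norm (x' k) * norm (x k)" for k
  define b where "b k = norm (y' k) * norm (y k)" for k
  have a0: "0 \<le> a k" and b0: "0 \<le> b k" for k by (auto simp: a_def b_def)
  have sa: "summable (\<lambda>k. a k powr (1/3))" and sb: "summable (\<lambda>k. b k powr (1/3))"
    using smx smy by (simp_all add: a_def b_def powr_mult)
  have sa1: "summable a" and sb1: "summable b"
    using summable_of_summable_powr[OF a0 _ _ sa] summable_of_summable_powr[OF b0 _ _ sb] by simp_all
  define A where "A = (\<Sum>k. a k powr (1/3))"
  define B where "B = (\<Sum>k. b k powr (1/3))"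
  have AB: "0 \<le> A" "0 \<le> B" unfolding A_def B_def by (intro suminf_nonneg sa sb; simp)+
  have main: "norm (u - v) \<le> (\<delta> + 2 * (A + B)) * (\<delta> * (A + B))" if \<delta>: "0 < \<delta>" for \<delta>
  proof -
    define F where "F = {k. \<delta> \<le> a k powr (1/3)}"
    define F' where "F' = {k. \<delta> \<le> b k powr (1/3)}"
    note Fa = large_terms_and_tail[OF a0 sa \<delta>, folded F_def A_def]
    note Fb = large_terms_and_tail[OF b0 sb \<delta>, folded F'_def B_def]
    obtain n e h where n: "n \<le> card (x' ` F \<union> y' ` F')"
      and eh: "\<And>i. i < n \<Longrightarrow> norm (e i) \<le> 1" "\<And>i. i < n \<Longrightarrow> norm (h i) \<le> 2"
      and rep: "\<And>g. g \<in> x' ` F \<union> y' ` F' \<Longrightarrow> g = (\<Sum>i<n. cblinfun_apply g (e i) *\<^sub>C h i)"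
      using auerbach_system[of "x' ` F \<union> y' ` F'"] Fa(1) Fb(1) by blast
    have "card (x' ` F \<union> y' ` F') \<le> card F + card F'"
      using card_Un_le[of "x' ` F" "y' ` F'"] card_image_le[OF Fa(1), of x'] card_image_le[OF Fb(1), of y']
      by linarith
    then have "real n \<le> A / \<delta> + B / \<delta>"
      using n Fa(2) Fb(2) by linarith
    then have n\<delta>: "real n * \<delta> \<le> A + B"
      using \<delta> by (simp add: add_divide_distrib[symmetric] pos_le_divide_eq)
    let ?w = "\<Sum>i<n. h i \<otimes>\<^sub>\<pi> tensor_operator u (e i)"
    have "norm (u - ?w) \<le> (1 + 2 * real n) * (\<Sum>k. if k \<in> F then 0 else a k)"
      unfolding a_def using sa1 u eh rep
      by (intro tensor_minus_projection_bound) (auto simp: a_def[abs_def])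
    also have "\<dots> \<le> (1 + 2 * real n) * (\<delta>\<^sup>2 * A)"
      using Fa(3) by (intro mult_left_mono) auto
    finally have 1: "norm (u - ?w) \<le> (1 + 2 * real n) * (\<delta>\<^sup>2 * A)" .
    have "norm (v - ?w) \<le> (1 + 2 * real n) * (\<Sum>k. if k \<in> F' then 0 else b k)"
      unfolding b_def uv using sb1 v eh rep
      by (intro tensor_minus_projection_bound) (auto simp: b_def[abs_def])
    also have "\<dots> \<le> (1 + 2 * real n) * (\<delta>\<^sup>2 * B)"
      using Fb(3) by (intro mult_left_mono) auto
    finally have 2: "norm (v - ?w) \<le> (1 + 2 * real n) * (\<delta>\<^sup>2 * B)" .
    have "norm (u - v) \<le> (1 + 2 * real n) * (\<delta>\<^sup>2 * (A + B))"
      using 1 2 norm_triangle_ineq4[of "u - ?w" "v - ?w"] by (simp add: algebra_simps)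
    also have "\<dots> = (\<delta> + 2 * (real n * \<delta>)) * (\<delta> * (A + B))"
      by (simp add: power2_eq_square algebra_simps)
    also have "\<dots> \<le> (\<delta> + 2 * (A + B)) * (\<delta> * (A + B))"
      using n\<delta> \<delta> AB by (intro mult_right_mono) auto
    finally show ?thesis .
  qed
  have "((\<lambda>\<delta>. (\<delta> + 2 * (A + B)) * (\<delta> * (A + B))) \<longlongrightarrow> (0 + 2 * (A + B)) * (0 * (A + B))) (at_right 0)"
    by (intro tendsto_intros)
  then have "norm (u - v) \<le> (0 + 2 * (A + B)) * (0 * (A + B))"
    by (rule tendsto_lowerbound) (rule eventually_at_rightI[of 0 1], use main in \<open>auto simp del: distrib_left_numeral\<close>)
  then show "u = v" by simp
qed


section \<open>Finite-rank approximation of powers of nuclear operators\<close>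

text \<open>Pythagoras' theorem in C^N for the orthogonal projection onto the span of the
  \<open>a i\<close>.\<close>

lemma bessel_identity:
  fixes a :: "nat \<Rightarrow> nat \<Rightarrow> complex" and \<xi> :: "nat \<Rightarrow> complex"
  assumes "\<And>i j. i < n \<Longrightarrow> j < n \<Longrightarrow> (\<Sum>k<N. a i k * cnj (a j k)) = (if i = j then 1 else 0)"
  defines "c \<equiv> \<lambda>i. \<Sum>k<N. \<xi> k * cnj (a i k)"
  shows "(\<Sum>k<N. (cmod (\<xi> k - (\<Sum>i<n. c i * a i k)))\<^sup>2) + (\<Sum>i<n. (cmod (c i))\<^sup>2) = (\<Sum>k<N. (cmod (\<xi> k))\<^sup>2)"
proof -
  define w where "w k = (\<Sum>i<n. c i * a i k)" for k
  have 1: "(\<Sum>k<N. \<xi> k * cnj (w k)) = (\<Sum>i<n. c i * cnj (c i))"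
  proof -
    have "(\<Sum>k<N. \<xi> k * cnj (w k)) = (\<Sum>k<N. \<Sum>i<n. cnj (c i) * (\<xi> k * cnj (a i k)))"
      by (simp add: w_def sum_distrib_left ac_simps)
    also have "\<dots> = (\<Sum>i<n. cnj (c i) * c i)"
      unfolding c_def by (subst sum.swap) (simp add: sum_distrib_left)
    finally show ?thesis by (simp add: mult.commute)
  qed
  have 2: "(\<Sum>k<N. w k * cnj (\<xi> k)) = (\<Sum>i<n. c i * cnj (c i))"
  proof -
    have "(\<Sum>k<N. w k * cnj (\<xi> k)) = cnj (\<Sum>k<N. \<xi> k * cnj (w k))"
      by (simp add: mult.commute)
    then show ?thesis unfolding 1 by (simp add: mult.commute)
  qed
  have 3: "(\<Sum>k<N. w k * cnj (w k)) = (\<Sum>i<n. c i * cnj (c i))"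
  proof -
    have "(\<Sum>k<N. w k * cnj (w k)) = (\<Sum>k<N. \<Sum>i<n. \<Sum>j<n. c i * cnj (c j) * (a i k * cnj (a j k)))"
      by (simp add: w_def sum_product ac_simps)
    also have "\<dots> = (\<Sum>i<n. \<Sum>j<n. c i * cnj (c j) * (\<Sum>k<N. a i k * cnj (a j k)))"
      by (subst sum.swap, rule sum.cong[OF refl], subst sum.swap) (simp add: sum_distrib_left)
    also have "\<dots> = (\<Sum>i<n. \<Sum>j<n. if j = i then c i * cnj (c i) else 0)"
      by (intro sum.cong refl) (auto simp: assms(1))
    finally show ?thesis by simp
  qed
  have "complex_of_real ((\<Sum>k<N. (cmod (\<xi> k - w k))\<^sup>2) + (\<Sum>i<n. (cmod (c i))\<^sup>2))
      = (\<Sum>k<N. (\<xi> k - w k) * cnj (\<xi> k - w k)) + (\<Sum>i<n. c i * cnj (c i))"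
    by (simp only: of_real_add of_real_sum complex_norm_square)
  also have "\<dots> = (\<Sum>k<N. \<xi> k * cnj (\<xi> k))"
    using 1 2 3 by (simp add: algebra_simps sum.distrib sum_subtractf)
  also have "\<dots> = complex_of_real (\<Sum>k<N. (cmod (\<xi> k))\<^sup>2)"
    by (simp only: of_real_sum complex_norm_square)
  finally show ?thesis
    unfolding w_def of_real_eq_iff .
qed

lemma bessel_inequality:
  fixes a :: "nat \<Rightarrow> nat \<Rightarrow> complex" and \<xi> :: "nat \<Rightarrow> complex"
  assumes "\<And>i j. i < n \<Longrightarrow> j < n \<Longrightarrow> (\<Sum>k<N. a i k * cnj (a j k)) = (if i = j then 1 else 0)"
  shows "(\<Sum>i<n. (cmod (\<Sum>k<N. \<xi> k * cnj (a i k)))\<^sup>2) \<le> (\<Sum>k<N. (cmod (\<xi> k))\<^sup>2)"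
  using bessel_identity[OF assms, where \<xi> = \<xi>]
    sum_nonneg[of "{..<N}" "\<lambda>k. (cmod (\<xi> k - (\<Sum>i<n. (\<Sum>k<N. \<xi> k * cnj (a i k)) * a i k)))\<^sup>2"]
  by fastforce

section \<open>Operators of rank at most r and series of such operators\<close>

definition finite_rank :: "nat \<Rightarrow> ('a::complex_normed_vector \<Rightarrow>\<^sub>C\<^sub>L 'b::complex_normed_vector) \<Rightarrow> bool"
  where "finite_rank r V \<longleftrightarrow> (\<exists>y' y. V = (\<Sum>i<r. rank_one (y' i) (y i)))"

lemma finite_rankI: "V = (\<Sum>i<r. rank_one (y' i) (y i)) \<Longrightarrow> finite_rank r V"
  unfolding finite_rank_def by (intro exI)

lemma finite_rank_add:
  assumes "finite_rank r V" "finite_rank q W"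
  shows "finite_rank (r + q) (V + W)"
proof -
  obtain y' y z' z where V: "V = (\<Sum>i<r. rank_one (y' i) (y i))" and W: "W = (\<Sum>i<q. rank_one (z' i) (z i))"
    using assms by (auto simp: finite_rank_def)
  define u' where "u' i = (if i < r then y' i else z' (i - r))" for i
  define u where "u i = (if i < r then y i else z (i - r))" for i
  have "(\<Sum>i<r + q. rank_one (u' i) (u i)) = V + (\<Sum>i\<in>{r..<r + q}. rank_one (u' i) (u i))"
    unfolding lessThan_atLeast0 V
    by (subst sum.atLeastLessThan_concat[of 0 r "r + q", symmetric]) (auto simp: u'_def u_def)
  also have "(\<Sum>i\<in>{r..<r + q}. rank_one (u' i) (u i)) = W"
    unfolding W lessThan_atLeast0
    by (rule sum.reindex_bij_witness[of _ "\<lambda>i. i + r" "\<lambda>i. i - r"]) (auto simp: u'_def u_def)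
  finally show ?thesis by (rule finite_rankI[OF sym])
qed

lemma finite_rank_compose:
  assumes "finite_rank r V"
  shows "finite_rank r (A \<circ>\<^sub>L V)" "finite_rank r (V \<circ>\<^sub>L B)"
proof -
  obtain y' y where V: "V = (\<Sum>i<r. rank_one (y' i) (y i))"
    using assms by (auto simp: finite_rank_def)
  show "finite_rank r (A \<circ>\<^sub>L V)"
    unfolding V cblinfun_compose_sum_right compose_rank_one by (rule finite_rankI[OF refl])
  show "finite_rank r (V \<circ>\<^sub>L B)"
    unfolding V cblinfun_compose_sum_left rank_one_compose by (rule finite_rankI[OF refl])
qed

lemma finite_rank_uminus: "finite_rank r V \<Longrightarrow> finite_rank r (- V)"
proof -
  have "- V = V \<circ>\<^sub>L (- id_cblinfun)"
    by (rule cblinfun_eqI) (simp add: cblinfun_rep_simps cblinfun_linear_simps)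
  then show "finite_rank r V \<Longrightarrow> finite_rank r (- V)"
    using finite_rank_compose(2) by metis
qed

lemma finite_rank_0: "finite_rank 0 0"
  by (simp add: finite_rank_def)

text \<open>With an Auerbach system (e, g) of the functionals of V, the rank-one terms become g_m
  paired with V (e_m), so each is controlled by the norm of V; in an arbitrary representation the
  terms may be large and cancel. Padding by zeros makes the length exactly r.\<close>

lemma finite_rank_auerbach_rep:
  fixes V :: "'a::complex_normed_vector \<Rightarrow>\<^sub>C\<^sub>L 'b::complex_normed_vector"
  assumes "finite_rank r V"
  obtains h :: "nat \<Rightarrow> 'a dual" and w :: "nat \<Rightarrow> 'b"
  where "V = (\<Sum>i<r. rank_one (h i) (w i))" "\<And>i. norm (h i) * norm (w i) \<le> 2 * norm V"
    "\<And>i. r \<le> i \<Longrightarrow> h i = 0" "\<And>i. r \<le> i \<Longrightarrow> w i = 0"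
proof -
  obtain y' y where V: "V = (\<Sum>i<r. rank_one (y' i) (y i))"
    using assms by (auto simp: finite_rank_def)
  obtain n e g where n: "n \<le> card (y' ` {..<r})"
    and e: "\<And>i. i < n \<Longrightarrow> norm (e i) \<le> 1" and g: "\<And>i. i < n \<Longrightarrow> norm (g i) \<le> 2"
    and rep: "\<And>f. f \<in> y' ` {..<r} \<Longrightarrow> f = (\<Sum>i<n. cblinfun_apply f (e i) *\<^sub>C g i)"
    by (rule auerbach_system[of "y' ` {..<r}"]) auto
  have nr: "n \<le> r" using n card_image_le[of "{..<r}" y'] by simp
  define h where "h i = (if i < n then g i else 0)" for i
  define w where "w i = (if i < n then V (e i) else 0)" for i
  have "V = (\<Sum>m<n. rank_one (g m) (V (e m)))"
  proof (rule cblinfun_eqI)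
    fix x
    have y'x: "y' i x = (\<Sum>m<n. y' i (e m) * g m x)" if "i < r" for i
      using arg_cong[OF rep[of "y' i"], of "\<lambda>f. cblinfun_apply f x"] that
      by (simp add: sum_cblinfun_apply scaleC_cblinfun.rep_eq scaleC_complex_def)
    have "V x = (\<Sum>i<r. \<Sum>m<n. g m x *\<^sub>C (y' i (e m) *\<^sub>C y i))"
      unfolding V sum_cblinfun_apply rank_one.rep_eq
      by (intro sum.cong refl) (simp add: y'x complex_vector.scale_sum_left scaleC_scaleC mult.commute)
    also have "\<dots> = (\<Sum>m<n. g m x *\<^sub>C V (e m))"
      unfolding V sum_cblinfun_apply rank_one.rep_eq
      by (subst sum.swap) (simp add: complex_vector.scale_sum_right)
    finally show "V x = (\<Sum>m<n. rank_one (g m) (V (e m))) x"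
      by (simp add: sum_cblinfun_apply rank_one.rep_eq)
  qed
  also have "\<dots> = (\<Sum>i<r. rank_one (h i) (w i))"
    using nr by (intro sum.mono_neutral_cong_left)
      (auto simp: h_def w_def intro!: cblinfun_eqI simp: rank_one.rep_eq zero_cblinfun.rep_eq)
  finally have "V = (\<Sum>i<r. rank_one (h i) (w i))" .
  moreover have "norm (h i) * norm (w i) \<le> 2 * norm V" for i
  proof (cases "i < n")
    case True
    have "norm (V (e i)) \<le> norm V"
      using norm_cblinfun[of V "e i"] mult_left_mono[OF e[OF True], of "norm V"] by simp
    then show ?thesis
      using True g[OF True] by (simp add: h_def w_def mult_mono)
  qed (simp add: h_def)
  ultimately show ?thesis
    using that[of h w] nr by (simp add: h_def w_def)
qed

text \<open>A piece of rank r and norm b contributes at most r (2 b)^s to a series over the pairs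
  (j, i), enumerated by \<open>prod_decode\<close>. Decay of finite-rank approximations is thereby
  turned into s-nuclearity.\<close>

lemma s_nuclear_sum_of_finite_rank:
  fixes V :: "nat \<Rightarrow> 'a::complex_banach \<Rightarrow>\<^sub>C\<^sub>L 'a"
  assumes s: "0 < s" "s \<le> 1" and V: "V sums S" and r: "\<And>j. finite_rank (r j) (V j)"
    and sm: "summable (\<lambda>j. real (r j) * (2 * norm (V j)) powr s)"
  shows "s_nuclear s S"
proof -
  have "\<forall>j. \<exists>p. V j = (\<Sum>i<r j. rank_one (fst p i) (snd p i)) \<and>
      (\<forall>i. norm (fst p i) * norm (snd p i) \<le> 2 * norm (V j)) \<and>
      (\<forall>i\<ge>r j. fst p i = 0) \<and> (\<forall>i\<ge>r j. snd p i = 0)"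
  proof
    fix j
    obtain h :: "nat \<Rightarrow> 'a dual" and w :: "nat \<Rightarrow> 'a"
      where "V j = (\<Sum>i<r j. rank_one (h i) (w i))" "\<And>i. norm (h i) * norm (w i) \<le> 2 * norm (V j)"
        "\<And>i. r j \<le> i \<Longrightarrow> h i = 0" "\<And>i. r j \<le> i \<Longrightarrow> w i = 0"
      using finite_rank_auerbach_rep[OF r[of j]] by blast
    then show "\<exists>p. V j = (\<Sum>i<r j. rank_one (fst p i) (snd p i)) \<and>
        (\<forall>i. norm (fst p i) * norm (snd p i) \<le> 2 * norm (V j)) \<and>
        (\<forall>i\<ge>r j. fst p i = 0) \<and> (\<forall>i\<ge>r j. snd p i = 0)"
      by (intro exI[of _ "(h, w)"]) simp
  qed
  from choice[OF this] obtain p where p: "\<forall>j. V j = (\<Sum>i<r j. rank_one (fst (p j) i) (snd (p j) i)) \<and>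
      (\<forall>i. norm (fst (p j) i) * norm (snd (p j) i) \<le> 2 * norm (V j)) \<and>
      (\<forall>i\<ge>r j. fst (p j) i = 0) \<and> (\<forall>i\<ge>r j. snd (p j) i = 0)" ..
  define h where "h j = fst (p j)" for j
  define w where "w j = snd (p j)" for j
  have hw: "V j = (\<Sum>i<r j. rank_one (h j i) (w j i))" "norm (h j i) * norm (w j i) \<le> 2 * norm (V j)"
    "r j \<le> i \<Longrightarrow> h j i = 0" "r j \<le> i \<Longrightarrow> w j i = 0" for i j
    unfolding h_def w_def using p by blast+
  define g where "g = (\<lambda>(j, i). norm (h j i) powr s * norm (w j i) powr s)"
  define f where "f = (\<lambda>(j, i). rank_one (h j i) (w j i))"
  have rowg: "((\<lambda>i. g (j, i)) has_sum (\<Sum>i<r j. g (j, i))) UNIV" for j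
    by (rule has_sum_finite_neutralI) (auto simp: g_def hw(3,4) not_less)
  have rank_one_0: "rank_one 0 y = (0 :: 'a \<Rightarrow>\<^sub>C\<^sub>L 'a)" for y :: 'a
    by (rule cblinfun_eqI) (simp add: cblinfun_rep_simps)
  have rowf: "((\<lambda>i. f (j, i)) has_sum V j) UNIV" for j
  proof (rule has_sum_finite_neutralI[of "{..<r j}"])
    show "V j = (\<Sum>i\<in>{..<r j}. f (j, i))" by (simp add: f_def flip: hw(1))
  qed (simp_all add: f_def hw(3) not_less rank_one_0)
  have g0: "0 \<le> g p" for p by (simp add: g_def case_prod_unfold)
  have "(\<lambda>j. \<Sum>i<r j. g (j, i)) summable_on UNIV"
  proof (rule norm_summable_imp_summable_on, rule summable_comparison_test'[OF sm, of 0])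
    fix j
    have "(\<Sum>i<r j. g (j, i)) \<le> (\<Sum>i<r j. (2 * norm (V j)) powr s)"
      using s hw(2) by (intro sum_mono) (auto simp: g_def powr_mult[symmetric] simp del: powr_mult intro!: powr_mono2)
    then show "norm (norm (\<Sum>i<r j. g (j, i))) \<le> real (r j) * (2 * norm (V j)) powr s"
      using g0 by (simp add: sum_nonneg)
  qed
  then have "g summable_on UNIV \<times> UNIV"
    by (rule summable_on_SigmaI[OF rowg]) (use g0 in auto)
  then have "(\<lambda>k. g (prod_decode k)) summable_on UNIV"
    using summable_on_reindex_bij_betw[of prod_decode UNIV UNIV g] bij_prod_decode by simp
  then have smk: "summable (\<lambda>k. g (prod_decode k))"
    by (simp add: summable_on_imp_summable)
  define x' where "x' k = h (fst (prod_decode k)) (snd (prod_decode k))" for k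
  define x where "x k = w (fst (prod_decode k)) (snd (prod_decode k))" for k
  have smx: "summable (\<lambda>k. norm (x' k) powr s * norm (x k) powr s)"
    using smk by (simp add: g_def x'_def x_def case_prod_unfold)
  have smx1: "summable (\<lambda>k. norm (x' k) * norm (x k))"
    by (rule summable_of_summable_powr[OF _ s]) (use smx in \<open>simp_all add: powr_mult\<close>)
  then obtain L where L: "(\<lambda>k. rank_one (x' k) (x k)) sums L"
    using summable_rank_one by (auto simp: summable_def)
  moreover have "summable (\<lambda>k. norm (rank_one (x' k) (x k)))"
    by (rule summable_comparison_test'[OF smx1, of 0]) (simp add: norm_rank_one)
  ultimately have "((\<lambda>k. f (prod_decode k)) has_sum L) UNIV"
    using norm_summable_imp_has_sum[of "\<lambda>k. rank_one (x' k) (x k)" L]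
    by (simp add: f_def x'_def x_def case_prod_unfold)
  then have "(f has_sum L) (UNIV \<times> UNIV)"
    using has_sum_reindex_bij_betw[of prod_decode UNIV UNIV f L] bij_prod_decode by simp
  then have "V sums L"
    by (intro has_sum_imp_sums has_sum_SigmaD[OF _ rowf])
  then have "L = S" using V sums_unique2 by blast
  then show ?thesis
    using L smx s_nuclear_iff[OF s] by (auto simp: nuclear_rep_def)
qed


section \<open>Truncations as Hilbert-Schmidt operators\<close>

locale balanced_sequence =
  fixes x' :: "nat \<Rightarrow> 'a::complex_banach dual" and x :: "nat \<Rightarrow> 'a"
  assumes balanced: "norm (x' k) = norm (x k)" and square_summable: "summable (\<lambda>k. (norm (x k))\<^sup>2)"
begin

definition trunc :: "nat \<Rightarrow> 'a \<Rightarrow>\<^sub>C\<^sub>L 'a"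
  where "trunc N = (\<Sum>k<N. rank_one (x' k) (x k))"

definition C :: real
  where "C = (\<Sum>k. (norm (x k))\<^sup>2)"

text \<open>The semi-inner product pulled back from \<open>\<complex>\<^sup>N\<close> along \<open>x'\<^sub>0, \<dots>, x'\<^sub>N\<^sub>-\<^sub>1\<close>. With respect to it,
  \<open>trunc N\<close> is a Hilbert--Schmidt operator of norm at most \<open>C\<close>.\<close>

definition ip :: "nat \<Rightarrow> 'a \<Rightarrow> 'a \<Rightarrow> complex"
  where "ip N y z = (\<Sum>k<N. x' k y * cnj (x' k z))"

definition sq :: "nat \<Rightarrow> 'a \<Rightarrow> real"
  where "sq N y = (\<Sum>k<N. (cmod (x' k y))\<^sup>2)"

definition orthonormal :: "nat \<Rightarrow> nat \<Rightarrow> (nat \<Rightarrow> 'a) \<Rightarrow> bool"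
  where "orthonormal N n v \<longleftrightarrow> (\<forall>i<n. \<forall>j<n. ip N (v i) (v j) = (if i = j then 1 else 0))"

text \<open>Orthogonal projection for \<open>ip\<close> onto the span of v: the i-th functional
  sends z to \<open>ip N z (v i)\<close>, written as a combination of the \<open>x' k\<close> so
  that it is an element of the dual.\<close>

definition proj :: "nat \<Rightarrow> nat \<Rightarrow> (nat \<Rightarrow> 'a) \<Rightarrow> 'a \<Rightarrow>\<^sub>C\<^sub>L 'a"
  where "proj N n v = (\<Sum>i<n. rank_one (\<Sum>k<N. cnj (x' k (v i)) *\<^sub>C x' k) (v i))"

lemma ip_linear:
  "ip N (y + z) w = ip N y w + ip N z w" "ip N (y - z) w = ip N y w - ip N z w"
  "ip N (c *\<^sub>C y) w = c * ip N y w" "ip N 0 w = 0"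
  by (simp_all add: ip_def cblinfun_linear_simps scaleC_complex_def algebra_simps sum.distrib
      sum_subtractf sum_distrib_left)

lemma ip_sum: "ip N (sum f I) w = (\<Sum>i\<in>I. ip N (f i) w)"
  by (induction I rule: infinite_finite_induct) (simp_all add: ip_linear)

lemma ip_scaleC_right: "ip N y (c *\<^sub>C z) = cnj c * ip N y z"
  by (simp add: ip_def cblinfun_linear_simps scaleC_complex_def sum_distrib_left algebra_simps)

lemma ip_commute: "ip N z y = cnj (ip N y z)"
  by (simp add: ip_def mult.commute)

lemma ip_self: "ip N y y = complex_of_real (sq N y)"
  by (simp only: ip_def sq_def of_real_sum complex_norm_square)

lemma sq_nonneg: "0 \<le> sq N y"
  by (simp add: sq_def sum_nonneg)

lemma proj_apply: "proj N n v y = (\<Sum>i<n. ip N y (v i) *\<^sub>C v i)"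
  by (simp add: proj_def sum_cblinfun_apply rank_one.rep_eq scaleC_cblinfun.rep_eq
      scaleC_complex_def ip_def mult.commute)

lemma finite_rank_proj: "finite_rank n (proj N n v)"
  unfolding proj_def by (rule finite_rankI[OF refl])

lemma trunc_apply: "trunc N y = (\<Sum>k<N. x' k y *\<^sub>C x k)"
  by (simp add: trunc_def sum_cblinfun_apply rank_one.rep_eq)

lemma C_nonneg: "0 \<le> C"
  unfolding C_def by (rule suminf_nonneg[OF square_summable]) simp

lemma sum_norm_square_le: "(\<Sum>k<N. (norm (x k))\<^sup>2) \<le> C"
  unfolding C_def by (rule sum_le_suminf[OF square_summable]) auto

lemma sq_le: "sq N y \<le> C * (norm y)\<^sup>2"
proof -
  have "sq N y \<le> (\<Sum>k<N. (norm (x k))\<^sup>2 * (norm y)\<^sup>2)"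
    unfolding sq_def
  proof (rule sum_mono)
    fix k
    show "(cmod (x' k y))\<^sup>2 \<le> (norm (x k))\<^sup>2 * (norm y)\<^sup>2"
      using norm_cblinfun[of "x' k" y] by (auto simp: balanced power_mult_distrib[symmetric] intro!: power_mono)
  qed
  also have "\<dots> \<le> C * (norm y)\<^sup>2"
    unfolding sum_distrib_right[symmetric] by (intro mult_right_mono sum_norm_square_le) simp
  finally show ?thesis .
qed

text \<open>Cauchy-Schwarz. Since the bound is by \<open>sq\<close>, the truncation kills the null
  vectors of the degenerate form, so these never carry a nonzero eigenvalue.\<close>

lemma norm_trunc_le: "(norm (trunc N y))\<^sup>2 \<le> C * sq N y"
proof -
  have "norm (trunc N y) \<le> (\<Sum>k<N. cmod (x' k y) * norm (x k))"
    unfolding trunc_apply by (rule order_trans[OF norm_sum]) (simp add: norm_scaleC)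
  then have "(norm (trunc N y))\<^sup>2 \<le> (\<Sum>k<N. cmod (x' k y) * norm (x k))\<^sup>2"
    by (intro power_mono) auto
  also have "\<dots> \<le> sq N y * (\<Sum>k<N. (norm (x k))\<^sup>2)"
    unfolding sq_def by (rule Cauchy_Schwarz_ineq_sum)
  also have "\<dots> \<le> sq N y * C"
    by (intro mult_left_mono sum_norm_square_le sq_nonneg)
  finally show ?thesis by (simp add: mult.commute)
qed

lemma orthonormal_bessel:
  assumes "orthonormal N n v"
  shows "(\<Sum>i<n. (cmod (\<Sum>k<N. \<xi> k * cnj (x' k (v i))))\<^sup>2) \<le> (\<Sum>k<N. (cmod (\<xi> k))\<^sup>2)"
  using assms by (intro bessel_inequality) (simp add: orthonormal_def ip_def)

text \<open>Bessel's inequality for the unit vectors of C^N, summed up. It bounds the length of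
  orthonormal systems, so that longest ones exist.\<close>

lemma orthonormal_le:
  assumes "orthonormal N n v"
  shows "n \<le> N"
proof -
  have "real n = (\<Sum>i<n. sq N (v i))"
  proof -
    have "sq N (v i) = 1" if "i < n" for i
      using assms that ip_self[of N "v i"] by (simp add: orthonormal_def)
    then show ?thesis by simp
  qed
  also have "\<dots> = (\<Sum>k<N. \<Sum>i<n. (cmod (x' k (v i)))\<^sup>2)"
    unfolding sq_def by (rule sum.swap)
  also have "\<dots> \<le> (\<Sum>k<N. 1)"
  proof (rule sum_mono)
    fix k assume "k \<in> {..<N}"
    then have k: "k < N" by simp
    show "(\<Sum>i<n. (cmod (x' k (v i)))\<^sup>2) \<le> 1"
      using orthonormal_bessel[OF assms, of "\<lambda>j. if j = k then 1 else 0"] k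
      by (simp add: if_distrib[of "\<lambda>z. z * _"] if_distrib[of "\<lambda>z. (cmod z)\<^sup>2"] cong: if_cong)
  qed
  finally show ?thesis by simp
qed

text \<open>The matrix of the x'_k (x_j) represents the truncation, and its Hilbert-Schmidt norm is
  at most the sum of the |x_k|^2; Bessel's inequality is applied to each row.\<close>

lemma orthonormal_trunc_sq_le:
  assumes "orthonormal N n v"
  shows "(\<Sum>i<n. sq N (trunc N (v i))) \<le> C\<^sup>2"
proof -
  have "(\<Sum>i<n. sq N (trunc N (v i))) = (\<Sum>k<N. \<Sum>i<n. (cmod (x' k (trunc N (v i))))\<^sup>2)"
    unfolding sq_def by (rule sum.swap)
  also have "\<dots> \<le> (\<Sum>k<N. \<Sum>j<N. (norm (x k))\<^sup>2 * (norm (x j))\<^sup>2)"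
  proof (rule sum_mono)
    fix k
    \<comment> \<open>Conjugation brings the row into the form required by
      \<open>orthonormal_bessel\<close>.\<close>
    have "cmod (x' k (trunc N (v i))) = cmod (\<Sum>j<N. cnj (x' k (x j)) * cnj (x' j (v i)))" for i
    proof -
      have "x' k (trunc N (v i)) = cnj (\<Sum>j<N. cnj (x' k (x j)) * cnj (x' j (v i)))"
        by (simp add: trunc_apply cblinfun_apply_sum cblinfun_linear_simps scaleC_complex_def mult.commute)
      then show ?thesis by (simp only: complex_mod_cnj)
    qed
    then have "(\<Sum>i<n. (cmod (x' k (trunc N (v i))))\<^sup>2) \<le> (\<Sum>j<N. (cmod (cnj (x' k (x j))))\<^sup>2)"
      using orthonormal_bessel[OF assms, of "\<lambda>j. cnj (x' k (x j))"] by (simp only:)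
    also have "\<dots> \<le> (\<Sum>j<N. (norm (x k))\<^sup>2 * (norm (x j))\<^sup>2)"
    proof (rule sum_mono)
      fix j
      show "(cmod (cnj (x' k (x j))))\<^sup>2 \<le> (norm (x k))\<^sup>2 * (norm (x j))\<^sup>2"
        using norm_cblinfun[of "x' k" "x j"]
        by (auto simp: balanced power_mult_distrib[symmetric] intro!: power_mono)
    qed
    finally show "(\<Sum>i<n. (cmod (x' k (trunc N (v i))))\<^sup>2) \<le> (\<Sum>j<N. (norm (x k))\<^sup>2 * (norm (x j))\<^sup>2)" .
  qed
  also have "\<dots> = (\<Sum>k<N. (norm (x k))\<^sup>2)\<^sup>2"
    by (simp add: sum_product power2_eq_square)
  also have "\<dots> \<le> C\<^sup>2"
    by (intro power_mono sum_norm_square_le sum_nonneg) auto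
  finally show ?thesis .
qed

lemma ip_minus_proj:
  assumes "orthonormal N n v" "i < n"
  shows "ip N (y - proj N n v y) (v i) = 0"
proof -
  have "ip N (proj N n v y) (v i) = (\<Sum>j<n. if j = i then ip N y (v i) else 0)"
    unfolding proj_apply ip_sum using assms
    by (intro sum.cong) (auto simp: ip_linear orthonormal_def)
  then show ?thesis using assms(2) by (simp add: ip_linear)
qed

lemma sq_minus_proj_le:
  assumes "orthonormal N n v"
  shows "sq N (y - proj N n v y) \<le> sq N y"
proof -
  have on: "(\<Sum>k<N. x' k (v i) * cnj (x' k (v j))) = (if i = j then 1 else 0)" if "i < n" "j < n" for i j
    using assms that by (simp add: orthonormal_def ip_def)
  have "x' k (y - proj N n v y) = x' k y - (\<Sum>i<n. (\<Sum>k<N. x' k y * cnj (x' k (v i))) * x' k (v i))" for k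
    by (simp add: proj_apply cblinfun_linear_simps cblinfun_apply_sum scaleC_complex_def ip_def)
  then show ?thesis
    using bessel_identity[where n = n and N = N and a = "\<lambda>i k. x' k (v i)" and \<xi> = "\<lambda>k. x' k y", OF on]
      sum_nonneg[of "{..<n}" "\<lambda>i. (cmod (\<Sum>k<N. x' k y * cnj (x' k (v i))))\<^sup>2"]
    by (simp add: sq_def)
qed

lemma orthonormal_extend:
  assumes "orthonormal N n v" "\<And>i. i < n \<Longrightarrow> ip N w (v i) = 0" "sq N w = 1"
  shows "orthonormal N (Suc n) (v(n := w))"
proof -
  have "ip N (v i) w = 0" if "i < n" for i
    using assms(2)[OF that] ip_commute[of N "v i" w] by simp
  then show ?thesis
    using assms by (auto simp: orthonormal_def less_Suc_eq ip_self)
qed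

lemma normalize_sq:
  assumes "0 < sq N z"
  shows "sq N (complex_of_real (1 / sqrt (sq N z)) *\<^sub>C z) = 1"
proof -
  have "complex_of_real (sq N (complex_of_real (1 / sqrt (sq N z)) *\<^sub>C z))
      = complex_of_real ((1 / sqrt (sq N z)) * (1 / sqrt (sq N z)) * sq N z)"
    by (simp only: ip_self[symmetric] ip_linear ip_scaleC_right complex_cnj_complex_of_real of_real_mult mult.assoc)
  also have "(1 / sqrt (sq N z)) * (1 / sqrt (sq N z)) * sq N z = 1"
    using assms by simp
  finally show ?thesis by (simp only: of_real_eq_iff)
qed

lemma sq_scaleC: "sq N (c *\<^sub>C z) = (cmod c)\<^sup>2 * sq N z"
  by (simp add: sq_def cblinfun_linear_simps scaleC_complex_def norm_mult power_mult_distrib sum_distrib_left)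

text \<open>A substitute for the singular value decomposition: take a longest orthonormal system on
  which the truncation exceeds \<epsilon>. The Hilbert-Schmidt bound limits its length, and
  maximality makes the truncation small on the orthogonal complement.\<close>

lemma small_on_complement:
  assumes "0 < \<epsilon>"
  obtains n v where "orthonormal N n v" "real n * \<epsilon>\<^sup>2 \<le> C\<^sup>2"
    "\<And>z. (\<And>i. i < n \<Longrightarrow> ip N z (v i) = 0) \<Longrightarrow> sq N (trunc N z) \<le> \<epsilon>\<^sup>2 * sq N z"
proof -
  define P where "P n \<longleftrightarrow> (\<exists>v. orthonormal N n v \<and> (\<forall>i<n. \<epsilon>\<^sup>2 < sq N (trunc N (v i))))" for n
  have "P 0" by (simp add: P_def orthonormal_def)
  moreover have "P n \<Longrightarrow> n \<le> N" for n using orthonormal_le by (auto simp: P_def)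
  ultimately obtain n where n: "P n" and max: "\<And>m. P m \<Longrightarrow> m \<le> n"
    using ex_has_greatest_nat[of P 0 "\<lambda>n. n" "Suc N"] by (auto simp: less_Suc_eq_le)
  then obtain v where v: "orthonormal N n v" and large: "\<And>i. i < n \<Longrightarrow> \<epsilon>\<^sup>2 < sq N (trunc N (v i))"
    by (auto simp: P_def)
  have "real n * \<epsilon>\<^sup>2 = (\<Sum>i<n. \<epsilon>\<^sup>2)" by simp
  also have "\<dots> \<le> (\<Sum>i<n. sq N (trunc N (v i)))"
    using large by (intro sum_mono) (auto intro: less_imp_le)
  also have "\<dots> \<le> C\<^sup>2" by (rule orthonormal_trunc_sq_le[OF v])
  finally have "real n * \<epsilon>\<^sup>2 \<le> C\<^sup>2" .
  moreover have "sq N (trunc N z) \<le> \<epsilon>\<^sup>2 * sq N z" if z: "\<And>i. i < n \<Longrightarrow> ip N z (v i) = 0" for z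
  proof (rule ccontr)
    assume neg: "\<not> sq N (trunc N z) \<le> \<epsilon>\<^sup>2 * sq N z"
    \<comment> \<open>A null vector cannot violate the bound, so z can be normalised.\<close>
    have pos: "0 < sq N z"
    proof (rule ccontr)
      assume "\<not> 0 < sq N z"
      then have "sq N z = 0" using sq_nonneg[of N z] by simp
      then have "trunc N z = 0" using norm_trunc_le[of N z] by simp
      then show False using neg \<open>sq N z = 0\<close> by (simp add: sq_def cblinfun_linear_simps)
    qed
    define r where "r = 1 / sqrt (sq N z)"
    define w where "w = complex_of_real r *\<^sub>C z"
    have "orthonormal N (Suc n) (v(n := w))"
      using v z normalize_sq[OF pos] by (intro orthonormal_extend) (auto simp: w_def r_def ip_linear)
    moreover have "\<epsilon>\<^sup>2 < sq N (trunc N w)"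
    proof -
      have "r\<^sup>2 * sq N z = 1" using pos by (simp add: r_def power_divide)
      then have "r\<^sup>2 * (\<epsilon>\<^sup>2 * sq N z) = \<epsilon>\<^sup>2" by (simp add: mult.left_commute)
      moreover have "r\<^sup>2 * (\<epsilon>\<^sup>2 * sq N z) < r\<^sup>2 * sq N (trunc N z)"
        using neg pos by (intro mult_strict_left_mono) (auto simp: r_def)
      ultimately show ?thesis
        by (simp only: w_def cblinfun_linear_simps sq_scaleC norm_of_real power2_abs)
    qed
    ultimately have "P (Suc n)"
      using large by (auto simp: P_def less_Suc_eq intro!: exI[of _ "v(n := w)"])
    then show False using max by fastforce
  qed
  ultimately show ?thesis using that v by blast
qed

text \<open>Write T for the truncation. G = T (1 - P) contracts the semi-norm by \<epsilon>, while
  T^j - G^j has rank at most j n. The semi-norm controls the norm only after one more application of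
  T, hence \<open>Suc m\<close> against \<epsilon>^m.\<close>

lemma trunc_power_approx:
  assumes "0 < \<epsilon>"
  obtains K r where "finite_rank r K" "real r * \<epsilon>\<^sup>2 \<le> real m * C\<^sup>2"
    "norm (cblinfun_power (trunc N) (Suc m) - K) \<le> C * \<epsilon> ^ m"
proof -
  obtain n v where v: "orthonormal N n v" and n: "real n * \<epsilon>\<^sup>2 \<le> C\<^sup>2"
    and small: "\<And>z. (\<And>i. i < n \<Longrightarrow> ip N z (v i) = 0) \<Longrightarrow> sq N (trunc N z) \<le> \<epsilon>\<^sup>2 * sq N z"
    using small_on_complement[OF assms, of N] by blast
  define P where "P = proj N n v"
  define G where "G = trunc N - trunc N \<circ>\<^sub>L P"
  have G: "G z = trunc N (z - P z)" for z
    by (simp add: G_def cblinfun_rep_simps cblinfun_linear_simps)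
  have "finite_rank (j * n) (cblinfun_power (trunc N) j - cblinfun_power G j)" for j
  proof (induction j)
    case 0
    then show ?case using finite_rank_0 by simp
  next
    case (Suc j)
    have "finite_rank n ((trunc N \<circ>\<^sub>L P) \<circ>\<^sub>L cblinfun_power G j)"
      unfolding P_def by (intro finite_rank_compose(2)[OF finite_rank_compose(1)] finite_rank_proj)
    then have "finite_rank (j * n + n) (trunc N \<circ>\<^sub>L (cblinfun_power (trunc N) j - cblinfun_power G j)
        + (trunc N \<circ>\<^sub>L P) \<circ>\<^sub>L cblinfun_power G j)"
      by (intro finite_rank_add finite_rank_compose(1)[OF Suc])
    also have "trunc N \<circ>\<^sub>L (cblinfun_power (trunc N) j - cblinfun_power G j)
        + (trunc N \<circ>\<^sub>L P) \<circ>\<^sub>L cblinfun_power G j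
        = cblinfun_power (trunc N) (Suc j) - cblinfun_power G (Suc j)"
      by (rule cblinfun_eqI) (simp add: G cblinfun_rep_simps cblinfun_linear_simps)
    finally show ?case by (simp add: add.commute)
  qed
  note fr = this
  have sqG: "sq N (cblinfun_power G j z) \<le> (\<epsilon>\<^sup>2) ^ j * sq N z" for j z
  proof (induction j)
    case (Suc j)
    let ?y = "cblinfun_power G j z"
    have "sq N (cblinfun_power G (Suc j) z) \<le> \<epsilon>\<^sup>2 * sq N (?y - P ?y)"
      unfolding cblinfun_power_Suc_apply(1) G using v by (intro small) (simp add: P_def ip_minus_proj)
    also have "\<dots> \<le> \<epsilon>\<^sup>2 * sq N ?y"
      unfolding P_def by (intro mult_left_mono sq_minus_proj_le[OF v]) simp
    also have "\<dots> \<le> \<epsilon>\<^sup>2 * ((\<epsilon>\<^sup>2) ^ j * sq N z)"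
      by (intro mult_left_mono Suc) simp
    finally show ?case by (simp add: mult.assoc)
  qed (simp add: id_cblinfun.rep_eq)
  define K where "K = trunc N \<circ>\<^sub>L (cblinfun_power (trunc N) m - cblinfun_power G m)"
  have "norm (cblinfun_power (trunc N) (Suc m) - K) \<le> C * \<epsilon> ^ m"
  proof (rule norm_cblinfun_bound)
    show "0 \<le> C * \<epsilon> ^ m" using assms C_nonneg by simp
    fix z
    have "(norm (trunc N (cblinfun_power G m z)))\<^sup>2 \<le> C * sq N (cblinfun_power G m z)"
      by (rule norm_trunc_le)
    also have "\<dots> \<le> C * ((\<epsilon>\<^sup>2) ^ m * (C * (norm z)\<^sup>2))"
      by (intro mult_left_mono C_nonneg order_trans[OF sqG] sq_le) simp
    also have "\<dots> = (C * \<epsilon> ^ m * norm z)\<^sup>2"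
      by (simp add: power2_eq_square power_mult_distrib ac_simps)
    finally have "norm (trunc N (cblinfun_power G m z)) \<le> C * \<epsilon> ^ m * norm z"
      by (rule power2_le_imp_le) (use assms C_nonneg in simp)
    then show "norm ((cblinfun_power (trunc N) (Suc m) - K) z) \<le> C * \<epsilon> ^ m * norm z"
      by (simp add: K_def cblinfun_rep_simps cblinfun_linear_simps)
  qed
  moreover have "finite_rank (m * n) K"
    unfolding K_def by (intro finite_rank_compose(1) fr)
  moreover have "real (m * n) * \<epsilon>\<^sup>2 \<le> real m * C\<^sup>2"
    using mult_left_mono[OF n, of "real m"] by (simp add: mult.assoc)
  ultimately show ?thesis using that by blast
qed

end

text \<open>The bounds for \<open>trunc N\<close> do not depend on N, so N may be chosen after
  \<epsilon>. In other words, the approximation numbers of S^(m+1) are O(n^(-m/2)).\<close>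

lemma nuclear_power_approx:
  assumes "nuclear S"
  obtains D where "0 \<le> D"
    "\<And>\<epsilon>. 0 < \<epsilon> \<Longrightarrow> \<exists>K r. finite_rank r K \<and> real r * \<epsilon>\<^sup>2 \<le> D \<and> norm (cblinfun_power S (Suc m) - K) \<le> D * \<epsilon> ^ m"
proof -
  obtain x' x where bal: "\<And>k. norm (x' k) = norm (x k)" "summable (\<lambda>k. (norm (x k))\<^sup>2)"
    and S: "(\<lambda>k. rank_one (x' k) (x k)) sums S"
    using nuclear_balanced_rep[OF assms] by blast
  interpret balanced_sequence x' x using bal by unfold_locales
  have trunc: "trunc \<longlonglongrightarrow> S"
    using S by (simp add: sums_def trunc_def[abs_def])
  \<comment> \<open>The extra 1 absorbs the distance between the powers of S and of its
    truncation.\<close>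
  define D where "D = max (real m * C\<^sup>2) (C + 1)"
  show ?thesis
  proof (rule that[of D])
    show "0 \<le> D" using C_nonneg by (simp add: D_def)
    fix \<epsilon> :: real assume \<epsilon>: "0 < \<epsilon>"
    have "(\<lambda>N. cblinfun_power (trunc N) (Suc m)) \<longlonglongrightarrow> cblinfun_power S (Suc m)"
      by (rule tendsto_cblinfun_power[OF trunc])
    then obtain N where N: "norm (cblinfun_power (trunc N) (Suc m) - cblinfun_power S (Suc m)) < \<epsilon> ^ m"
      using LIMSEQ_D[of _ _ "\<epsilon> ^ m"] \<epsilon> by (metis le_refl zero_less_power)
    obtain K r where K: "finite_rank r K" "real r * \<epsilon>\<^sup>2 \<le> real m * C\<^sup>2"
      "norm (cblinfun_power (trunc N) (Suc m) - K) \<le> C * \<epsilon> ^ m"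
      using trunc_power_approx[OF \<epsilon>, where N = N and m = m] by blast
    have "norm (cblinfun_power S (Suc m) - K) \<le> (C + 1) * \<epsilon> ^ m"
      using N K(3) norm_triangle_ineq4[of "cblinfun_power (trunc N) (Suc m) - K"
          "cblinfun_power (trunc N) (Suc m) - cblinfun_power S (Suc m)"]
      by (simp add: distrib_right)
    also have "\<dots> \<le> D * \<epsilon> ^ m" using \<epsilon> by (intro mult_right_mono) (auto simp: D_def)
    finally show "\<exists>K r. finite_rank r K \<and> real r * \<epsilon>\<^sup>2 \<le> D \<and> norm (cblinfun_power S (Suc m) - K) \<le> D * \<epsilon> ^ m"
      using K by (intro exI[of _ K] exI[of _ r]) (auto simp: D_def)
  qed
qed

text \<open>For \<epsilon> = 2^(-j) the ranks grow like 4^j, while the norms of successive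
  differences fall like 2^(-9j), with cube root 2^(-3j); the product is O(2^(-j)). Any m > 6 leaves
  a geometric series, m = 9 makes the cube root a plain power, and 10 = m + 1.\<close>

theorem nuclear_power_third_nuclear:
  fixes S :: "'a::complex_banach \<Rightarrow>\<^sub>C\<^sub>L 'a"
  assumes "nuclear S"
  shows "s_nuclear (1/3) (cblinfun_power S 10)"
proof -
  define R where "R = cblinfun_power S (Suc 9)"
  obtain D where D: "0 \<le> D"
    and approx: "\<And>\<epsilon>. 0 < \<epsilon> \<Longrightarrow> \<exists>K r. finite_rank r K \<and> real r * \<epsilon>\<^sup>2 \<le> D \<and> norm (R - K) \<le> D * \<epsilon> ^ 9"
    unfolding R_def using nuclear_power_approx[OF assms, of 9] by blast
  have "\<forall>j. \<exists>p. finite_rank (snd p) (fst p) \<and> real (snd p) * ((1/2) ^ j)\<^sup>2 \<le> D \<and>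
      norm (R - fst p) \<le> D * ((1/2) ^ j) ^ 9"
    using approx[of "(1/2) ^ _"] by (simp del: power_one_over) 
  from choice[OF this] obtain p where p: "\<forall>j. finite_rank (snd (p j)) (fst (p j)) \<and>
      real (snd (p j)) * ((1/2) ^ j)\<^sup>2 \<le> D \<and> norm (R - fst (p j)) \<le> D * ((1/2) ^ j) ^ 9" ..
  define K where "K j = fst (p j)" for j
  define r where "r j = snd (p j)" for j
  have Kr: "finite_rank (r j) (K j)" and r: "real (r j) * ((1/2) ^ j)\<^sup>2 \<le> D"
    and K: "norm (R - K j) \<le> D * ((1/2) ^ j) ^ 9" for j
    using p by (auto simp: K_def r_def)
  define V where "V j = (case j of 0 \<Rightarrow> K 0 | Suc i \<Rightarrow> K (Suc i) - K i)" for j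
  define q where "q j = (case j of 0 \<Rightarrow> r 0 | Suc i \<Rightarrow> r (Suc i) + r i)" for j
  have Vq: "finite_rank (q (Suc j)) (V (Suc j))" for j
    using finite_rank_add[OF Kr finite_rank_uminus[OF Kr], of "Suc j" j] by (simp add: V_def q_def)
  have V0: "finite_rank (q 0) (V 0)" using Kr by (simp add: V_def q_def)
  have partial: "(\<Sum>j<Suc n. V j) = K n" for n
    by (induction n) (simp_all add: V_def)
  have "(\<lambda>n. R - K n) \<longlonglongrightarrow> 0"
  proof (rule Lim_null_comparison[OF always_eventually, rotated])
    show "(\<lambda>n. D * ((1/2) ^ n) ^ 9) \<longlonglongrightarrow> 0"
    proof -
      have "(\<lambda>n. D * ((1/2) ^ n) ^ 9) \<longlonglongrightarrow> D * 0 ^ 9"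
        by (intro tendsto_intros LIMSEQ_power_zero) auto
      then show ?thesis by simp
    qed
  qed (use K in blast)
  then have "K \<longlonglongrightarrow> R"
    using tendsto_diff[of "\<lambda>n. R" R sequentially "\<lambda>n. R - K n" 0] by simp
  then have "V sums R"
    unfolding sums_def by (subst filterlim_sequentially_Suc[symmetric]) (simp add: partial[abs_def] del: sum.lessThan_Suc)
  moreover have "finite_rank (q j) (V j)" for j using V0 Vq by (cases j) auto
  moreover have "summable (\<lambda>j. real (q j) * (2 * norm (V j)) powr (1/3))"
  proof (subst summable_Suc_iff[symmetric], rule summable_comparison_test')
    define E where "E = 5 * D * (4 * D) powr (1/3)"
    show "summable (\<lambda>j. E * (1/2) ^ j)"
      by (intro summable_mult summable_geometric) simp
    fix j
    define t where "t = (1/2 :: real) ^ j"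
    have t: "0 < t" by (simp add: t_def)
    have "norm (V (Suc j)) \<le> norm (R - K j) + norm (R - K (Suc j))"
      using norm_triangle_ineq4[of "R - K j" "R - K (Suc j)"] by (simp add: V_def)
    also have "\<dots> \<le> D * t ^ 9 + D * (t / 2) ^ 9"
      using K[of j] K[of "Suc j"] by (simp add: t_def)
    also have "\<dots> \<le> D * t ^ 9 + D * t ^ 9"
      using D t by (intro add_left_mono mult_left_mono power_mono) auto
    finally have "2 * norm (V (Suc j)) \<le> (4 * D) * t ^ 9" by simp
    then have "(2 * norm (V (Suc j))) powr (1/3) \<le> ((4 * D) * t ^ 9) powr (1/3)"
      by (intro powr_mono2) auto
    also have "\<dots> = (4 * D) powr (1/3) * t ^ 3"
    proof -
      have "(t ^ 9) powr (1/3) = ((t ^ 3) powr 3) powr (1/3)"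
        using t by (simp add: powr_numeral flip: power_mult)
      also have "\<dots> = t ^ 3"
        using t unfolding powr_powr by simp
      finally have "(t ^ 9) powr (1/3) = t ^ 3" .
      then show ?thesis using D t by (simp add: powr_mult)
    qed
    finally have 1: "(2 * norm (V (Suc j))) powr (1/3) \<le> (4 * D) powr (1/3) * t ^ 3" .
    have "real (q (Suc j)) * t\<^sup>2 \<le> 4 * D + D"
      using r[of j] r[of "Suc j"] by (simp add: q_def t_def power2_eq_square distrib_right)
    then have "real (q (Suc j)) * t\<^sup>2 * ((4 * D) powr (1/3) * t) \<le> 5 * D * ((4 * D) powr (1/3) * t)"
      using t by (intro mult_right_mono) auto
    moreover have "real (q (Suc j)) * (2 * norm (V (Suc j))) powr (1/3)
        \<le> real (q (Suc j)) * ((4 * D) powr (1/3) * t ^ 3)"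
      by (intro mult_left_mono 1) simp
    ultimately show "norm (real (q (Suc j)) * (2 * norm (V (Suc j))) powr (1/3)) \<le> E * (1/2) ^ j"
      by (simp add: E_def t_def[symmetric] power3_eq_cube power2_eq_square ac_simps)
  qed
  ultimately have "s_nuclear (1/3) R"
    by (intro s_nuclear_sum_of_finite_rank[of "1/3" V R q]) auto
  then show ?thesis by (simp add: R_def numeral_eq_Suc)
qed


section \<open>Eigenvalues of finite-rank truncations\<close>

lemma trace_mat_mult_commute:
  fixes A B :: "complex mat"
  assumes "A \<in> carrier_mat n n" "B \<in> carrier_mat n n"
  shows "(\<Sum>i<n. (A * B) $$ (i, i)) = (\<Sum>i<n. (B * A) $$ (i, i))"
proof -
  have "(\<Sum>i<n. (A * B) $$ (i, i)) = (\<Sum>i<n. \<Sum>k<n. A $$ (i, k) * B $$ (k, i))"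
    using assms by (intro sum.cong) (auto simp: scalar_prod_def atLeast0LessThan)
  also have "\<dots> = (\<Sum>k<n. \<Sum>i<n. B $$ (k, i) * A $$ (i, k))"
    by (subst sum.swap) (simp add: mult.commute)
  also have "\<dots> = (\<Sum>k<n. (B * A) $$ (k, k))"
    using assms by (intro sum.cong) (auto simp: scalar_prod_def atLeast0LessThan)
  finally show ?thesis .
qed

text \<open>The Schur form has zero diagonal, so it and its powers are strictly upper triangular;
  the trace is invariant under similarity.\<close>

lemma trace_mat_power_eq_0:
  fixes A :: "complex mat"
  assumes A: "A \<in> carrier_mat n n" and ev: "\<And>\<mu>. Char_Poly.eigenvalue A \<mu> \<Longrightarrow> \<mu> = 0"
  shows "(\<Sum>i<n. (A ^\<^sub>m Suc j) $$ (i, i)) = 0"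
proof -
  obtain es where es: "char_poly A = (\<Prod>e\<leftarrow>es. [:- e, 1:])" "length es = n"
    using char_poly_factorized[OF A] by blast
  have es0: "e = 0" if "e \<in> set es" for e
    using that ev eigenvalue_root_char_poly[OF A, of e] es(1) linear_poly_root by metis
  obtain U P Q where "schur_decomposition A es = (U, P, Q)"
    by (cases "schur_decomposition A es") auto
  from schur_decomposition[OF A es(1) this]
  have sim: "similar_mat_wit A U P Q" and ut: "upper_triangular U" and diag: "diag_mat U = es"
    by auto
  note car = similar_mat_witD2[OF A sim]
  have U0: "U $$ (i, k) = 0" if "k \<le> i" "i < n" for i k
  proof (cases "k = i")
    case True
    have "U $$ (i, i) \<in> set (diag_mat U)" using car(5) that by (auto simp: diag_mat_def)
    then show ?thesis using es0 diag True by simp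
  next
    case False
    then show ?thesis using ut that car(5) by (intro upper_triangularD) auto
  qed
  have U_pow: "U ^\<^sub>m j \<in> carrier_mat n n" for j using car(5) by simp
  have "\<forall>i<n. \<forall>k\<le>i. (U ^\<^sub>m Suc j) $$ (i, k) = 0"
  proof (induction j)
    case 0
    then show ?case using U0 car(5) by simp
  next
    case (Suc j)
    show ?case
    proof (intro allI impI)
      fix i k assume i: "i < n" and k: "k \<le> i"
      have "(U ^\<^sub>m Suc (Suc j)) $$ (i, k) = (\<Sum>m<n. (U ^\<^sub>m Suc j) $$ (i, m) * U $$ (m, k))"
        using i k car(5) U_pow[of "Suc j"] by (simp add: scalar_prod_def atLeast0LessThan del: pow_mat.simps) (simp add: scalar_prod_def atLeast0LessThan)
      also have "\<dots> = 0"
      proof (rule sum.neutral, rule ballI)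
        fix m assume "m \<in> {..<n}"
        then show "(U ^\<^sub>m Suc j) $$ (i, m) * U $$ (m, k) = 0"
          using Suc i k U0[of k m] by (cases "m \<le> i") auto
      qed
      finally show "(U ^\<^sub>m Suc (Suc j)) $$ (i, k) = 0" .
    qed
  qed
  then have "(\<Sum>i<n. (U ^\<^sub>m Suc j) $$ (i, i)) = 0" by (intro sum.neutral) auto
  moreover have "(\<Sum>i<n. (A ^\<^sub>m Suc j) $$ (i, i)) = (\<Sum>i<n. (U ^\<^sub>m Suc j) $$ (i, i))"
  proof -
    have "A ^\<^sub>m Suc j = P * ((U ^\<^sub>m Suc j) * Q)"
      unfolding similar_mat_wit_pow_id[OF sim, of "Suc j"] by (rule assoc_mult_mat[OF car(6) U_pow car(7)])
    then have "(\<Sum>i<n. (A ^\<^sub>m Suc j) $$ (i, i)) = (\<Sum>i<n. ((U ^\<^sub>m Suc j) * Q * P) $$ (i, i))"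
      using trace_mat_mult_commute[OF car(6) mult_carrier_mat[OF U_pow car(7)]] by metis
    also have "(U ^\<^sub>m Suc j) * Q * P = U ^\<^sub>m Suc j"
      using assoc_mult_mat[OF U_pow car(7) car(6)] car(2) right_mult_one_mat[OF U_pow] by metis
    finally show ?thesis .
  qed
  ultimately show ?thesis by simp
qed

text \<open>B factors as Y X' with X' = (x'_k) and Y = (y_k), and the matrix A = (x'_k (y_i)) is X'
  Y. The two products share their nonzero eigenvalues, and the diagonal of A^(j+1) consists of the
  x'_k (B^j y_k).\<close>

lemma trace_power_eq_0:
  fixes x' :: "nat \<Rightarrow> 'a::complex_normed_vector dual" and y :: "nat \<Rightarrow> 'a" and N :: nat
  defines "B \<equiv> \<Sum>k<N. rank_one (x' k) (y k)"
  assumes ev: "\<And>\<mu> z. \<mu> \<noteq> 0 \<Longrightarrow> B z = \<mu> *\<^sub>C z \<Longrightarrow> z = 0"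
  shows "(\<Sum>k<N. x' k (cblinfun_power B j (y k))) = 0"
proof -
  define A where "A = mat N N (\<lambda>(k, i). x' k (y i))"
  have A: "A \<in> carrier_mat N N" by (simp add: A_def)
  have Bz: "B z = (\<Sum>k<N. x' k z *\<^sub>C y k)" for z
    by (simp add: B_def sum_cblinfun_apply rank_one.rep_eq)
  have "(A ^\<^sub>m Suc j) $$ (k, i) = x' k (cblinfun_power B j (y i))" if "k < N" "i < N" for k i
    using that
  proof (induction j arbitrary: k i)
    case 0
    then show ?case using A by (simp add: A_def id_cblinfun.rep_eq)
  next
    case (Suc j)
    have car: "A ^\<^sub>m Suc j \<in> carrier_mat N N" by (rule pow_carrier_mat[OF A])
    have "(A ^\<^sub>m Suc (Suc j)) $$ (k, i) = (A ^\<^sub>m Suc j * A) $$ (k, i)" by simp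
    also have "\<dots> = (\<Sum>m<N. (A ^\<^sub>m Suc j) $$ (k, m) * A $$ (m, i))"
      using Suc.prems A car by (subst index_mult_mat) (auto simp: scalar_prod_def atLeast0LessThan simp del: pow_mat.simps)
    also have "\<dots> = (\<Sum>m<N. x' k (cblinfun_power B j (y m)) * x' m (y i))"
      using Suc by (intro sum.cong) (auto simp: A_def simp del: pow_mat.simps)
    also have "\<dots> = x' k (cblinfun_power B j (B (y i)))"
      by (simp add: Bz cblinfun_apply_sum cblinfun_linear_simps scaleC_complex_def mult.commute)
    finally show ?case by (simp add: cblinfun_power_Suc_apply(2) del: cblinfun_power.simps)
  qed
  then have "(\<Sum>k<N. x' k (cblinfun_power B j (y k))) = (\<Sum>k<N. (A ^\<^sub>m Suc j) $$ (k, k))" by simp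
  also have "\<dots> = 0"
  proof (rule trace_mat_power_eq_0[OF A])
    fix \<mu> assume "Char_Poly.eigenvalue A \<mu>"
    then obtain v where v: "v \<in> carrier_vec N" "v \<noteq> 0\<^sub>v N" "A *\<^sub>v v = \<mu> \<cdot>\<^sub>v v"
      using A by (auto simp: Char_Poly.eigenvalue_def eigenvector_def)
    \<comment> \<open>Y carries eigenvectors of A to eigenvectors of B; if the image vanished, \<mu>
      v would vanish too.\<close>
    define z where "z = (\<Sum>i<N. v $ i *\<^sub>C y i)"
    have xz: "x' k z = \<mu> * v $ k" if "k < N" for k
    proof -
      have "(A *\<^sub>v v) $ k = (\<Sum>i<N. x' k (y i) * v $ i)"
        using that v(1) by (simp add: A_def scalar_prod_def atLeast0LessThan)
      also have "\<dots> = x' k z"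
        by (simp add: z_def cblinfun_apply_sum cblinfun_linear_simps scaleC_complex_def mult.commute)
      finally show ?thesis using v that by simp
    qed
    have "B z = \<mu> *\<^sub>C z"
    proof -
      have "B z = (\<Sum>k<N. (\<mu> * v $ k) *\<^sub>C y k)" unfolding Bz by (simp add: xz)
      also have "\<dots> = \<mu> *\<^sub>C z" unfolding z_def by (simp add: complex_vector.scale_sum_right scaleC_scaleC)
      finally show ?thesis .
    qed
    then have "\<mu> \<noteq> 0 \<Longrightarrow> z = 0" using ev by blast
    then have "\<mu> \<noteq> 0 \<Longrightarrow> v $ k = 0" if "k < N" for k
      using xz[OF that] by (simp add: cblinfun_linear_simps)
    then have "\<mu> \<noteq> 0 \<Longrightarrow> v = 0\<^sub>v N" using v(1) by (intro eq_vecI) auto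
    then show "\<mu> = 0" using v(2) by blast
  qed
  finally show ?thesis .
qed

text \<open>Upper triangular form of T along v, with e on the diagonal.\<close>

definition eigenflag :: "('a::complex_normed_vector \<Rightarrow>\<^sub>C\<^sub>L 'a) \<Rightarrow> nat \<Rightarrow> (nat \<Rightarrow> complex) \<Rightarrow> (nat \<Rightarrow> 'a) \<Rightarrow> bool"
  where "eigenflag T n e v \<longleftrightarrow>
    (\<forall>i<n. T (v i) - e i *\<^sub>C v i \<in> complex_vector.span (v ` {..<i}))"

text \<open>Back substitution: the triangular system of T - \<mu> has no zero on its
  diagonal.\<close>

lemma eigenflag_solve:
  assumes "eigenflag T n e v" "m \<le> n" "\<And>i. i < m \<Longrightarrow> e i \<noteq> \<mu>" "w \<in> complex_vector.span (v ` {..<m})"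
  shows "\<exists>u\<in>complex_vector.span (v ` {..<m}). T u - \<mu> *\<^sub>C u = w"
  using assms(2-)
proof (induction m arbitrary: w)
  case 0
  then show ?case by (auto simp: cblinfun_linear_simps)
next
  case (Suc m)
  let ?S = "complex_vector.span (v ` {..<m})"
  have Sm: "v ` {..<Suc m} = insert (v m) (v ` {..<m})" by (simp add: lessThan_Suc)
  obtain c where c: "w - c *\<^sub>C v m \<in> ?S"
    using Suc.prems(3) unfolding Sm complex_vector.span_breakdown_eq by blast
  define l where "l = T (v m) - e m *\<^sub>C v m"
  have l: "l \<in> ?S" using assms(1) Suc.prems(1) by (auto simp: eigenflag_def l_def)
  define d where "d = c / (e m - \<mu>)"
  have cd: "c = d * (e m - \<mu>)" using Suc.prems(2)[of m] by (simp add: d_def)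
  have "w - c *\<^sub>C v m - d *\<^sub>C l \<in> ?S"
    by (intro complex_vector.span_diff complex_vector.span_scale c l)
  then obtain u where u: "u \<in> ?S" "T u - \<mu> *\<^sub>C u = w - c *\<^sub>C v m - d *\<^sub>C l"
    using Suc.IH[of "w - c *\<^sub>C v m - d *\<^sub>C l"] Suc.prems by auto
  have "T (u + d *\<^sub>C v m) - \<mu> *\<^sub>C (u + d *\<^sub>C v m) = (T u - \<mu> *\<^sub>C u) + d *\<^sub>C (l + (e m - \<mu>) *\<^sub>C v m)"
    by (simp add: l_def cblinfun_linear_simps scaleC_add_right scaleC_scaleC algebra_simps
        complex_vector.scale_right_diff_distrib complex_vector.scale_left_diff_distrib)
  also have "\<dots> = w"
    by (simp add: u cd scaleC_add_right scaleC_scaleC)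
  finally have "T (u + d *\<^sub>C v m) - \<mu> *\<^sub>C (u + d *\<^sub>C v m) = w" .
  moreover have "u + d *\<^sub>C v m \<in> complex_vector.span (v ` {..<Suc m})"
    unfolding Sm using subsetD[OF complex_vector.span_mono[OF subset_insertI] u(1)]
    by (intro complex_vector.span_add complex_vector.span_scale[OF complex_vector.span_base]) auto
  ultimately show ?case by blast
qed

text \<open>At the first index m with diagonal entry \<open>e i\<close>, the operator T - e i is
  onto on the span of the earlier vectors, so v m can be corrected by them to an eigenvector; it
  stays nonzero by independence.\<close>

lemma eigenflag_eigenvalue:
  assumes flag: "eigenflag T n e v" and "i < n"
    and ind: "\<And>i. i < n \<Longrightarrow> v i \<notin> complex_vector.span (v ` {..<i})"
  shows "eigenvalue T (e i)"
proof -
  define m where "m = (LEAST m. e m = e i)"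
  have m: "e m = e i" "m \<le> i" "\<And>k. k < m \<Longrightarrow> e k \<noteq> e i"
    unfolding m_def by (auto intro: LeastI Least_le dest: not_less_Least)
  then have "m < n" using assms(2) by simp
  then have "T (v m) - e i *\<^sub>C v m \<in> complex_vector.span (v ` {..<m})"
    using flag m(1) by (auto simp: eigenflag_def)
  then obtain u where u: "u \<in> complex_vector.span (v ` {..<m})" "T u - e i *\<^sub>C u = T (v m) - e i *\<^sub>C v m"
    using eigenflag_solve[OF flag _ m(3)] \<open>m < n\<close> by (metis less_imp_le)
  then have "T (v m - u) = e i *\<^sub>C (v m - u)"
    by (simp add: cblinfun_linear_simps complex_vector.scale_right_diff_distrib algebra_simps)
  moreover have "v m - u \<noteq> 0" using u(1) ind[OF \<open>m < n\<close>] by auto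
  ultimately show ?thesis unfolding Defs.eigenvalue_def by blast
qed

lemma eigenflag_invariant:
  assumes flag: "eigenflag T n e v" and "m \<le> n" and w: "w \<in> complex_vector.span (v ` {..<m})"
  shows "T w \<in> complex_vector.span (v ` {..<m})"
  using w
proof (induction rule: complex_vector.span_induct_alt)
  case base
  then show ?case by (simp add: cblinfun_linear_simps complex_vector.span_zero)
next
  case (step c z w)
  obtain i where i: "i < m" "z = v i" using step(1) by auto
  have "complex_vector.span (v ` {..<i}) \<subseteq> complex_vector.span (v ` {..<m})"
    using i by (intro complex_vector.span_mono) auto
  then have "T (v i) - e i *\<^sub>C v i \<in> complex_vector.span (v ` {..<m})"
    using flag i assms(2) by (auto simp: eigenflag_def)
  moreover have "e i *\<^sub>C v i \<in> complex_vector.span (v ` {..<m})"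
    using i by (intro complex_vector.span_scale complex_vector.span_base) auto
  ultimately have "T z \<in> complex_vector.span (v ` {..<m})"
    using complex_vector.span_add i by fastforce
  then show ?case
    using step(2) by (auto simp: cblinfun_linear_simps intro!: complex_vector.span_add complex_vector.span_scale)
qed

lemma eigenflag_power:
  assumes flag: "eigenflag T n e v" and "i < n"
  shows "cblinfun_power T j (v i) - e i ^ j *\<^sub>C v i \<in> complex_vector.span (v ` {..<i})"
proof (induction j)
  case 0
  then show ?case by (simp add: id_cblinfun.rep_eq complex_vector.span_zero scaleC_one)
next
  case (Suc j)
  let ?y = "cblinfun_power T j (v i)"
  have "T (?y - e i ^ j *\<^sub>C v i) + e i ^ j *\<^sub>C (T (v i) - e i *\<^sub>C v i) \<in> complex_vector.span (v ` {..<i})"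
    using flag assms(2)
    by (intro complex_vector.span_add complex_vector.span_scale eigenflag_invariant[OF flag] Suc)
      (auto simp: eigenflag_def)
  also have "T (?y - e i ^ j *\<^sub>C v i) + e i ^ j *\<^sub>C (T (v i) - e i *\<^sub>C v i)
      = cblinfun_power T (Suc j) (v i) - e i ^ Suc j *\<^sub>C v i"
    by (simp add: cblinfun_linear_simps cblinfun_rep_simps complex_vector.scale_right_diff_distrib
        scaleC_scaleC mult.commute)
  finally show ?case .
qed

section \<open>Schur triangularisation of a truncation\<close>

context balanced_sequence
begin

lemma ip_span_eq_0:
  assumes "orthonormal N n v" "i < n" "m \<le> i" "w \<in> complex_vector.span (v ` {..<m})"
  shows "ip N w (v i) = 0"
  using assms(4)
proof (induction rule: complex_vector.span_induct_alt)
  case (step c z w)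
  then obtain j where "j < m" "z = v j" by auto
  then show ?case using step assms by (auto simp: ip_linear orthonormal_def)
qed (simp add: ip_linear)

lemma proj_span:
  assumes "orthonormal N n v" "w \<in> complex_vector.span (v ` {..<n})"
  shows "proj N n v w = w"
  using assms(2)
proof (induction rule: complex_vector.span_induct_alt)
  case (step c z w)
  then obtain j where j: "j < n" "z = v j" by auto
  have "proj N n v z = (\<Sum>i<n. if i = j then v i else 0)"
    unfolding proj_apply j using assms(1) j(1)
    by (intro sum.cong) (auto simp: orthonormal_def scaleC_one)
  then show ?case using step j by (simp add: cblinfun_linear_simps)
qed (simp add: cblinfun_linear_simps)

lemma proj_in_span: "proj N n v w \<in> complex_vector.span (v ` {..<n})"
  unfolding proj_apply
  by (intro complex_vector.span_sum complex_vector.span_scale complex_vector.span_base) auto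

text \<open>Length is bounded by N, so a longest orthonormal flag with nonzero diagonal exists. An
  eigenvector of (1 - P) T for a nonzero eigenvalue is orthogonal to the flag and, once normalised,
  would prolong it.\<close>

lemma maximal_eigenflag:
  obtains n e v where "orthonormal N n v" "eigenflag (trunc N) n e v" "\<And>i. i < n \<Longrightarrow> e i \<noteq> 0"
    "\<forall>\<mu> z. \<mu> \<noteq> 0 \<longrightarrow> trunc N z - proj N n v (trunc N z) = \<mu> *\<^sub>C z \<longrightarrow> z = 0"
proof -
  define P where "P n \<longleftrightarrow> (\<exists>e v. orthonormal N n v \<and> eigenflag (trunc N) n e v \<and> (\<forall>i<n. e i \<noteq> 0))" for n
  have "P 0" by (simp add: P_def orthonormal_def eigenflag_def)
  moreover have "P n \<Longrightarrow> n \<le> N" for n using orthonormal_le by (auto simp: P_def)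
  ultimately obtain n where n: "P n" and max: "\<And>m. P m \<Longrightarrow> m \<le> n"
    using ex_has_greatest_nat[of P 0 "\<lambda>n. n" "Suc N"] by (auto simp: less_Suc_eq_le)
  then obtain e v where v: "orthonormal N n v" and flag: "eigenflag (trunc N) n e v"
    and e: "\<And>i. i < n \<Longrightarrow> e i \<noteq> 0" by (auto simp: P_def)
  have "z = 0" if \<mu>: "\<mu> \<noteq> 0" and z: "trunc N z - proj N n v (trunc N z) = \<mu> *\<^sub>C z" for \<mu> z
  proof (rule ccontr)
    assume "z \<noteq> 0"
    have pos: "0 < sq N z"
    proof (rule ccontr)
      assume "\<not> 0 < sq N z"
      then have "sq N z = 0" using sq_nonneg[of N z] by simp
      then have "trunc N z = 0" using norm_trunc_le[of N z] by simp
      then show False using z \<mu> \<open>z \<noteq> 0\<close> by (simp add: cblinfun_linear_simps)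
    qed
    have "\<mu> * ip N z (v i) = 0" if "i < n" for i
      using ip_minus_proj[OF v that, of "trunc N z"] by (simp add: z ip_linear)
    then have ortho: "ip N z (v i) = 0" if "i < n" for i using \<mu> that by simp
    define r where "r = complex_of_real (1 / sqrt (sq N z))"
    define w where "w = r *\<^sub>C z"
    have on: "orthonormal N (Suc n) (v(n := w))"
      using v ortho normalize_sq[OF pos] by (intro orthonormal_extend) (auto simp: w_def r_def ip_linear)
    have "trunc N w - \<mu> *\<^sub>C w = r *\<^sub>C (trunc N z - \<mu> *\<^sub>C z)"
      by (simp add: w_def cblinfun_linear_simps complex_vector.scale_right_diff_distrib scaleC_scaleC mult.commute)
    also have "trunc N z - \<mu> *\<^sub>C z = proj N n v (trunc N z)" by (simp flip: z)
    finally have "trunc N w - \<mu> *\<^sub>C w \<in> complex_vector.span (v ` {..<n})"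
      by (simp add: complex_vector.span_scale proj_in_span)
    moreover have "(v(n := w)) ` {..<i} = v ` {..<i}" if "i \<le> n" for i using that by auto
    ultimately have "eigenflag (trunc N) (Suc n) (e(n := \<mu>)) (v(n := w))"
      using flag by (simp add: eigenflag_def All_less_Suc)
    then have "P (Suc n)" using on e \<mu>
      unfolding P_def by (intro exI[of _ "e(n := \<mu>)"] exI[of _ "v(n := w)"]) (auto simp: less_Suc_eq)
    then show False using max by fastforce
  qed
  then show ?thesis using that v flag e by blast
qed

text \<open>The flag splits T into a triangular block with diagonal e and the compression (1 - P) T,
  which has no nonzero eigenvalue and contributes nothing to the traces. Schur's inequality follows
  from e_i being the coefficient of T v_i along v_i.\<close>

lemma trunc_eigenvalues:
  obtains n and e :: "nat \<Rightarrow> complex"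
  where "\<And>i. i < n \<Longrightarrow> eigenvalue (trunc N) (e i)" "(\<Sum>i<n. (cmod (e i))\<^sup>2) \<le> C\<^sup>2"
    "\<And>j. (\<Sum>k<N. x' k (cblinfun_power (trunc N) j (x k))) = (\<Sum>i<n. e i ^ Suc j)"
proof -
  obtain n e v where v: "orthonormal N n v" and flag: "eigenflag (trunc N) n e v"
    and e: "\<And>i. i < n \<Longrightarrow> e i \<noteq> 0"
    and max: "\<forall>\<mu> z. \<mu> \<noteq> 0 \<longrightarrow> trunc N z - proj N n v (trunc N z) = \<mu> *\<^sub>C z \<longrightarrow> z = 0"
    using maximal_eigenflag[of N] by metis
  define T where "T = trunc N"
  define P where "P = proj N n v"
  have vv: "ip N (v i) (v i) = 1" if "i < n" for i using v that by (simp add: orthonormal_def)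
  have ip_power: "ip N (cblinfun_power T j (v i)) (v i) = e i ^ j" if "i < n" for i j
    using ip_span_eq_0[OF v that order_refl eigenflag_power[OF flag that, of j]] vv[OF that]
    by (simp add: T_def ip_linear)
  have "v i \<notin> complex_vector.span (v ` {..<i})" if "i < n" for i
    using ip_span_eq_0[OF v that order_refl, of "v i"] vv[OF that] by auto
  then have ev: "eigenvalue T (e i)" if "i < n" for i
    using eigenflag_eigenvalue[OF flag that] by (simp add: T_def)
  have "(cmod (e i))\<^sup>2 \<le> sq N (T (v i))" if "i < n" for i
  proof -
    have "(cmod (ip N (T (v i)) (v i)))\<^sup>2 \<le> (\<Sum>j<n. (cmod (ip N (T (v i)) (v j)))\<^sup>2)"
      using that by (intro member_le_sum) auto
    also have "\<dots> \<le> sq N (T (v i))"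
      unfolding ip_def sq_def by (rule orthonormal_bessel[OF v])
    finally show ?thesis using ip_power[OF that, of 1] by simp
  qed
  then have "(\<Sum>i<n. (cmod (e i))\<^sup>2) \<le> (\<Sum>i<n. sq N (T (v i)))"
    by (intro sum_mono) auto
  also have "\<dots> \<le> C\<^sup>2" unfolding T_def by (rule orthonormal_trunc_sq_le[OF v])
  finally have bound: "(\<Sum>i<n. (cmod (e i))\<^sup>2) \<le> C\<^sup>2" .
  define B where "B = (\<Sum>k<N. rank_one (x' k) (x k - P (x k)))"
  have B: "B z = T z - P (T z)" for z
    by (simp add: B_def T_def P_def trunc_apply sum_cblinfun_apply rank_one.rep_eq
        complex_vector.scale_right_diff_distrib sum_subtractf cblinfun_apply_sum cblinfun_linear_simps)
  have PTP: "P (T (P z)) = T (P z)" for z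
    unfolding P_def T_def by (intro proj_span[OF v] eigenflag_invariant[OF flag] proj_in_span) simp
  \<comment> \<open>The span of the flag is invariant, so (1 - P) T P = 0 and 1 - P intertwines T
    with B.\<close>
  have Bpow: "cblinfun_power B j (z - P z) = cblinfun_power T j z - P (cblinfun_power T j z)" for j z
  proof (induction j)
    case (Suc j)
    let ?y = "cblinfun_power T j z"
    have "B (?y - P ?y) = T ?y - P (T ?y)"
      using PTP[of ?y] by (simp add: B cblinfun_linear_simps)
    then show ?case using Suc by (simp add: cblinfun_rep_simps)
  qed (simp add: id_cblinfun.rep_eq)
  have "(\<Sum>k<N. x' k (cblinfun_power T j (x k))) = (\<Sum>i<n. e i ^ Suc j)" for j
  proof -
    have "(\<Sum>k<N. x' k (cblinfun_power B j (x k - P (x k)))) = 0"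
      by (rule trace_power_eq_0[where x' = x' and y = "\<lambda>k. x k - P (x k)" and N = N, folded B_def])
        (use max B in \<open>auto simp: T_def P_def\<close>)
    then have "(\<Sum>k<N. x' k (cblinfun_power T j (x k))) = (\<Sum>k<N. x' k (P (cblinfun_power T j (x k))))"
      unfolding Bpow by (simp add: cblinfun_linear_simps sum_subtractf)
    also have "\<dots> = (\<Sum>k<N. \<Sum>i<n. ip N (x' k (v i) *\<^sub>C cblinfun_power T j (x k)) (v i))"
      by (simp add: P_def proj_apply cblinfun_apply_sum cblinfun_linear_simps scaleC_complex_def ip_linear mult.commute)
    \<comment> \<open>Cyclicity of the trace in coordinates: the sum over k rebuilds T (v
      i).\<close>
    also have "\<dots> = (\<Sum>i<n. ip N (cblinfun_power T j (T (v i))) (v i))"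
      by (subst sum.swap) (simp add: ip_sum[symmetric] T_def trunc_apply cblinfun_apply_sum cblinfun_linear_simps)
    also have "\<dots> = (\<Sum>i<n. e i ^ Suc j)"
      using ip_power by (intro sum.cong refl) (simp add: cblinfun_power_Suc_apply(2)[symmetric] del: cblinfun_power.simps)
    finally show ?thesis .
  qed
  then show ?thesis
    using that[of n e] ev bound by (simp add: T_def)
qed

end


section \<open>Passage to the limit\<close>

lemma bounded_sequences_diagonal:
  fixes f :: "nat \<Rightarrow> nat \<Rightarrow> complex"
  assumes bound: "\<And>N k. cmod (f N k) \<le> b k"
  obtains r l where "strict_mono r" "\<And>k. (\<lambda>N. f (r N) k) \<longlonglongrightarrow> l k"
proof -
  interpret subseqs "\<lambda>k s. convergent (\<lambda>N. f (s N) k)"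
  proof
    fix k and s :: "nat \<Rightarrow> nat"
    have "bounded (range (\<lambda>N. f (s N) k))"
      using bound by (auto simp: bounded_iff)
    from bounded_imp_convergent_subsequence[OF this] obtain l r where
      "strict_mono r" "((\<lambda>N. f (s N) k) \<circ> r) \<longlonglongrightarrow> l" by blast
    then show "\<exists>r. strict_mono r \<and> convergent (\<lambda>N. f ((s \<circ> r) N) k)"
      by (auto simp: convergent_def o_def intro!: exI[of _ r])
  qed
  have "convergent (\<lambda>N. f (diagseq N) k)" for k
  proof -
    have "convergent (\<lambda>N. f ((diagseq \<circ> (+) (Suc k)) N) k)"
    proof (rule diagseq_holds)
      fix r s :: "nat \<Rightarrow> nat" and n
      assume "strict_mono r" "convergent (\<lambda>N. f (s N) n)"
      then show "convergent (\<lambda>N. f ((s \<circ> r) N) n)"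
        using convergent_subseq_convergent[of "\<lambda>N. f (s N) n" r] by (simp add: o_def)
    qed
    then have "convergent (\<lambda>N. f (diagseq (N + Suc k)) k)"
      by (simp add: o_def add.commute)
    then show ?thesis
      using convergent_ignore_initial_segment[of "\<lambda>N. f (diagseq N) k" "Suc k"] by simp
  qed
  then have "\<exists>l. \<forall>k. (\<lambda>N. f (diagseq N) k) \<longlonglongrightarrow> l k"
    by (auto simp: convergent_def intro: choice)
  then show ?thesis using that subseq_diagseq by blast
qed

lemma suminf_tendsto_dominated:
  fixes a :: "nat \<Rightarrow> nat \<Rightarrow> 'b :: {real_normed_algebra, banach}"
  assumes "\<And>k. (\<lambda>N. a N k) \<longlonglongrightarrow> l k" "\<And>N k. norm (a N k) \<le> M k" "summable M"
  shows "(\<lambda>N. \<Sum>k. a N k) \<longlonglongrightarrow> (\<Sum>k. l k)"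
proof -
  have "\<forall>\<^sub>F (k, N) in sequentially \<times>\<^sub>F sequentially. norm (a N k) \<le> M k"
    using assms(2) by (auto intro: always_eventually)
  from tannerys_theorem[OF assms(1) this assms(3)] show ?thesis by simp
qed

context balanced_sequence
begin

text \<open>Listing eigenvalues by decreasing modulus turns the bound on the sum of squares into
  |\<mu>_i|^2 \<le> C^2 / (i + 1), uniformly in N; dominated convergence needs such a termwise
  bound. Zeros fill up the sequence.\<close>

lemma trunc_eigenvalue_sequence:
  "\<exists>\<mu> :: nat \<Rightarrow> complex. (\<forall>i. \<mu> i \<noteq> 0 \<longrightarrow> eigenvalue (trunc N) (\<mu> i)) \<and>
    (\<forall>i. real (Suc i) * (cmod (\<mu> i))\<^sup>2 \<le> C\<^sup>2) \<and>
    (\<forall>j. (\<lambda>i. \<mu> i ^ Suc j) sums (\<Sum>k<N. x' k (cblinfun_power (trunc N) j (x k))))"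
proof -
  obtain n and e :: "nat \<Rightarrow> complex" where ev: "\<And>i. i < n \<Longrightarrow> eigenvalue (trunc N) (e i)"
    and bound: "(\<Sum>i<n. (cmod (e i))\<^sup>2) \<le> C\<^sup>2"
    and tr: "\<And>j. (\<Sum>k<N. x' k (cblinfun_power (trunc N) j (x k))) = (\<Sum>i<n. e i ^ Suc j)"
    by (rule trunc_eigenvalues[of N]) (rule that)
  define L where "L = sort_key (\<lambda>z. - cmod z) (map e [0..<n])"
  have len: "length L = n" by (simp add: L_def)
  have sum_L: "(\<Sum>i<n. g (L ! i)) = (\<Sum>i<n. g (e i))" for g :: "complex \<Rightarrow> 'c::comm_monoid_add"
  proof -
    have "(\<Sum>i<n. g (L ! i)) = sum_list (map g L)"
      by (simp add: sum_list_sum_nth len atLeast0LessThan)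
    also have "\<dots> = sum_mset (image_mset g (mset (map e [0..<n])))"
      by (simp add: L_def flip: sum_mset_sum_list)
    also have "\<dots> = sum_list (map (g \<circ> e) [0..<n])"
      by (metis map_map mset_map sum_mset_sum_list)
    also have "\<dots> = (\<Sum>i<n. g (e i))"
      by (simp add: interv_sum_list_conv_sum_set_nat atLeast0LessThan)
    finally show ?thesis .
  qed
  define \<mu> where "\<mu> i = (if i < n then L ! i else 0)" for i
  have "eigenvalue (trunc N) (\<mu> i)" if "\<mu> i \<noteq> 0" for i
  proof -
    have "i < n" using that by (simp add: \<mu>_def split: if_splits)
    then have "L ! i \<in> set L" using len by simp
    then show ?thesis using ev \<open>i < n\<close> by (auto simp: \<mu>_def L_def)
  qed
  moreover have "real (Suc i) * (cmod (\<mu> i))\<^sup>2 \<le> C\<^sup>2" for i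
  proof (cases "i < n")
    case True
    have "sorted (map (\<lambda>z. - cmod z) L)" by (simp add: L_def)
    then have dec: "cmod (L ! i) \<le> cmod (L ! k)" if "k \<le> i" for k
      using sorted_nth_mono[of "map (\<lambda>z. - cmod z) L" k i] that True len by simp
    have "real (Suc i) * (cmod (\<mu> i))\<^sup>2 = (\<Sum>k\<le>i. (cmod (L ! i))\<^sup>2)"
      using True by (simp add: \<mu>_def)
    also have "\<dots> \<le> (\<Sum>k\<le>i. (cmod (L ! k))\<^sup>2)"
      using dec by (intro sum_mono power_mono) auto
    also have "\<dots> \<le> (\<Sum>k<n. (cmod (L ! k))\<^sup>2)"
      using True by (intro sum_mono2) auto
    also have "\<dots> \<le> C\<^sup>2" using bound sum_L[of "\<lambda>z. (cmod z)\<^sup>2"] by simp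
    finally show ?thesis .
  qed (simp add: \<mu>_def)
  moreover have "(\<lambda>i. \<mu> i ^ Suc j) sums (\<Sum>k<N. x' k (cblinfun_power (trunc N) j (x k)))" for j
  proof -
    have "(\<lambda>i. \<mu> i ^ Suc j) sums (\<Sum>i<n. \<mu> i ^ Suc j)"
      by (rule sums_finite) (auto simp: \<mu>_def)
    also have "(\<Sum>i<n. \<mu> i ^ Suc j) = (\<Sum>k<N. x' k (cblinfun_power (trunc N) j (x k)))"
      unfolding tr using sum_L[of "\<lambda>z. z ^ Suc j"] by (simp add: \<mu>_def)
    finally show ?thesis .
  qed
  ultimately show ?thesis by blast
qed

lemma norm_trunc: "norm (trunc N) \<le> C"
proof -
  have "norm (trunc N) \<le> (\<Sum>k<N. norm (rank_one (x' k) (x k)))"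
    unfolding trunc_def by (rule norm_sum)
  also have "\<dots> \<le> (\<Sum>k<N. (norm (x k))\<^sup>2)"
    using norm_rank_one[of "x' _" "x _"] by (intro sum_mono) (simp add: balanced power2_eq_square)
  also have "\<dots> \<le> C" by (rule sum_norm_square_le)
  finally show ?thesis .
qed

lemma norm_trunc_power: "norm (cblinfun_power (trunc N) j z) \<le> C ^ j * norm z"
proof (induction j)
  case (Suc j)
  have "norm (cblinfun_power (trunc N) (Suc j) z) \<le> norm (trunc N) * norm (cblinfun_power (trunc N) j z)"
    unfolding cblinfun_power_Suc_apply(1) by (rule norm_cblinfun)
  also have "\<dots> \<le> C * (C ^ j * norm z)"
    by (intro mult_mono norm_trunc Suc C_nonneg) auto
  finally show ?case by (simp add: mult.assoc)
qed (simp add: id_cblinfun.rep_eq)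

lemma trunc_trace_tendsto:
  assumes S: "(\<lambda>k. rank_one (x' k) (x k)) sums S"
  shows "(\<lambda>N. \<Sum>k<N. x' k (cblinfun_power (trunc N) j (x k)))
    \<longlonglongrightarrow> (\<Sum>k. x' k (cblinfun_power S j (x k)))"
proof -
  have trunc: "trunc \<longlonglongrightarrow> S" using S by (simp add: sums_def trunc_def[abs_def])
  define a where "a N k = (if k < N then x' k (cblinfun_power (trunc N) j (x k)) else 0)" for N k
  have "(\<lambda>N. a N k) \<longlonglongrightarrow> x' k (cblinfun_power S j (x k))" for k
  proof -
    have "(\<lambda>N. x' k (cblinfun_power (trunc N) j (x k))) \<longlonglongrightarrow> x' k (cblinfun_power S j (x k))"
      by (intro bounded_linear.tendsto[OF bounded_linear_cblinfun_apply]
          bounded_linear.tendsto[OF bounded_linear_cblinfun_eval] tendsto_cblinfun_power trunc)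
    moreover have "\<forall>\<^sub>F N in sequentially. x' k (cblinfun_power (trunc N) j (x k)) = a N k"
      using eventually_gt_at_top[of k] by eventually_elim (simp add: a_def)
    ultimately show ?thesis by (rule Lim_transform_eventually)
  qed
  moreover have "norm (a N k) \<le> C ^ j * (norm (x k))\<^sup>2" for N k
  proof -
    have "cmod (x' k (cblinfun_power (trunc N) j (x k))) \<le> norm (x' k) * (C ^ j * norm (x k))"
      by (rule order_trans[OF norm_cblinfun mult_left_mono[OF norm_trunc_power]]) simp
    then show ?thesis using C_nonneg by (simp add: a_def balanced power2_eq_square ac_simps)
  qed
  ultimately have "(\<lambda>N. \<Sum>k. a N k) \<longlonglongrightarrow> (\<Sum>k. x' k (cblinfun_power S j (x k)))"
    by (rule suminf_tendsto_dominated[OF _ _ summable_mult[OF square_summable]])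
  moreover have "(\<Sum>k. a N k) = (\<Sum>k<N. x' k (cblinfun_power (trunc N) j (x k)))" for N
    by (subst suminf_finite[of "{..<N}"]) (auto simp: a_def)
  ultimately show ?thesis by simp
qed

text \<open>Unit eigenvectors of the truncations have a subsequence along which all \<open>x'\<^sub>k\<close> converge;
  this replaces the compactness of \<open>S\<close>.\<close>

lemma eigenvalue_limit:
  assumes S: "(\<lambda>k. rank_one (x' k) (x k)) sums S" and r: "strict_mono r"
    and ev: "\<And>N. \<mu> N \<noteq> 0 \<Longrightarrow> eigenvalue (trunc (r N)) (\<mu> N)"
    and lim: "\<mu> \<longlonglongrightarrow> \<kappa>" and "\<kappa> \<noteq> 0"
  shows "eigenvalue S \<kappa>"
proof -
  \<comment> \<open>\<open>ev\<close> speaks of nonzero \<open>\<mu> N\<close> only, so the first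
    terms are dropped.\<close>
  have "\<forall>\<^sub>F N in sequentially. \<mu> N \<noteq> 0"
    using lim \<open>\<kappa> \<noteq> 0\<close> by (rule tendsto_imp_eventually_ne)
  then obtain N0 where N0: "\<And>N. N \<ge> N0 \<Longrightarrow> \<mu> N \<noteq> 0" by (auto simp: eventually_sequentially)
  have "\<exists>y. norm y = 1 \<and> trunc (r (N + N0)) y = \<mu> (N + N0) *\<^sub>C y" for N
  proof -
    obtain z where z: "z \<noteq> 0" "trunc (r (N + N0)) z = \<mu> (N + N0) *\<^sub>C z"
      using ev[of "N + N0"] N0[of "N + N0"] by (auto simp: Defs.eigenvalue_def)
    then show ?thesis
      by (intro exI[of _ "complex_of_real (inverse (norm z)) *\<^sub>C z"])
        (simp add: norm_scaleC norm_inverse cblinfun_linear_simps scaleC_scaleC mult.commute)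
  qed
  then obtain y where y: "\<And>N. norm (y N) = 1" "\<And>N. trunc (r (N + N0)) (y N) = \<mu> (N + N0) *\<^sub>C y N"
    by metis
  have xb: "cmod (x' k (y N)) \<le> norm (x k)" for k N
    using norm_cblinfun[of "x' k" "y N"] by (simp add: y balanced)
  then obtain q c where q: "strict_mono q" and c: "\<And>k. (\<lambda>N. x' k (y (q N))) \<longlonglongrightarrow> c k"
    using bounded_sequences_diagonal[of "\<lambda>N k. x' k (y N)" "\<lambda>k. norm (x k)"] by blast
  have cb: "cmod (c k) \<le> norm (x k)" for k
    by (rule LIMSEQ_le_const2[OF tendsto_norm[OF c]]) (use xb in auto)
  define t where "t N = r (q N + N0)" for N
  have t: "strict_mono t" using r q by (auto simp: t_def strict_mono_def)
  have tN: "N \<le> t N" for N using seq_suble[OF t] .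
  have smc: "summable (\<lambda>k. norm (c k *\<^sub>C x k))"
    by (rule summable_comparison_test'[OF square_summable, of 0])
      (use cb in \<open>auto simp: norm_scaleC power2_eq_square mult_right_mono\<close>)
  \<comment> \<open>The images of the \<open>y (q N)\<close> tend to z by dominated convergence.
    Each \<open>y (q N)\<close> is its image divided by the eigenvalue, so these unit vectors
    converge too, to z / \<kappa>.\<close>
  define z where "z = (\<Sum>k. c k *\<^sub>C x k)"
  define a where "a N k = cmod ((if k < t N then x' k (y (q N)) else 0) - c k) * norm (x k)" for N k
  have a_lim: "(\<lambda>N. a N k) \<longlonglongrightarrow> 0" for k
  proof -
    have "(\<lambda>N. if k < t N then x' k (y (q N)) else 0) \<longlonglongrightarrow> c k"
    proof (rule Lim_transform_eventually[OF c])
      show "\<forall>\<^sub>F N in sequentially. x' k (y (q N)) = (if k < t N then x' k (y (q N)) else 0)"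
        using eventually_gt_at_top[of k] by eventually_elim (use tN less_le_trans in auto)
    qed
    then have "(\<lambda>N. cmod ((if k < t N then x' k (y (q N)) else 0) - c k) * norm (x k)) \<longlonglongrightarrow> 0 * norm (x k)"
      by (intro tendsto_mult tendsto_const tendsto_norm_zero LIM_zero)
    then show ?thesis by (simp add: a_def)
  qed
  have a_bound: "norm (a N k) \<le> 2 * (norm (x k))\<^sup>2" for N k
  proof -
    have "cmod ((if k < t N then x' k (y (q N)) else 0) - c k) \<le> norm (x k) + norm (x k)"
      using xb[of k "q N"] cb[of k] by (intro order_trans[OF norm_triangle_ineq4] add_mono) auto
    then have "a N k \<le> (norm (x k) + norm (x k)) * norm (x k)"
      unfolding a_def by (rule mult_right_mono) simp
    then show ?thesis by (simp add: a_def power2_eq_square algebra_simps)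
  qed
  have "(\<lambda>N. \<Sum>k. a N k) \<longlonglongrightarrow> (\<Sum>k. 0)"
    by (rule suminf_tendsto_dominated[OF a_lim a_bound summable_mult[OF square_summable]])
  then have a0: "(\<lambda>N. \<Sum>k. a N k) \<longlonglongrightarrow> 0" by simp
  have "norm (trunc (t N) (y (q N)) - z) \<le> (\<Sum>k. a N k)" for N
  proof -
    define d where "d k = (if k < t N then x' k (y (q N)) else 0) *\<^sub>C x k - c k *\<^sub>C x k" for k
    have "(\<lambda>k. (if k < t N then x' k (y (q N)) else 0) *\<^sub>C x k) sums
        (\<Sum>k<t N. (if k < t N then x' k (y (q N)) else 0) *\<^sub>C x k)"
      by (rule sums_finite) auto
    then have "(\<lambda>k. (if k < t N then x' k (y (q N)) else 0) *\<^sub>C x k) sums trunc (t N) (y (q N))"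
      by (simp add: trunc_apply)
    then have "d sums (trunc (t N) (y (q N)) - z)"
      unfolding d_def z_def using summable_norm_cancel[OF smc] by (intro sums_diff summable_sums)
    moreover have nd: "norm (d k) = a N k" for k
      by (simp add: d_def a_def norm_scaleC flip: complex_vector.scale_left_diff_distrib)
    moreover have "summable (\<lambda>k. a N k)"
      by (rule summable_comparison_test'[OF summable_mult[OF square_summable, of 2], of 0]) (use a_bound in auto)
    ultimately show ?thesis
      using summable_norm[of d] sums_unique[of d] by simp
  qed
  then have "(\<lambda>N. trunc (t N) (y (q N)) - z) \<longlonglongrightarrow> 0"
    by (intro Lim_null_comparison[OF always_eventually a0]) blast
  then have Tz: "(\<lambda>N. trunc (t N) (y (q N))) \<longlonglongrightarrow> z"
    by (rule LIM_zero_cancel)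
  define \<nu> where "\<nu> N = \<mu> (q N + N0)" for N
  have \<nu>: "\<nu> \<longlonglongrightarrow> \<kappa>" and \<nu>0: "\<nu> N \<noteq> 0" for N
  proof -
    have "strict_mono (\<lambda>N. q N + N0)" using q by (auto simp: strict_mono_def)
    from LIMSEQ_subseq_LIMSEQ[OF lim this] show "\<nu> \<longlonglongrightarrow> \<kappa>" by (simp add: o_def \<nu>_def[abs_def])
  qed (simp add: N0 \<nu>_def)
  have "y (q N) = inverse (\<nu> N) *\<^sub>C trunc (t N) (y (q N))" for N
    using y(2)[of "q N"] \<nu>0[of N] by (simp add: t_def \<nu>_def scaleC_scaleC scaleC_one)
  moreover have "(\<lambda>N. inverse (\<nu> N) *\<^sub>C trunc (t N) (y (q N))) \<longlonglongrightarrow> inverse \<kappa> *\<^sub>C z"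
  proof -
    have "bounded_bilinear (scaleC :: complex \<Rightarrow> 'a \<Rightarrow> 'a)"
      by standard (auto simp: scaleC_add_left scaleC_add_right scaleR_scaleC scaleC_scaleC
          scaleC_complex_def norm_scaleC mult.commute intro!: exI[of _ 1])
    then show ?thesis
      by (rule bounded_bilinear.tendsto) (intro tendsto_inverse \<nu> \<open>\<kappa> \<noteq> 0\<close>, rule Tz)
  qed
  ultimately have yl: "(\<lambda>N. y (q N)) \<longlonglongrightarrow> inverse \<kappa> *\<^sub>C z" by simp
  have trunc: "(\<lambda>N. trunc (t N)) \<longlonglongrightarrow> S"
    using LIMSEQ_subseq_LIMSEQ[OF _ t, of trunc S] S by (simp add: sums_def trunc_def[abs_def] o_def)
  have "(\<lambda>N. trunc (t N) (y (q N))) \<longlonglongrightarrow> S (inverse \<kappa> *\<^sub>C z)"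
    by (rule bounded_bilinear.tendsto[OF bounded_bilinear_cblinfun_apply trunc yl])
  then have "S (inverse \<kappa> *\<^sub>C z) = z" using Tz LIMSEQ_unique by blast
  then have "S (inverse \<kappa> *\<^sub>C z) = \<kappa> *\<^sub>C (inverse \<kappa> *\<^sub>C z)"
    using \<open>\<kappa> \<noteq> 0\<close> by (simp add: scaleC_scaleC scaleC_one)
  moreover have "norm (inverse \<kappa> *\<^sub>C z) = 1"
    using LIMSEQ_unique[OF tendsto_norm[OF yl]] y(1) by simp
  ultimately show ?thesis unfolding Defs.eigenvalue_def by (intro exI[of _ "inverse \<kappa> *\<^sub>C z"]) auto
qed

text \<open>A decay of C (i + 1)^(-1/2) is summable from the third power on; higher powers reduce to
  the third because s \<le> 1.\<close>

lemma summable_sqrt_decay: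
  assumes "2 \<le> j"
  obtains M where "summable M"
    "\<And>z i. real (Suc i) * (cmod z)\<^sup>2 \<le> C\<^sup>2 \<Longrightarrow> cmod (z ^ Suc j) \<le> M i"
proof
  define M where "M i = C ^ Suc j * real (Suc i) powr (-3/2)" for i
  have "summable (\<lambda>i. real i powr (-3/2))" by (simp add: summable_real_powr_iff)
  then show "summable M"
    unfolding M_def
    by (intro summable_mult) (rule summable_Suc_iff[of "\<lambda>i. real i powr (-3/2)", THEN iffD2])
  fix z :: complex and i assume z: "real (Suc i) * (cmod z)\<^sup>2 \<le> C\<^sup>2"
  define s where "s = real (Suc i) powr (-1/2)"
  have s: "0 < s" "s \<le> 1"
    unfolding s_def using powr_mono[of "-1/2" 0 "real (Suc i)"] by simp_all
  have s2: "s\<^sup>2 = inverse (real (Suc i))"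
    unfolding s_def by (subst powr_power) (simp_all add: powr_minus)
  have s3: "s ^ 3 = real (Suc i) powr (-3/2)"
    unfolding s_def by (subst powr_power) simp_all
  have "(cmod z)\<^sup>2 \<le> C\<^sup>2 * s\<^sup>2"
    using z by (simp add: s2 field_simps)
  then have "cmod z \<le> C * s"
    unfolding power_mult_distrib[symmetric]
    by (rule power2_le_imp_le) (use C_nonneg s in simp)
  then have "cmod (z ^ Suc j) \<le> (C * s) ^ Suc j"
    unfolding norm_power by (intro power_mono) auto
  also have "\<dots> \<le> C ^ Suc j * s ^ 3"
    unfolding power_mult_distrib using s assms C_nonneg by (intro mult_left_mono power_decreasing) auto
  finally show "cmod (z ^ Suc j) \<le> M i" by (simp add: M_def s3)
qed

text \<open>Nothing is claimed yet about how often an eigenvalue occurs in \<mu>; that is settled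
  later by comparing power sums.\<close>

theorem eigenvalue_sequence:
  assumes S: "(\<lambda>k. rank_one (x' k) (x k)) sums S"
  obtains \<mu> :: "nat \<Rightarrow> complex" where "\<And>i. \<mu> i \<noteq> 0 \<Longrightarrow> eigenvalue S (\<mu> i)"
    "\<And>j. 2 \<le> j \<Longrightarrow> summable (\<lambda>i. cmod (\<mu> i ^ Suc j))"
    "\<And>j. 2 \<le> j \<Longrightarrow> (\<Sum>i. \<mu> i ^ Suc j) = (\<Sum>k. x' k (cblinfun_power S j (x k)))"
proof -
  obtain e :: "nat \<Rightarrow> nat \<Rightarrow> complex" where
    ev: "\<And>N i. e N i \<noteq> 0 \<Longrightarrow> eigenvalue (trunc N) (e N i)"
    and bound: "\<And>N i. real (Suc i) * (cmod (e N i))\<^sup>2 \<le> C\<^sup>2"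
    and tr: "\<And>N j. (\<lambda>i. e N i ^ Suc j) sums (\<Sum>k<N. x' k (cblinfun_power (trunc N) j (x k)))"
    using choice[of "\<lambda>N \<mu>. (\<forall>i. \<mu> i \<noteq> 0 \<longrightarrow> eigenvalue (trunc N) (\<mu> i)) \<and>
      (\<forall>i. real (Suc i) * (cmod (\<mu> i))\<^sup>2 \<le> C\<^sup>2) \<and>
      (\<forall>j. (\<lambda>i. \<mu> i ^ Suc j) sums (\<Sum>k<N. x' k (cblinfun_power (trunc N) j (x k))))"]
      trunc_eigenvalue_sequence by blast
  have "cmod (e N i) \<le> C" for N i
  proof (rule power2_le_imp_le[OF _ C_nonneg])
    have "(cmod (e N i))\<^sup>2 \<le> real (Suc i) * (cmod (e N i))\<^sup>2"
      using mult_right_mono[of 1 "real (Suc i)" "(cmod (e N i))\<^sup>2"] by simp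
    then show "(cmod (e N i))\<^sup>2 \<le> C\<^sup>2" using bound[of i N] by linarith
  qed
  then obtain r \<mu> where r: "strict_mono r" and \<mu>: "\<And>i. (\<lambda>N. e (r N) i) \<longlonglongrightarrow> \<mu> i"
    using bounded_sequences_diagonal[of e "\<lambda>_. C"] by blast
  show ?thesis
  proof (rule that[of \<mu>])
    show "eigenvalue S (\<mu> i)" if "\<mu> i \<noteq> 0" for i
      using eigenvalue_limit[OF S r _ \<mu>[of i] that] ev by blast
    fix j :: nat assume "2 \<le> j"
    then obtain M where M: "summable M"
      "\<And>z i. real (Suc i) * (cmod z)\<^sup>2 \<le> C\<^sup>2 \<Longrightarrow> cmod (z ^ Suc j) \<le> M i"
      using summable_sqrt_decay by blast
    have "real (Suc i) * (cmod (\<mu> i))\<^sup>2 \<le> C\<^sup>2" for i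
      by (rule LIMSEQ_le_const2[of "\<lambda>N. real (Suc i) * (cmod (e (r N) i))\<^sup>2"])
        (use bound in \<open>auto intro!: tendsto_intros \<mu>\<close>)
    then show "summable (\<lambda>i. cmod (\<mu> i ^ Suc j))"
      using M by (intro summable_comparison_test'[OF M(1), of 0]) (simp only: real_norm_def abs_norm_cancel)
    have "(\<lambda>N. \<Sum>i. e (r N) i ^ Suc j) \<longlonglongrightarrow> (\<Sum>i. \<mu> i ^ Suc j)"
      by (rule suminf_tendsto_dominated[OF _ _ M(1)]) (intro tendsto_power \<mu>, intro M(2) bound)
    moreover have "(\<lambda>N. \<Sum>i. e (r N) i ^ Suc j) \<longlonglongrightarrow> (\<Sum>k. x' k (cblinfun_power S j (x k)))"
      using LIMSEQ_subseq_LIMSEQ[OF trunc_trace_tendsto[OF S] r, of j] tr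
      by (simp add: o_def sums_iff del: power_Suc)
    ultimately show "(\<Sum>i. \<mu> i ^ Suc j) = (\<Sum>k. x' k (cblinfun_power S j (x k)))"
      by (rule LIMSEQ_unique)
  qed
qed

end


section \<open>Families with equal power sums\<close>

lemma has_sum_finite_sum:
  fixes f :: "'k \<Rightarrow> 'i \<Rightarrow> 'a :: topological_comm_monoid_add"
  assumes "\<And>k. k \<in> K \<Longrightarrow> (f k has_sum s k) I"
  shows "((\<lambda>i. \<Sum>k\<in>K. f k i) has_sum (\<Sum>k\<in>K. s k)) I"
  using assms by (induction K rule: infinite_finite_induct) (auto intro: has_sum_add)

lemma has_sum_poly_powers:
  fixes \<mu> :: "'i \<Rightarrow> complex"
  assumes "\<And>l. l \<ge> L \<Longrightarrow> ((\<lambda>i. \<mu> i ^ l) has_sum s l) I"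
    and "n \<ge> L"
  shows "((\<lambda>i. \<mu> i ^ n * poly q (\<mu> i)) has_sum (\<Sum>k\<le>degree q. coeff q k * s (n + k))) I"
proof -
  have "((\<lambda>i. \<Sum>k\<le>degree q. coeff q k * \<mu> i ^ (n + k)) has_sum (\<Sum>k\<le>degree q. coeff q k * s (n + k))) I"
    using assms(2) by (intro has_sum_finite_sum has_sum_cmult_right assms) auto
  then show ?thesis
    by (simp add: poly_altdef power_add sum_distrib_left ac_simps)
qed

lemma finite_large_terms:
  fixes \<mu> :: "'i \<Rightarrow> complex"
  assumes sm: "(\<lambda>i. cmod (\<mu> i ^ L)) summable_on I" and e: "0 < e"
  shows "finite {i\<in>I. e \<le> cmod (\<mu> i)}"
proof (rule ccontr)
  assume inf: "infinite {i\<in>I. e \<le> cmod (\<mu> i)}"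
  define S where "S = (\<Sum>\<^sub>\<infinity>i\<in>I. cmod (\<mu> i ^ L))"
  obtain n :: nat where n: "S / e ^ L < real n" using reals_Archimedean2 by blast
  obtain F where F: "F \<subseteq> {i\<in>I. e \<le> cmod (\<mu> i)}" "finite F" "card F = n"
    using infinite_arbitrarily_large[OF inf, of n] by blast
  have "real n * e ^ L = (\<Sum>i\<in>F. e ^ L)" using F by simp
  also have "\<dots> \<le> (\<Sum>i\<in>F. cmod (\<mu> i ^ L))"
    using F e by (intro sum_mono) (auto simp: norm_power intro!: power_mono)
  also have "\<dots> \<le> S"
    unfolding S_def using F by (intro finite_sum_le_infsum sm) auto
  finally show False using n e by (simp add: pos_divide_less_eq)
qed

text \<open>Isolates the multiplicity of \<open>\<kappa>\<close>: \<open>q\<close> kills the other values of modulus at least \<open>\<bar>\<kappa>\<bar>\<close>, and the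
  factors \<open>(\<mu> / \<kappa>)\<^sup>n\<close> kill the smaller ones as \<open>n\<close> grows.\<close>

lemma power_sums_isolate:
  fixes \<mu> :: "'i \<Rightarrow> complex"
  assumes sm: "(\<lambda>i. cmod (\<mu> i ^ L)) summable_on I"
    and s: "\<And>l. l \<ge> L \<Longrightarrow> ((\<lambda>i. \<mu> i ^ l) has_sum s l) I" and \<kappa>: "\<kappa> \<noteq> 0"
    and q: "poly q \<kappa> \<noteq> 0" "\<And>i. i \<in> I \<Longrightarrow> \<mu> i \<noteq> \<kappa> \<Longrightarrow> cmod \<kappa> \<le> cmod (\<mu> i) \<Longrightarrow> poly q (\<mu> i) = 0"
  shows "finite {i\<in>I. \<mu> i = \<kappa>}"
    and "(\<lambda>n. (\<Sum>k\<le>degree q. coeff q k * s (L + n + k)) / (\<kappa> ^ (L + n) * poly q \<kappa>))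
      \<longlonglongrightarrow> of_nat (card {i\<in>I. \<mu> i = \<kappa>})"
proof -
  let ?F = "{i\<in>I. \<mu> i = \<kappa>}"
  define S where "S = (\<Sum>\<^sub>\<infinity>i\<in>I. cmod (\<mu> i ^ L))"
  have S: "((\<lambda>i. cmod (\<mu> i ^ L)) has_sum S) I"
    unfolding S_def by (rule has_sum_infsum[OF sm])
  have big: "finite {i\<in>I. e \<le> cmod (\<mu> i)}" if "0 < e" for e
    by (rule finite_large_terms[OF sm that])
  show fin: "finite ?F"
    by (rule finite_subset[OF _ big[of "cmod \<kappa>"]]) (use \<kappa> in auto)
  \<comment> \<open>Only finitely many terms have modulus between |\<kappa>| / 2 and |\<kappa>|, so
    their ratios stay away from 1; the added 1/2 covers all smaller terms and keeps R
    nonempty.\<close>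
  define R where "R = insert (1/2) ((\<lambda>i. cmod (\<mu> i) / cmod \<kappa>) ` {i\<in>I. cmod \<kappa> / 2 \<le> cmod (\<mu> i) \<and> cmod (\<mu> i) < cmod \<kappa>})"
  have finR: "finite R"
    unfolding R_def using \<kappa> by (intro finite.insertI finite_imageI finite_subset[OF _ big[of "cmod \<kappa> / 2"]]) auto
  define \<rho> where "\<rho> = Max R"
  have "\<forall>r\<in>R. r < 1" using \<kappa> by (auto simp: R_def)
  then have \<rho>1: "\<rho> < 1" using Max_in[OF finR] by (auto simp: \<rho>_def R_def)
  have half: "1/2 \<le> \<rho>" unfolding \<rho>_def using finR by (intro Max_ge) (auto simp: R_def)
  have \<rho>: "cmod (\<mu> i) / cmod \<kappa> \<le> \<rho>" if "i \<in> I" "cmod (\<mu> i) < cmod \<kappa>" for i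
  proof (cases "cmod \<kappa> / 2 \<le> cmod (\<mu> i)")
    case True
    then show ?thesis unfolding \<rho>_def using finR that by (intro Max_ge) (auto simp: R_def)
  next
    case False
    then have "cmod (\<mu> i) / cmod \<kappa> \<le> 1/2" using \<kappa> by (simp add: field_simps)
    then show ?thesis using half by linarith
  qed
  define Q where "Q = (\<Sum>k\<le>degree q. cmod (coeff q k) * cmod \<kappa> ^ k)"
  have Q: "cmod (poly q z) \<le> Q" if "cmod z \<le> cmod \<kappa>" for z
    unfolding poly_altdef Q_def using that
    by (intro sum_norm_le) (auto simp: norm_mult norm_power intro!: mult_left_mono power_mono)
  have Q0: "0 \<le> Q" unfolding Q_def by (intro sum_nonneg) auto
  define D where "D = Q / cmod (\<kappa> ^ L * poly q \<kappa>)"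
  define t where "t n i = \<mu> i ^ (L + n) * poly q (\<mu> i) / (\<kappa> ^ (L + n) * poly q \<kappa>)" for n i
  define V where "V n = (\<Sum>k\<le>degree q. coeff q k * s (L + n + k)) / (\<kappa> ^ (L + n) * poly q \<kappa>)" for n
  have tV: "(t n has_sum V n) I" for n
    unfolding t_def V_def divide_inverse
    by (intro has_sum_cmult_left has_sum_poly_powers[where L = L] s) auto
  have "(t n has_sum (\<Sum>i\<in>?F. t n i)) ?F" for n by (rule has_sum_finite[OF fin])
  moreover have "(\<Sum>i\<in>?F. t n i) = of_nat (card ?F)" for n
    using \<kappa> q(1) by (simp add: t_def)
  ultimately have tF: "(t n has_sum of_nat (card ?F)) ?F" for n by metis
  have tG: "(t n has_sum (V n - of_nat (card ?F))) (I - ?F)" for n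
    by (rule has_sum_Diff[OF tV tF]) auto
  have bound: "cmod (t n i) \<le> D * \<rho> ^ n * cmod (\<mu> i ^ L)" if i: "i \<in> I - ?F" for n i
  proof (cases "cmod (\<mu> i) < cmod \<kappa>")
    case True
    have "cmod (t n i) = (cmod (\<mu> i) / cmod \<kappa>) ^ n * cmod (poly q (\<mu> i)) * cmod (\<mu> i ^ L) / cmod (\<kappa> ^ L * poly q \<kappa>)"
      by (simp add: t_def norm_divide norm_mult norm_power power_add power_divide ac_simps)
    also have "\<dots> \<le> \<rho> ^ n * Q * cmod (\<mu> i ^ L) / cmod (\<kappa> ^ L * poly q \<kappa>)"
      using True i \<rho> Q Q0 half
      by (intro divide_right_mono mult_right_mono mult_mono power_mono) auto
    finally show ?thesis by (simp add: D_def mult_ac)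
  next
    case False
    then have "t n i = 0" using i q(2)[of i] by (auto simp: t_def)
    then show ?thesis using Q0 half by (simp add: D_def)
  qed
  have "cmod (V n - of_nat (card ?F)) \<le> D * \<rho> ^ n * S" for n
  proof -
    have smG: "(\<lambda>i. cmod (\<mu> i ^ L)) summable_on I - ?F"
      by (rule summable_on_subset[OF sm]) auto
    have "cmod (V n - of_nat (card ?F)) \<le> (\<Sum>\<^sub>\<infinity>i\<in>I - ?F. D * \<rho> ^ n * cmod (\<mu> i ^ L))"
      by (rule norm_infsum_le[OF tG has_sum_infsum bound]) (intro summable_on_cmult_right smG)
    also have "\<dots> = D * \<rho> ^ n * (\<Sum>\<^sub>\<infinity>i\<in>I - ?F. cmod (\<mu> i ^ L))"
      by (rule infsum_cmult_right) (use smG in simp)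
    also have "\<dots> \<le> D * \<rho> ^ n * S"
      unfolding S_def using Q0 half
      by (intro mult_left_mono infsum_mono2 smG sm) (auto simp: D_def)
    finally show ?thesis .
  qed
  note bnd = this
  have "(\<lambda>n. D * \<rho> ^ n * S) \<longlonglongrightarrow> D * 0 * S"
    using half \<rho>1 by (intro tendsto_intros LIMSEQ_power_zero) auto
  then have lim0: "(\<lambda>n. D * \<rho> ^ n * S) \<longlonglongrightarrow> 0" by simp
  have "(\<lambda>n. V n - of_nat (card ?F)) \<longlonglongrightarrow> 0"
    by (rule Lim_null_comparison[OF always_eventually lim0]) (use bnd in blast)
  then show "(\<lambda>n. (\<Sum>k\<le>degree q. coeff q k * s (L + n + k)) / (\<kappa> ^ (L + n) * poly q \<kappa>))
      \<longlonglongrightarrow> of_nat (card ?F)"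
    unfolding V_def by (rule LIM_zero_cancel)
qed

text \<open>A single q, vanishing at the other large values of both families, makes
  \<open>power_sums_isolate\<close> express both counts as the limit of one sequence built from
  s.\<close>

theorem power_sums_determine_multiplicities:
  fixes \<mu> :: "'i \<Rightarrow> complex" and \<nu> :: "'j \<Rightarrow> complex"
  assumes sm: "(\<lambda>i. cmod (\<mu> i ^ L)) summable_on I" "(\<lambda>j. cmod (\<nu> j ^ L)) summable_on J"
    and s: "\<And>l. l \<ge> L \<Longrightarrow> ((\<lambda>i. \<mu> i ^ l) has_sum s l) I" "\<And>l. l \<ge> L \<Longrightarrow> ((\<lambda>j. \<nu> j ^ l) has_sum s l) J"
    and \<kappa>: "\<kappa> \<noteq> 0"
  shows "finite {i\<in>I. \<mu> i = \<kappa>}" "card {i\<in>I. \<mu> i = \<kappa>} = card {j\<in>J. \<nu> j = \<kappa>}"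
proof -
  define Z where "Z = \<mu> ` {i\<in>I. cmod \<kappa> \<le> cmod (\<mu> i)} \<union> \<nu> ` {j\<in>J. cmod \<kappa> \<le> cmod (\<nu> j)} - {\<kappa>}"
  have Z: "finite Z"
    unfolding Z_def using finite_large_terms[OF sm(1)] finite_large_terms[OF sm(2)] \<kappa> by auto
  define q where "q = (\<Prod>z\<in>Z. [:- z, 1:])"
  have q: "poly q x = (\<Prod>z\<in>Z. x - z)" for x by (simp add: q_def poly_prod)
  have q\<kappa>: "poly q \<kappa> \<noteq> 0" using Z by (auto simp: q Z_def)
  have "poly q z = 0" if "z \<in> Z" for z using Z that by (auto simp: q)
  then have q0: "\<And>i. i \<in> I \<Longrightarrow> \<mu> i \<noteq> \<kappa> \<Longrightarrow> cmod \<kappa> \<le> cmod (\<mu> i) \<Longrightarrow> poly q (\<mu> i) = 0"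
    "\<And>j. j \<in> J \<Longrightarrow> \<nu> j \<noteq> \<kappa> \<Longrightarrow> cmod \<kappa> \<le> cmod (\<nu> j) \<Longrightarrow> poly q (\<nu> j) = 0"
    by (auto simp: Z_def)
  note 1 = power_sums_isolate[OF sm(1) s(1) \<kappa> q\<kappa> q0(1)]
  note 2 = power_sums_isolate[OF sm(2) s(2) \<kappa> q\<kappa> q0(2)]
  show "finite {i\<in>I. \<mu> i = \<kappa>}" using 1(1) by simp
  show "card {i\<in>I. \<mu> i = \<kappa>} = card {j\<in>J. \<nu> j = \<kappa>}"
    using LIMSEQ_unique[OF 1(2) 2(2)] by simp
qed


section \<open>Polynomials in an operator\<close>

definition poly_op :: "complex poly \<Rightarrow> ('a::complex_normed_vector \<Rightarrow>\<^sub>C\<^sub>L 'a) \<Rightarrow> 'a \<Rightarrow>\<^sub>C\<^sub>L 'a"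
  where "poly_op p T = (\<Sum>i\<le>degree p. coeff p i *\<^sub>C cblinfun_power T i)"

lemma poly_op_0 [simp]: "poly_op 0 T = 0"
  by (simp add: poly_op_def)

lemma poly_op_pCons: "poly_op (pCons a p) T = a *\<^sub>C id_cblinfun + T \<circ>\<^sub>L poly_op p T"
proof (cases "p = 0")
  case True
  then show ?thesis
    by (simp add: poly_op_def) (rule cblinfun_eqI, simp add: cblinfun_rep_simps cblinfun_linear_simps)
next
  case False
  then show ?thesis
    by (simp add: poly_op_def sum.atMost_Suc_shift cblinfun_compose_sum_right cblinfun_compose_scaleC del: sum.atMost_Suc)
qed

lemma poly_op_add: "poly_op (p + q) T = poly_op p T + poly_op q T"
proof (induction p q rule: poly_induct2)
  case (pCons a p b q)
  then show ?case
    by (simp add: poly_op_pCons cblinfun_compose_add scaleC_add_left)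
qed simp

lemma poly_op_smult: "poly_op (Polynomial.smult c p) T = c *\<^sub>C poly_op p T"
proof (induction p)
  case (pCons a p)
  then show ?case
    by (simp add: poly_op_pCons cblinfun_compose_scaleC scaleC_add_right scaleC_scaleC)
qed simp

lemma poly_op_mult: "poly_op (p * q) T = poly_op p T \<circ>\<^sub>L poly_op q T"
proof (induction p)
  case 0
  then show ?case by (intro cblinfun_eqI) (simp add: cblinfun_rep_simps)
next
  case (pCons a p)
  then show ?case
    by (simp add: poly_op_pCons poly_op_add poly_op_smult mult_pCons_left cblinfun_compose_add
        cblinfun_compose_scaleC cblinfun_compose_assoc)
qed

lemma poly_op_1: "poly_op 1 T = id_cblinfun"
  by (simp add: poly_op_def scaleC_one)

lemma poly_op_power: "poly_op (p ^ n) T = cblinfun_power (poly_op p T) n"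
  by (induction n) (simp_all add: poly_op_1 poly_op_mult)

lemma poly_op_monom: "poly_op (monom c n) T = c *\<^sub>C cblinfun_power T n"
  by (induction n)
    (simp_all add: poly_op_pCons monom_0 monom_Suc cblinfun_compose_scaleC,
     intro cblinfun_eqI, simp add: cblinfun_rep_simps cblinfun_linear_simps)

text \<open>Linear factors of p are peeled off one at a time; the last nonzero vector met on the way
  is an eigenvector.\<close>

lemma eigenvalue_of_annihilating_poly:
  assumes "p \<noteq> 0" "y \<noteq> 0" "poly_op p T y = 0"
  shows "\<exists>\<mu>. poly p \<mu> = 0 \<and> eigenvalue T \<mu>"
  using assms
proof (induction "degree p" arbitrary: p)
  case 0
  then obtain c where "p = [:c:]" using degree_eq_zeroE by metis
  then show ?case using 0
    by (simp add: poly_op_pCons cblinfun_rep_simps cblinfun_linear_simps)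
next
  case (Suc n)
  then have "\<not> constant (poly p)" using constant_degree[of p] by simp
  then obtain \<mu> where \<mu>: "poly p \<mu> = 0" using fundamental_theorem_of_algebra by blast
  then obtain q where q: "p = [:- \<mu>, 1:] * q" by (metis dvdE poly_eq_0_iff_dvd)
  then have q0: "q \<noteq> 0" using Suc.prems(1) by auto
  have "degree p = degree [:- \<mu>, 1:] + degree q"
    unfolding q using q0 by (intro degree_mult_eq) auto
  then have deg: "n = degree q" using Suc.hyps(2) by simp
  show ?case
  proof (cases "poly_op q T y = 0")
    case True
    then obtain \<nu> where "poly q \<nu> = 0" "eigenvalue T \<nu>"
      using Suc.hyps(1)[OF deg q0 Suc.prems(2)] by blast
    then show ?thesis using q by auto
  next
    case False
    have "poly_op [:- \<mu>, 1:] T = T - \<mu> *\<^sub>C id_cblinfun"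
      by (rule cblinfun_eqI) (simp add: poly_op_pCons cblinfun_rep_simps cblinfun_linear_simps scaleC_one)
    then have "T (poly_op q T y) = \<mu> *\<^sub>C poly_op q T y"
      using Suc.prems(3) unfolding q poly_op_mult by (simp add: cblinfun_rep_simps)
    then show ?thesis using False \<mu> unfolding Defs.eigenvalue_def by blast
  qed
qed


section \<open>Traces of powers\<close>

lemma op_trace_third_sums:
  assumes "nuclear_rep (1/3) x' (x :: nat \<Rightarrow> 'a::complex_banach) S"
  shows "(\<lambda>k. cblinfun_apply (x' k) (x k)) sums op_trace S"
  using op_trace_sums[OF _ _ approx_property_third assms] by simp

text \<open>All traces are evaluated on one fixed representation of R, where they are visibly linear
  in the left factor.\<close>

lemma op_trace_compose_linear:
  fixes R :: "'a::complex_banach \<Rightarrow>\<^sub>C\<^sub>L 'a"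
  assumes "s_nuclear (1/3) R"
  shows "op_trace ((A + B) \<circ>\<^sub>L R) = op_trace (A \<circ>\<^sub>L R) + op_trace (B \<circ>\<^sub>L R)"
    and "op_trace ((c *\<^sub>C A) \<circ>\<^sub>L R) = c * op_trace (A \<circ>\<^sub>L R)"
proof -
  obtain x' x where rep: "nuclear_rep (1/3) x' x R"
    using assms s_nuclear_iff[of "1/3" R] by auto
  note tr = op_trace_third_sums[OF nuclear_rep_compose_left[OF _ rep], simplified]
  show "op_trace ((A + B) \<circ>\<^sub>L R) = op_trace (A \<circ>\<^sub>L R) + op_trace (B \<circ>\<^sub>L R)"
    using sums_add[OF tr[of A] tr[of B]] tr[of "A + B"]
    by (simp add: cblinfun_rep_simps cblinfun_linear_simps sums_unique2)
  show "op_trace ((c *\<^sub>C A) \<circ>\<^sub>L R) = c * op_trace (A \<circ>\<^sub>L R)"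
    using sums_mult[OF tr[of A], of c] tr[of "c *\<^sub>C A"]
    by (simp add: cblinfun_rep_simps cblinfun_linear_simps scaleC_complex_def sums_unique2)
qed

lemma op_trace_poly_linear:
  fixes T :: "'a::complex_banach \<Rightarrow>\<^sub>C\<^sub>L 'a"
  assumes T: "s_nuclear (1/3) (cblinfun_power T L)" and "monom 1 L dvd p" "monom 1 L dvd q"
  shows "op_trace (poly_op (p + q) T) = op_trace (poly_op p T) + op_trace (poly_op q T)"
    and "op_trace (poly_op (Polynomial.smult c p) T) = c * op_trace (poly_op p T)"
proof -
  obtain p' q' where pq: "p = p' * monom 1 L" "q = q' * monom 1 L"
    using assms(2,3) by (metis dvdE mult.commute)
  have mono: "poly_op (h * monom 1 L) T = poly_op h T \<circ>\<^sub>L cblinfun_power T L" for h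
    by (simp add: poly_op_mult poly_op_monom scaleC_one)
  show "op_trace (poly_op (p + q) T) = op_trace (poly_op p T) + op_trace (poly_op q T)"
    unfolding pq distrib_right[symmetric] mono poly_op_add by (rule op_trace_compose_linear[OF T])
  show "op_trace (poly_op (Polynomial.smult c p) T) = c * op_trace (poly_op p T)"
    unfolding pq mult_smult_left[symmetric] mono poly_op_smult by (rule op_trace_compose_linear[OF T])
qed

lemma s_nuclear_poly_op:
  fixes T :: "'a::complex_banach \<Rightarrow>\<^sub>C\<^sub>L 'a"
  assumes "0 < s" "s \<le> 1" "s_nuclear s (cblinfun_power T L)" "monom 1 L dvd p"
  shows "s_nuclear s (poly_op p T)"
proof -
  obtain p' where p: "p = p' * monom 1 L" using assms(4) by (metis dvdE mult.commute)
  show ?thesis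
    unfolding p poly_op_mult poly_op_monom scaleC_one by (rule s_nuclear_compose(1)[OF assms(1-3)])
qed

text \<open>The hypothesis is the case of the monomials X^l with l \<ge> L, and both sides are
  linear on multiples of X^L. Such a polynomial is written X^l h, and h is built up coefficient by
  coefficient.\<close>

lemma op_trace_poly_diff:
  fixes T T' :: "'a::complex_banach \<Rightarrow>\<^sub>C\<^sub>L 'a"
  assumes T: "s_nuclear (1/3) (cblinfun_power T L)" and T': "s_nuclear (1/3) (cblinfun_power T' L)"
    and diff: "\<And>l. L \<le> l \<Longrightarrow> op_trace (cblinfun_power T' l) =
      op_trace (cblinfun_power T l) - (\<Sum>\<mu>\<in>\<Lambda>. of_nat (m \<mu>) * \<mu> ^ l)"
    and p: "monom 1 L dvd p"
  shows "op_trace (poly_op p T') = op_trace (poly_op p T) - (\<Sum>\<mu>\<in>\<Lambda>. of_nat (m \<mu>) * poly p \<mu>)"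
proof -
  define ok where "ok p \<longleftrightarrow> op_trace (poly_op p T') = op_trace (poly_op p T) - (\<Sum>\<mu>\<in>\<Lambda>. of_nat (m \<mu>) * poly p \<mu>)" for p
  have mono: "ok (monom 1 l)" if "L \<le> l" for l
    using diff[OF that] by (simp add: ok_def poly_op_monom scaleC_one poly_monom)
  have dvd: "monom 1 L dvd (monom 1 l * h :: complex poly)" if "L \<le> l" for l h
    using that monom_1_dvd_iff[of "monom (1::complex) l" L] by (intro dvd_mult2) (simp add: le_imp_power_dvd monom_altdef)
  have "ok (monom 1 l * h)" if "L \<le> l" for l h
    using that
  proof (induction h arbitrary: l)
    case 0
    have "op_trace (poly_op 0 T) = 0 * op_trace (poly_op (monom 1 L) T)"
      using op_trace_poly_linear(2)[OF T, of "monom 1 L" 0 0] by simp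
    moreover have "op_trace (poly_op 0 T') = 0 * op_trace (poly_op (monom 1 L) T')"
      using op_trace_poly_linear(2)[OF T', of "monom 1 L" 0 0] by simp
    ultimately show ?case by (simp add: ok_def)
  next
    case (pCons a h)
    have split: "monom 1 l * pCons a h = Polynomial.smult a (monom 1 l) + monom 1 (Suc l) * h"
      by (simp add: monom_Suc mult_pCons_right)
    have d1: "monom 1 L dvd (monom 1 l :: complex poly)" and d2: "monom 1 L dvd monom 1 (Suc l) * h"
      using dvd[of l 1] dvd[of "Suc l" h] pCons.prems by auto
    have d3: "monom 1 L dvd Polynomial.smult a (monom 1 l)" using d1 by (rule dvd_smult)
    have ok: "ok (monom 1 l)" "ok (monom 1 (Suc l) * h)"
      using mono pCons by auto
    have sums: "(\<Sum>\<mu>\<in>\<Lambda>. of_nat (m \<mu>) * poly (Polynomial.smult a (monom 1 l) + monom 1 (Suc l) * h) \<mu>)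
        = a * (\<Sum>\<mu>\<in>\<Lambda>. of_nat (m \<mu>) * poly (monom 1 l) \<mu>)
          + (\<Sum>\<mu>\<in>\<Lambda>. of_nat (m \<mu>) * poly (monom 1 (Suc l) * h) \<mu>)"
      by (simp add: distrib_left sum.distrib sum_distrib_left ac_simps)
    show ?case
      unfolding split ok_def op_trace_poly_linear(1)[OF T d3 d2] op_trace_poly_linear(1)[OF T' d3 d2]
        op_trace_poly_linear(2)[OF T d1 d1] op_trace_poly_linear(2)[OF T' d1 d1] sums
        ok[unfolded ok_def]
      by (simp add: right_diff_distrib)
  qed
  then show ?thesis
    using p by (auto simp: ok_def dvd_def)
qed

text \<open>The balanced representation is only 1-summable, so the sum of the x'_k (S^j x_k) is not
  a trace by definition; \<open>op_trace_compose_sums\<close> identifies it as one because S^j is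
  one-third nuclear.\<close>

lemma eigenvalue_family:
  fixes S :: "'a::complex_banach \<Rightarrow>\<^sub>C\<^sub>L 'a"
  assumes nuc: "nuclear S" and third: "s_nuclear (1/3) S"
  obtains \<mu> :: "nat \<Rightarrow> complex" where "\<And>i. \<mu> i \<noteq> 0 \<Longrightarrow> eigenvalue S (\<mu> i)"
    "\<And>j. 3 \<le> j \<Longrightarrow> ((\<lambda>i. \<mu> i ^ j) has_sum op_trace (cblinfun_power S j)) UNIV"
    "(\<lambda>i. cmod (\<mu> i ^ 3)) summable_on UNIV"
proof -
  obtain x' x where bal: "\<And>k. norm (x' k) = norm (x k)" "summable (\<lambda>k. (norm (x k))\<^sup>2)"
    and S: "(\<lambda>k. rank_one (x' k) (x k)) sums S"
    using nuclear_balanced_rep[OF nuc] by blast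
  interpret balanced_sequence x' x using bal by unfold_locales
  have rep: "nuclear_rep 1 x' x S"
    using bal S by (simp add: nuclear_rep_1_iff power2_eq_square)
  obtain \<mu> where ev: "\<And>i. \<mu> i \<noteq> 0 \<Longrightarrow> eigenvalue S (\<mu> i)"
    and sm: "\<And>j. 2 \<le> j \<Longrightarrow> summable (\<lambda>i. cmod (\<mu> i ^ Suc j))"
    and tr: "\<And>j. 2 \<le> j \<Longrightarrow> (\<Sum>i. \<mu> i ^ Suc j) = (\<Sum>k. x' k (cblinfun_power S j (x k)))"
    by (rule eigenvalue_sequence[OF S]) (rule that)
  have "((\<lambda>i. \<mu> i ^ Suc j) has_sum op_trace (cblinfun_power S (Suc j))) UNIV" if "2 \<le> j" for j
  proof -
    obtain i where j: "j = Suc i" using \<open>2 \<le> j\<close> by (cases j) auto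
    have "s_nuclear (1/3) (cblinfun_power S j)"
      unfolding j cblinfun_power_Suc2 by (rule s_nuclear_compose(1)[OF _ _ third]) auto
    then have "(\<lambda>k. x' k (cblinfun_power S j (x k))) sums op_trace (S \<circ>\<^sub>L cblinfun_power S j)"
      by (intro op_trace_compose_sums[OF _ _ approx_property_third rep]) auto
    then have "(\<Sum>i. \<mu> i ^ Suc j) = op_trace (cblinfun_power S (Suc j))"
      using tr[OF that] by (simp add: sums_iff)
    moreover have "(\<lambda>i. \<mu> i ^ Suc j) sums (\<Sum>i. \<mu> i ^ Suc j)"
      using summable_norm_cancel[OF sm[OF that]] by (rule summable_sums)
    ultimately show ?thesis
      using norm_summable_imp_has_sum[OF sm[OF that]] by metis
  qed
  note hs = this
  show ?thesis
  proof (rule that[of \<mu>])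
    show "((\<lambda>i. \<mu> i ^ j) has_sum op_trace (cblinfun_power S j)) UNIV" if "3 \<le> j" for j
      using hs[of "j - 1"] that by (cases j) auto
    show "(\<lambda>i. cmod (\<mu> i ^ 3)) summable_on UNIV"
      using sm[of 2] by (intro norm_summable_imp_summable_on) (simp add: numeral_3_eq_3)
  qed (rule ev)
qed

text \<open>n copies of \<kappa> are joined to \<nu> through a sum type; the enlarged family then
  has the power sums of \<mu>.\<close>

lemma power_sums_add_copies:
  fixes \<mu> \<nu> :: "nat \<Rightarrow> complex"
  assumes sm: "(\<lambda>i. cmod (\<mu> i ^ L)) summable_on UNIV" "(\<lambda>i. cmod (\<nu> i ^ L)) summable_on UNIV"
    and s: "\<And>l. L \<le> l \<Longrightarrow> ((\<lambda>i. \<mu> i ^ l) has_sum s l) UNIV"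
      "\<And>l. L \<le> l \<Longrightarrow> ((\<lambda>i. \<nu> i ^ l) has_sum (s l - of_nat n * \<kappa> ^ l)) UNIV"
    and \<kappa>: "\<kappa> \<noteq> 0"
  shows "finite {i. \<mu> i = \<kappa>}" "card {i. \<mu> i = \<kappa>} = n + card {i. \<nu> i = \<kappa>}"
proof -
  define J where "J = Inr ` {..<n} \<union> range (Inl :: nat \<Rightarrow> nat + nat)"
  define \<rho> where "\<rho> = case_sum \<nu> (\<lambda>_ :: nat. \<kappa>)"
  have hs: "(f has_sum a + b) J"
    if "((\<lambda>i. f (Inr i)) has_sum a) {..<n}" "((\<lambda>i. f (Inl i)) has_sum b) UNIV"
    for f :: "nat + nat \<Rightarrow> 'b::{banach}" and a b
    unfolding J_def using that
    by (intro has_sum_Un_disjoint) (auto simp: has_sum_reindex o_def)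
  have c: "((\<lambda>i :: nat. c) has_sum of_nat n * c) {..<n}" for c :: "'b::{real_normed_field,banach}"
    using has_sum_finite[of "{..<n}" "\<lambda>i. c"] by simp
  have 1: "((\<lambda>j. \<rho> j ^ l) has_sum s l) J" if "L \<le> l" for l
  proof -
    have "((\<lambda>j. \<rho> j ^ l) has_sum of_nat n * \<kappa> ^ l + (s l - of_nat n * \<kappa> ^ l)) J"
      using c[of "\<kappa> ^ l"] s(2)[OF that] by (intro hs) (simp_all add: \<rho>_def)
    then show ?thesis by simp
  qed
  have "((\<lambda>j. cmod (\<rho> j ^ L)) has_sum of_nat n * cmod (\<kappa> ^ L) + (\<Sum>\<^sub>\<infinity>i. cmod (\<nu> i ^ L))) J"
    using c[of "cmod (\<kappa> ^ L)"] has_sum_infsum[OF sm(2)] by (intro hs) (simp_all add: \<rho>_def)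
  then have 2: "(\<lambda>j. cmod (\<rho> j ^ L)) summable_on J"
    by (auto simp: summable_on_def)
  note u = power_sums_determine_multiplicities
  have fin: "finite {i. \<mu> i = \<kappa>}" using u(1)[OF sm(1) 2 s(1) 1 \<kappa>] by simp
  then show "finite {i. \<mu> i = \<kappa>}" .
  have "card {i. \<mu> i = \<kappa>} = card {j \<in> J. \<rho> j = \<kappa>}" using u(2)[OF sm(1) 2 s(1) 1 \<kappa>] by simp
  also have "{j \<in> J. \<rho> j = \<kappa>} = Inr ` {..<n} \<union> Inl ` {i. \<nu> i = \<kappa>}"
    by (auto simp: J_def \<rho>_def)
  also have "card \<dots> = n + card {i. \<nu> i = \<kappa>}"
  proof -
    have "{i. \<nu> i = \<kappa>} \<subseteq> Inl -` {j \<in> J. \<rho> j = \<kappa>}" by (auto simp: J_def \<rho>_def)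
    moreover have "finite {j \<in> J. \<rho> j = \<kappa>}" using u(1)[OF 2 sm(1) 1 s(1) \<kappa>] by simp
    ultimately have "finite {i. \<nu> i = \<kappa>}"
      using finite_subset finite_vimageI[of _ Inl] by (metis inj_Inl)
    then show ?thesis by (subst card_Un_disjoint) (auto simp: card_image)
  qed
  finally show "card {i. \<mu> i = \<kappa>} = n + card {i. \<nu> i = \<kappa>}" .
qed


section \<open>Deflation\<close>

text \<open>A finite basis is part of the notion, since \<open>complex_vector.dim\<close> is 0 on
  infinite-dimensional spaces as well.\<close>

definition has_finite_dim :: "'a::complex_vector set \<Rightarrow> nat \<Rightarrow> bool"
  where "has_finite_dim W d \<longleftrightarrow>
    (\<exists>B. finite B \<and> complex_vector.independent B \<and> complex_vector.span B = W \<and> card B = d)"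

lemma dim_eq_of_has_finite_dim: "has_finite_dim W d \<Longrightarrow> complex_vector.dim W = d"
  using complex_vector.dim_span_eq_card_independent by (auto simp: has_finite_dim_def)

lemma has_finite_dim_singleton_0: "has_finite_dim {0} 0"
  unfolding has_finite_dim_def by (rule exI[of _ "{}"]) (simp add: complex_vector.independent_empty)

text \<open>Rank-nullity in the direction that yields finiteness of W: lifts of a basis of the image
  together with a basis of the kernel.\<close>

lemma has_finite_dim_lift:
  fixes f :: "'a::complex_vector \<Rightarrow> 'b::complex_vector"
  assumes add: "\<And>v w. f (v + w) = f v + f w" and scale: "\<And>c v. f (c *\<^sub>C v) = c *\<^sub>C f v"
    and W: "complex_vector.subspace W" and img: "f ` W = W'" and d: "has_finite_dim W' d"
    and K: "finite K" "complex_vector.independent K" "K \<subseteq> W"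
    and ker: "\<And>w. w \<in> W \<Longrightarrow> f w = 0 \<longleftrightarrow> w \<in> complex_vector.span K"
  shows "has_finite_dim W (card K + d)"
proof -
  obtain B where B: "finite B" "complex_vector.independent B" "complex_vector.span B = W'" "card B = d"
    using d by (auto simp: has_finite_dim_def)
  have "\<forall>b\<in>B. \<exists>w\<in>W. f w = b"
    using B(3) img complex_vector.span_base by (metis imageE)
  then obtain g where g: "\<And>b. b \<in> B \<Longrightarrow> g b \<in> W" "\<And>b. b \<in> B \<Longrightarrow> f (g b) = b" by metis
  have f0: "f 0 = 0" using scale[of 0 0] by simp
  have fK: "f k = 0" if "k \<in> K" for k
    using ker[of k] K(3) that complex_vector.span_base by blast
  have fspan: "f w \<in> complex_vector.span C" if "w \<in> complex_vector.span (K \<union> g ` C)" "C \<subseteq> B" for w C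
    using that(1)
  proof (induction rule: complex_vector.span_induct_alt)
    case base
    then show ?case by (simp add: f0 complex_vector.span_zero)
  next
    case (step c v w)
    have "f v \<in> complex_vector.span C"
    proof (cases "v \<in> K")
      case True
      then show ?thesis using fK by (simp add: complex_vector.span_zero)
    next
      case False
      then obtain b where "b \<in> C" "v = g b" using step(1) by auto
      moreover from this have "f (g b) = b" using g(2) that(2) by blast
      ultimately show ?thesis by (simp add: complex_vector.span_base)
    qed
    then show ?case using step(2) by (simp add: add scale complex_vector.span_add complex_vector.span_scale)
  qed
  have "complex_vector.independent (K \<union> g ` C)" if "finite C" "C \<subseteq> B" for C
    using that
  proof (induction C rule: finite_induct)
    case (insert b C)
    have "b \<notin> complex_vector.span (B - {b})"
      using B(2) insert.prems by (auto simp: complex_vector.dependent_def)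
    then have "b \<notin> complex_vector.span C"
      using complex_vector.span_mono[of C "B - {b}"] insert by blast
    then have "g b \<notin> complex_vector.span (K \<union> g ` C)"
      using fspan[of "g b" C] insert.prems g(2)[of b] by auto
    then show ?case
      using insert by (simp add: complex_vector.independent_insert complex_vector.span_base)
  qed (use K in simp)
  then have ind: "complex_vector.independent (K \<union> g ` B)" using B(1) by blast
  have "complex_vector.span (K \<union> g ` B) \<subseteq> W"
    using W K(3) g(1) by (intro complex_vector.span_minimal) auto
  moreover have "w \<in> complex_vector.span (K \<union> g ` B)" if w: "w \<in> W" for w
  proof -
    have "f w \<in> complex_vector.span B" using img w B(3) by blast
    then obtain c where c: "f w = (\<Sum>b\<in>B. c b *\<^sub>C b)"
      using complex_vector.span_finite[OF B(1)] by auto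
    define v where "v = (\<Sum>b\<in>B. c b *\<^sub>C g b)"
    have "f (\<Sum>b\<in>C. c b *\<^sub>C g b) = (\<Sum>b\<in>C. c b *\<^sub>C f (g b))" for C
      by (induction C rule: infinite_finite_induct) (auto simp: f0 add scale)
    then have "f v = f w" using g(2) by (simp add: v_def c)
    moreover have fdiff: "f (w - v) = f w - f v"
      using add[of "w - v" v] by simp
    moreover have vW: "v \<in> W"
      unfolding v_def using W g(1) by (intro complex_vector.subspace_sum complex_vector.subspace_scale) auto
    moreover have "w - v \<in> W" using W w vW by (intro complex_vector.subspace_diff)
    ultimately have "w - v \<in> complex_vector.span K" using ker by simp
    then have 1: "w - v \<in> complex_vector.span (K \<union> g ` B)"
      using complex_vector.span_mono[of K "K \<union> g ` B"] by blast
    have 2: "v \<in> complex_vector.span (K \<union> g ` B)"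
      unfolding v_def by (intro complex_vector.span_sum complex_vector.span_scale complex_vector.span_base) auto
    show ?thesis using complex_vector.span_add[OF 1 2] by simp
  qed
  ultimately have span: "complex_vector.span (K \<union> g ` B) = W" by blast
  have "inj_on g B" using g(2) by (metis inj_onI)
  moreover have "K \<inter> g ` B = {}"
  proof (rule ccontr)
    assume "K \<inter> g ` B \<noteq> {}"
    then obtain b where b: "b \<in> B" "g b \<in> K" by blast
    then have "b = 0" using fK g(2) by fastforce
    then show False using b B(2) complex_vector.dependent_zero by blast
  qed
  ultimately have "card (K \<union> g ` B) = card K + d"
    using K B by (simp add: card_Un_disjoint card_image)
  then show ?thesis
    using ind span K B unfolding has_finite_dim_def by (intro exI[of _ "K \<union> g ` B"]) simp
qed

section \<open>Generalised eigenspaces\<close>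

definition gen_eigenspace :: "('a::complex_normed_vector \<Rightarrow>\<^sub>C\<^sub>L 'a) \<Rightarrow> complex \<Rightarrow> 'a set"
  where "gen_eigenspace T \<mu> = (\<Union>n. {x. cblinfun_power (T - \<mu> *\<^sub>C id_cblinfun) n x = 0})"

lemma alg_multiplicity_eq: "alg_multiplicity T \<mu> = complex_vector.dim (gen_eigenspace T \<mu>)"
  by (simp add: alg_multiplicity_def gen_eigenspace_def)

lemma gen_eigenspaceI:
  "cblinfun_power (T - \<mu> *\<^sub>C id_cblinfun) n x = 0 \<Longrightarrow> x \<in> gen_eigenspace T \<mu>"
  by (auto simp: gen_eigenspace_def)

lemma cblinfun_power_eq_0_mono:
  assumes "cblinfun_power A n x = 0" "n \<le> m"
  shows "cblinfun_power A m x = 0"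
  using cblinfun_power_add[of A "m - n" n] assms by (simp add: cblinfun_rep_simps cblinfun_linear_simps)

lemma subspace_gen_eigenspace: "complex_vector.subspace (gen_eigenspace T \<mu>)"
proof (rule complex_vector.subspaceI)
  show "0 \<in> gen_eigenspace T \<mu>" by (rule gen_eigenspaceI[of _ _ 0]) (simp add: id_cblinfun.rep_eq)
  fix x y and c :: complex
  assume "x \<in> gen_eigenspace T \<mu>"
  then obtain m where m: "cblinfun_power (T - \<mu> *\<^sub>C id_cblinfun) m x = 0"
    by (auto simp: gen_eigenspace_def)
  then show "c *\<^sub>C x \<in> gen_eigenspace T \<mu>"
    by (intro gen_eigenspaceI[of _ _ m]) (simp add: cblinfun_linear_simps)
  assume "y \<in> gen_eigenspace T \<mu>"
  then obtain n where n: "cblinfun_power (T - \<mu> *\<^sub>C id_cblinfun) n y = 0"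
    by (auto simp: gen_eigenspace_def)
  show "x + y \<in> gen_eigenspace T \<mu>"
    using cblinfun_power_eq_0_mono[OF m, of "m + n"] cblinfun_power_eq_0_mono[OF n, of "m + n"]
    by (intro gen_eigenspaceI[of _ _ "m + n"]) (simp add: cblinfun_linear_simps)
qed

lemma eigenvalue_iff_gen_eigenspace: "eigenvalue T \<mu> \<longleftrightarrow> (\<exists>x\<in>gen_eigenspace T \<mu>. x \<noteq> 0)"
proof
  assume "eigenvalue T \<mu>"
  then obtain x where "x \<noteq> 0" "T x = \<mu> *\<^sub>C x" by (auto simp: Defs.eigenvalue_def)
  then show "\<exists>x\<in>gen_eigenspace T \<mu>. x \<noteq> 0"
    by (intro bexI[of _ x] gen_eigenspaceI[of _ _ 1]) (auto simp: cblinfun_rep_simps)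
next
  assume "\<exists>x\<in>gen_eigenspace T \<mu>. x \<noteq> 0"
  then obtain x n where x: "x \<noteq> 0" "cblinfun_power (T - \<mu> *\<^sub>C id_cblinfun) n x = 0"
    by (auto simp: gen_eigenspace_def)
  from x(2) show "eigenvalue T \<mu>"
  proof (induction n)
    case 0
    then show ?case using x(1) by (simp add: id_cblinfun.rep_eq)
  next
    case (Suc n)
    show ?case
    proof (cases "cblinfun_power (T - \<mu> *\<^sub>C id_cblinfun) n x = 0")
      case False
      with Suc.prems show ?thesis
        unfolding Defs.eigenvalue_def
        by (intro exI[of _ "cblinfun_power (T - \<mu> *\<^sub>C id_cblinfun) n x"]) (simp add: cblinfun_rep_simps)
    qed (use Suc.IH in simp)
  qed
qed

lemma gen_eigenspace_not_eigenvalue: "\<not> eigenvalue T \<mu> \<Longrightarrow> gen_eigenspace T \<mu> = {0}"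
  using eigenvalue_iff_gen_eigenspace[of T \<mu>] complex_vector.subspace_0[OF subspace_gen_eigenspace] by blast

lemma eigenvalue_iff_alg_multiplicity:
  assumes "has_finite_dim (gen_eigenspace T \<mu>) d"
  shows "eigenvalue T \<mu> \<longleftrightarrow> 0 < alg_multiplicity T \<mu>"
proof
  assume "eigenvalue T \<mu>"
  then have "gen_eigenspace T \<mu> \<noteq> {0}" by (auto simp: eigenvalue_iff_gen_eigenspace)
  moreover obtain B where B: "finite B" "complex_vector.span B = gen_eigenspace T \<mu>" "card B = d"
    using assms unfolding has_finite_dim_def by blast
  ultimately have "B \<noteq> {}" using complex_vector.span_empty by metis
  then have "0 < d" using B(1,3) card_gt_0_iff by metis
  then show "0 < alg_multiplicity T \<mu>"
    using dim_eq_of_has_finite_dim[OF assms] by (simp add: alg_multiplicity_eq)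
next
  assume pos: "0 < alg_multiplicity T \<mu>"
  show "eigenvalue T \<mu>"
  proof (rule ccontr)
    assume "\<not> eigenvalue T \<mu>"
    then have "alg_multiplicity T \<mu> = 0"
      unfolding alg_multiplicity_eq gen_eigenspace_not_eigenvalue[OF \<open>\<not> eigenvalue T \<mu>\<close>]
      by (simp add: dim_eq_of_has_finite_dim[OF has_finite_dim_singleton_0])
    then show False using pos by simp
  qed
qed

section \<open>Splitting off one eigenvector\<close>

locale eigen_deflation =
  fixes T :: "'a::complex_banach \<Rightarrow>\<^sub>C\<^sub>L 'a" and \<alpha> :: complex and y :: 'a and \<phi> :: "'a dual"
  assumes eigen: "T y = \<alpha> *\<^sub>C y" and \<phi>y: "\<phi> y = 1"
begin

definition q :: "'a \<Rightarrow>\<^sub>C\<^sub>L 'a"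
  where "q = id_cblinfun - rank_one \<phi> y"

text \<open>The operator induced by T on the quotient by the line of y, the quotient being realised
  as the kernel of \<phi> inside the same space, so that deflation can be iterated. On y it is zero,
  which affects only the eigenvalue 0.\<close>

definition T' :: "'a \<Rightarrow>\<^sub>C\<^sub>L 'a"
  where "T' = q \<circ>\<^sub>L T"

lemma q_apply: "q z = z - \<phi> z *\<^sub>C y"
  by (simp add: q_def cblinfun_rep_simps)

lemma q_y: "q y = 0" and \<phi>_q: "\<phi> (q z) = 0"
  by (simp_all add: q_apply \<phi>y scaleC_one cblinfun_linear_simps scaleC_complex_def)

lemma T'_q: "T' (q z) = q (T z)"
proof -
  have "T (q z) = T z - (\<phi> z * \<alpha>) *\<^sub>C y"
    by (simp add: q_apply cblinfun_linear_simps eigen scaleC_scaleC)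
  then show ?thesis
    by (simp add: T'_def cblinfun_compose.rep_eq cblinfun_linear_simps q_y)
qed

lemma \<phi>_T': "\<phi> (T' z) = 0"
  by (simp add: T'_def cblinfun_compose.rep_eq \<phi>_q)

lemma power_T'_q:
  "cblinfun_power (T' - \<mu> *\<^sub>C id_cblinfun) n (q z) = q (cblinfun_power (T - \<mu> *\<^sub>C id_cblinfun) n z)"
proof (induction n)
  case (Suc n)
  then show ?case
    by (simp add: cblinfun_rep_simps T'_q cblinfun_linear_simps)
qed (simp add: id_cblinfun.rep_eq)

lemma \<phi>_power: "\<phi> (cblinfun_power (T' - \<mu> *\<^sub>C id_cblinfun) n z) = (- \<mu>) ^ n * \<phi> z"
  by (induction n) (simp_all add: cblinfun_rep_simps cblinfun_linear_simps \<phi>_T' scaleC_complex_def)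

lemma power_y: "cblinfun_power (T - \<mu> *\<^sub>C id_cblinfun) n y = (\<alpha> - \<mu>) ^ n *\<^sub>C y"
  by (induction n)
    (simp_all add: cblinfun_rep_simps cblinfun_linear_simps eigen scaleC_one scaleC_scaleC
      complex_vector.scale_left_diff_distrib algebra_simps)

lemma power_y_0: "cblinfun_power T n y = \<alpha> ^ n *\<^sub>C y"
  using power_y[of 0 n] by simp

lemma power_T': "0 < n \<Longrightarrow> cblinfun_power T' n = q \<circ>\<^sub>L cblinfun_power T n"
proof (induction n)
  case (Suc n)
  show ?case
  proof (cases "n = 0")
    case True
    then show ?thesis by (simp add: T'_def)
  next
    case False
    then have "cblinfun_power T' (Suc n) = T' \<circ>\<^sub>L (q \<circ>\<^sub>L cblinfun_power T n)" using Suc by simp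
    also have "\<dots> = q \<circ>\<^sub>L cblinfun_power T (Suc n)"
      by (rule cblinfun_eqI) (simp add: cblinfun_compose.rep_eq T'_q)
    finally show ?thesis .
  qed
qed simp

text \<open>For \<mu> \<noteq> 0, generalised eigenvectors x of T' lie in the kernel of \<phi>,
  where q is the identity. Some (T - \<mu>)^n sends x into the line of y; this remainder is killed
  by one more factor if \<mu> = \<alpha>, and by shifting x along y otherwise.\<close>

lemma image_gen_eigenspace:
  assumes "\<mu> \<noteq> 0"
  shows "q ` gen_eigenspace T \<mu> = gen_eigenspace T' \<mu>"
proof (intro equalityI subsetI)
  fix x assume "x \<in> q ` gen_eigenspace T \<mu>"
  then obtain z n where z: "x = q z" "cblinfun_power (T - \<mu> *\<^sub>C id_cblinfun) n z = 0"
    by (auto simp: gen_eigenspace_def)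
  then show "x \<in> gen_eigenspace T' \<mu>"
    by (intro gen_eigenspaceI[of _ _ n]) (simp add: power_T'_q cblinfun_linear_simps)
next
  fix x assume "x \<in> gen_eigenspace T' \<mu>"
  then obtain n where n: "cblinfun_power (T' - \<mu> *\<^sub>C id_cblinfun) n x = 0"
    by (auto simp: gen_eigenspace_def)
  then have "\<phi> x = 0" using \<phi>_power[of \<mu> n x] assms by (simp add: cblinfun_linear_simps)
  then have qx: "q x = x" by (simp add: q_apply)
  define w where "w = cblinfun_power (T - \<mu> *\<^sub>C id_cblinfun) n x"
  have "q w = 0" using power_T'_q[of \<mu> n x] n qx by (simp add: w_def)
  then have w: "w = \<phi> w *\<^sub>C y" by (simp add: q_apply)
  show "x \<in> q ` gen_eigenspace T \<mu>"
  proof (cases "\<mu> = \<alpha>")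
    case True
    have "(T - \<mu> *\<^sub>C id_cblinfun) w = 0"
      by (subst w) (simp add: cblinfun_rep_simps cblinfun_linear_simps eigen True)
    then have "x \<in> gen_eigenspace T \<mu>"
      by (intro gen_eigenspaceI[of _ _ "Suc n"]) (simp add: cblinfun_power_Suc_apply(1) w_def del: cblinfun_power.simps)
    then show ?thesis using qx by force
  next
    case False
    define c where "c = \<phi> w / (\<alpha> - \<mu>) ^ n"
    have "cblinfun_power (T - \<mu> *\<^sub>C id_cblinfun) n (x - c *\<^sub>C y) = w - (c * (\<alpha> - \<mu>) ^ n) *\<^sub>C y"
      by (simp add: cblinfun_linear_simps power_y w_def scaleC_scaleC)
    also have "c * (\<alpha> - \<mu>) ^ n = \<phi> w" using False by (simp add: c_def)
    finally have "x - c *\<^sub>C y \<in> gen_eigenspace T \<mu>"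
      by (intro gen_eigenspaceI[of _ _ n]) (simp flip: w)
    moreover have "q (x - c *\<^sub>C y) = x" by (simp add: cblinfun_linear_simps q_y qx)
    ultimately show ?thesis by force
  qed
qed

text \<open>On the generalised eigenspace of T the kernel of q is the line of y for \<mu> = \<alpha>
  and trivial otherwise, so deflation lowers the dimension at \<alpha> only, by one.\<close>

lemma has_finite_dim_gen_eigenspace:
  assumes "\<mu> \<noteq> 0" "has_finite_dim (gen_eigenspace T' \<mu>) d"
  shows "has_finite_dim (gen_eigenspace T \<mu>) ((if \<mu> = \<alpha> then 1 else 0) + d)"
proof -
  have y0: "y \<noteq> 0" using \<phi>y by (auto simp: cblinfun_linear_simps)
  define K where "K = (if \<mu> = \<alpha> then {y} else {})"
  have "has_finite_dim (gen_eigenspace T \<mu>) (card K + d)"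
  proof (rule has_finite_dim_lift[where f = "cblinfun_apply q", OF _ _ subspace_gen_eigenspace
        image_gen_eigenspace[OF assms(1)] assms(2)])
    show "q (v + w) = q v + q w" "q (c *\<^sub>C v) = c *\<^sub>C q v" for v w c
      by (simp_all add: cblinfun_linear_simps)
    show "finite K" by (simp add: K_def)
    show "complex_vector.independent K"
      using y0 by (simp add: K_def complex_vector.dependent_single complex_vector.independent_empty)
    show "K \<subseteq> gen_eigenspace T \<mu>"
      using power_y[of \<alpha> 1] by (auto simp: K_def intro!: gen_eigenspaceI[of _ _ 1])
    fix w assume "w \<in> gen_eigenspace T \<mu>"
    then obtain n where n: "cblinfun_power (T - \<mu> *\<^sub>C id_cblinfun) n w = 0"
      by (auto simp: gen_eigenspace_def)
    show "q w = 0 \<longleftrightarrow> w \<in> complex_vector.span K"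
    proof
      assume "q w = 0"
      then have w: "w = \<phi> w *\<^sub>C y" by (simp add: q_apply)
      show "w \<in> complex_vector.span K"
      proof (cases "\<mu> = \<alpha>")
        case True
        then have "y \<in> complex_vector.span K" by (simp add: K_def complex_vector.span_base)
        then show ?thesis by (subst w) (rule complex_vector.span_scale)
      next
        case False
        have "(\<phi> w * (\<alpha> - \<mu>) ^ n) *\<^sub>C y = 0"
          using n by (subst (asm) w) (simp add: cblinfun_linear_simps power_y scaleC_scaleC)
        then have "\<phi> w = 0" using False y0 by simp
        then show ?thesis using w by (simp add: complex_vector.span_zero)
      qed
    next
      assume "w \<in> complex_vector.span K"
      then show "q w = 0"
      proof (induction rule: complex_vector.span_induct_alt)
        case (step c z w)
        then show ?case by (auto simp: K_def cblinfun_linear_simps q_y split: if_splits)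
      qed (simp add: cblinfun_linear_simps)
    qed
  qed
  then show ?thesis by (simp add: K_def split: if_splits)
qed

lemma eigenvalue_T':
  assumes "\<mu> \<noteq> 0" "eigenvalue T' \<mu>"
  shows "eigenvalue T \<mu>"
proof -
  obtain x where "x \<in> gen_eigenspace T \<mu>" "q x \<noteq> 0"
    using assms(2) unfolding eigenvalue_iff_gen_eigenspace image_gen_eigenspace[OF assms(1), symmetric] by blast
  moreover from this have "x \<noteq> 0" by (auto simp: cblinfun_linear_simps)
  ultimately show ?thesis unfolding eigenvalue_iff_gen_eigenspace by blast
qed

text \<open>The trace of q T^n is that of T^n minus \<phi> (T^n y), and y is an eigenvector.\<close>

lemma op_trace_T':
  assumes "0 < n" "s_nuclear (1/3) (cblinfun_power T n)"
  shows "op_trace (cblinfun_power T' n) = op_trace (cblinfun_power T n) - \<alpha> ^ n"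
proof -
  obtain x' x where rep: "nuclear_rep (1/3) x' x (cblinfun_power T n)"
    using assms(2) s_nuclear_iff[of "1/3" "cblinfun_power T n"] by auto
  have "(\<lambda>k. x' k (q (x k))) sums op_trace (q \<circ>\<^sub>L cblinfun_power T n)"
    by (rule op_trace_third_sums[OF nuclear_rep_compose_left[OF _ rep]]) simp
  moreover have "(\<lambda>k. x' k (x k) - \<phi> (x' k y *\<^sub>C x k)) sums (op_trace (cblinfun_power T n) - \<phi> (cblinfun_power T n y))"
    by (intro sums_diff op_trace_third_sums[OF rep] cblinfun_apply_sums nuclear_rep_apply[OF rep])
  ultimately show ?thesis
    unfolding power_T'[OF assms(1)]
    by (simp add: q_apply cblinfun_linear_simps scaleC_complex_def power_y_0 \<phi>y mult.commute sums_unique2)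
qed

end

section \<open>Removing eigenvalues with their full multiplicity\<close>

lemma eigenvector_power: "cblinfun_apply T y = \<alpha> *\<^sub>C y \<Longrightarrow> cblinfun_power T n y = \<alpha> ^ n *\<^sub>C y"
  by (induction n) (simp_all add: cblinfun_rep_simps cblinfun_linear_simps scaleC_one scaleC_scaleC mult.commute)

text \<open>The functional is found among those of a nuclear representation of T^M: if all of them
  vanished on y, so would T^M y = \<alpha>^M y.\<close>

lemma eigen_deflation_exists:
  fixes T :: "'a::complex_banach \<Rightarrow>\<^sub>C\<^sub>L 'a"
  assumes nuc: "nuclear (cblinfun_power T M)" and "\<alpha> \<noteq> 0" and ev: "eigenvalue T \<alpha>"
  shows "\<exists>y \<phi>. eigen_deflation T \<alpha> y \<phi>"
proof -
  obtain y where y: "y \<noteq> 0" "T y = \<alpha> *\<^sub>C y" using ev by (auto simp: Defs.eigenvalue_def)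
  obtain x' x where rep: "nuclear_rep 1 x' x (cblinfun_power T M)"
    using nuc s_nuclear_iff[of 1 "cblinfun_power T M"] by auto
  have "\<exists>k. x' k y \<noteq> 0"
  proof (rule ccontr)
    assume "\<nexists>k. x' k y \<noteq> 0"
    then have "(\<lambda>k. 0) sums cblinfun_power T M y"
      using nuclear_rep_apply[OF rep, of y] by simp
    then have "\<alpha> ^ M *\<^sub>C y = 0"
      using eigenvector_power[OF y(2), of M] sums_unique2 sums_zero by metis
    then show False using y \<open>\<alpha> \<noteq> 0\<close> by simp
  qed
  then obtain k where k: "x' k y \<noteq> 0" by blast
  have "eigen_deflation T \<alpha> y (inverse (x' k y) *\<^sub>C x' k)"
    using y(2) k by (simp add: eigen_deflation_def cblinfun_rep_simps scaleC_complex_def)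
  then show ?thesis by blast
qed

text \<open>From the exponent \<open>10 * M\<close> on, the powers of \<open>T\<close> are one-third nuclear.\<close>

definition deflates ::
  "nat \<Rightarrow> ('a::complex_banach \<Rightarrow>\<^sub>C\<^sub>L 'a) \<Rightarrow> complex set \<Rightarrow> ('a \<Rightarrow>\<^sub>C\<^sub>L 'a) \<Rightarrow> bool"
  where "deflates M T \<Lambda> T' \<longleftrightarrow>
    nuclear (cblinfun_power T' M) \<and>
    (\<forall>\<mu>\<in>\<Lambda>. \<not> eigenvalue T' \<mu>) \<and>
    (\<forall>\<mu>. \<mu> \<noteq> 0 \<longrightarrow> eigenvalue T' \<mu> \<longrightarrow> eigenvalue T \<mu>) \<and>
    (\<forall>\<mu>\<in>\<Lambda>. \<exists>d. has_finite_dim (gen_eigenspace T \<mu>) d) \<and>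
    (\<forall>\<mu> d. \<mu> \<noteq> 0 \<longrightarrow> \<mu> \<notin> \<Lambda> \<longrightarrow> has_finite_dim (gen_eigenspace T' \<mu>) d \<longrightarrow> has_finite_dim (gen_eigenspace T \<mu>) d) \<and>
    (\<forall>l\<ge>10 * M. op_trace (cblinfun_power T' l) =
      op_trace (cblinfun_power T l) - (\<Sum>\<mu>\<in>\<Lambda>. of_nat (alg_multiplicity T \<mu>) * \<mu> ^ l))"

lemma nuclear_power_large:
  fixes T :: "'a::complex_banach \<Rightarrow>\<^sub>C\<^sub>L 'a"
  assumes "nuclear (cblinfun_power T M)" "10 * M \<le> l"
  shows "nuclear (cblinfun_power T l)" "s_nuclear (1/3) (cblinfun_power T l)"
proof -
  show "nuclear (cblinfun_power T l)"
    using assms by (intro s_nuclear_power_mono[of 1 T M l]) auto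
  show "s_nuclear (1/3) (cblinfun_power T l)"
    using nuclear_power_third_nuclear[OF assms(1)] assms(2)
    by (intro s_nuclear_power_mono[of "1/3" T "M * 10" l]) (auto simp: cblinfun_power_mult)
qed

lemma eigenvalue_family_power:
  fixes T :: "'a::complex_banach \<Rightarrow>\<^sub>C\<^sub>L 'a"
  assumes "nuclear (cblinfun_power T M)" "monom 1 (10 * M) dvd f"
  obtains \<mu> :: "nat \<Rightarrow> complex" where "\<And>i. \<mu> i \<noteq> 0 \<Longrightarrow> eigenvalue (poly_op f T) (\<mu> i)"
    "\<And>j. 3 \<le> j \<Longrightarrow> ((\<lambda>i. \<mu> i ^ j) has_sum op_trace (poly_op (f ^ j) T)) UNIV"
    "(\<lambda>i. cmod (\<mu> i ^ 3)) summable_on UNIV"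
  unfolding poly_op_power
  by (rule eigenvalue_family[of "poly_op f T"])
    (use assms nuclear_power_large[OF assms(1) order_refl] in \<open>auto intro: s_nuclear_poly_op that\<close>)

text \<open>Induction on how often \<alpha>^(10 M) occurs in an eigenvalue sequence of T^(10 M). A
  deflation lowers the trace of T^l by \<alpha>^l, hence this count by one, so deflations must stop.
  Finiteness of the multiplicity of \<alpha> comes out on the way.\<close>

lemma remove_eigenvalue:
  fixes T :: "'a::complex_banach \<Rightarrow>\<^sub>C\<^sub>L 'a"
  assumes M: "1 \<le> M" and \<alpha>: "\<alpha> \<noteq> 0" and nuc: "nuclear (cblinfun_power T M)"
  shows "\<exists>T'. deflates M T {\<alpha>} T'"
proof -
  define f where "f = monom (1::complex) (10 * M)"
  define \<kappa> where "\<kappa> = \<alpha> ^ (10 * M)"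
  have \<kappa>: "\<kappa> \<noteq> 0" using \<alpha> by (simp add: \<kappa>_def)
  have fpow: "poly_op (f ^ j) T = cblinfun_power T (10 * M * j)" for j and T :: "'a \<Rightarrow>\<^sub>C\<^sub>L 'a"
    by (simp add: f_def poly_op_monom scaleC_one monom_power)
  \<comment> \<open>Generalised over the operator and its sequence, since each deflation replaces
    both.\<close>
  have step: "\<exists>T'. deflates M T {\<alpha>} T'"
    if "nuclear (cblinfun_power T M)" "\<And>j. 3 \<le> j \<Longrightarrow> ((\<lambda>i. \<mu> i ^ j) has_sum op_trace (poly_op (f ^ j) T)) UNIV"
      "(\<lambda>i. cmod (\<mu> i ^ 3)) summable_on UNIV" "card {i. \<mu> i = \<kappa>} = n"
    for T :: "'a \<Rightarrow>\<^sub>C\<^sub>L 'a" and \<mu> :: "nat \<Rightarrow> complex" and n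
    using that
  proof (induction n arbitrary: T \<mu> rule: less_induct)
    case (less n)
    note nucT = less.prems(1)
    show ?case
    proof (cases "eigenvalue T \<alpha>")
      case False
      then have 0: "gen_eigenspace T \<alpha> = {0}" by (rule gen_eigenspace_not_eigenvalue)
      then have "alg_multiplicity T \<alpha> = 0"
        using dim_eq_of_has_finite_dim[OF has_finite_dim_singleton_0] by (simp add: alg_multiplicity_eq)
      then have "deflates M T {\<alpha>} T"
        using nucT False 0 has_finite_dim_singleton_0 by (auto simp: deflates_def)
      then show ?thesis by blast
    next
      case True
      obtain y \<phi> where "eigen_deflation T \<alpha> y \<phi>"
        using eigen_deflation_exists[OF nucT \<alpha> True] by blast
      then interpret D: eigen_deflation T \<alpha> y \<phi> .
      have M0: "0 < M" using M by simp
      have nuc': "nuclear (cblinfun_power D.T' M)"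
        unfolding D.power_T'[OF M0] using nucT by (intro s_nuclear_compose(1)) auto
      have tr: "op_trace (cblinfun_power D.T' l) = op_trace (cblinfun_power T l) - \<alpha> ^ l" if "10 * M \<le> l" for l
        using that M by (intro D.op_trace_T' nuclear_power_large(2)[OF nucT]) auto
      obtain \<nu> :: "nat \<Rightarrow> complex" where
        \<nu>: "\<And>j. 3 \<le> j \<Longrightarrow> ((\<lambda>i. \<nu> i ^ j) has_sum op_trace (poly_op (f ^ j) D.T')) UNIV"
        "(\<lambda>i. cmod (\<nu> i ^ 3)) summable_on UNIV"
        using eigenvalue_family_power[OF nuc', of f] by (metis f_def dvd_refl)
      have "((\<lambda>i. \<nu> i ^ j) has_sum (op_trace (poly_op (f ^ j) T) - of_nat 1 * \<kappa> ^ j)) UNIV" if "3 \<le> j" for j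
      proof -
        have "10 * M \<le> 10 * M * j" using that by simp
        then show ?thesis using \<nu>(1)[OF that] tr by (simp add: fpow \<kappa>_def power_mult[symmetric])
      qed
      then have "n = 1 + card {i. \<nu> i = \<kappa>}"
        using power_sums_add_copies(2)[OF less.prems(3) \<nu>(2) less.prems(2) _ \<kappa>] less.prems(4) by blast
      then obtain T'' where T'': "deflates M D.T' {\<alpha>} T''"
        using less.IH[OF _ nuc' \<nu> refl] by auto
      then obtain d where d: "has_finite_dim (gen_eigenspace D.T' \<alpha>) d" by (auto simp: deflates_def)
      have d': "has_finite_dim (gen_eigenspace T \<alpha>) (1 + d)"
        using D.has_finite_dim_gen_eigenspace[OF \<alpha> d] by simp
      have mult: "alg_multiplicity T \<alpha> = 1 + alg_multiplicity D.T' \<alpha>"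
        using dim_eq_of_has_finite_dim[OF d] dim_eq_of_has_finite_dim[OF d'] by (simp add: alg_multiplicity_eq)
      have "has_finite_dim (gen_eigenspace T \<mu>) e"
        if "\<mu> \<noteq> 0" "\<mu> \<noteq> \<alpha>" "has_finite_dim (gen_eigenspace T'' \<mu>) e" for \<mu> e
        using D.has_finite_dim_gen_eigenspace[OF that(1), of e] T'' that by (auto simp: deflates_def)
      moreover have "op_trace (cblinfun_power T'' l) =
          op_trace (cblinfun_power T l) - of_nat (alg_multiplicity T \<alpha>) * \<alpha> ^ l" if "10 * M \<le> l" for l
        using T'' tr[OF that] that by (simp add: deflates_def mult algebra_simps)
      ultimately have "deflates M T {\<alpha>} T''"
        using T'' d' D.eigenvalue_T' unfolding deflates_def by auto
      then show ?thesis by blast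
    qed
  qed
  obtain \<mu> :: "nat \<Rightarrow> complex" where
    "\<And>j. 3 \<le> j \<Longrightarrow> ((\<lambda>i. \<mu> i ^ j) has_sum op_trace (poly_op (f ^ j) T)) UNIV"
    "(\<lambda>i. cmod (\<mu> i ^ 3)) summable_on UNIV"
    using eigenvalue_family_power[OF nuc, of f] by (metis f_def dvd_refl)
  from step[OF nuc this refl] show ?thesis .
qed

text \<open>One value at a time. The clause of \<open>deflates\<close> on values outside \<Lambda>
  carries the dimension found after earlier removals back to T, so the multiplicities in the trace
  formula are those of T.\<close>

lemma remove_eigenvalues:
  fixes T :: "'a::complex_banach \<Rightarrow>\<^sub>C\<^sub>L 'a"
  assumes M: "1 \<le> M" and nuc: "nuclear (cblinfun_power T M)" and "finite \<Lambda>" "0 \<notin> \<Lambda>"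
  shows "\<exists>T'. deflates M T \<Lambda> T'"
  using assms(3,4)
proof (induction \<Lambda> rule: finite_induct)
  case empty
  then show ?case using nuc by (auto simp: deflates_def intro!: exI[of _ T])
next
  case (insert \<alpha> \<Lambda>)
  then obtain T1 where T1: "deflates M T \<Lambda> T1" by auto
  have \<alpha>: "\<alpha> \<noteq> 0" using insert.prems by auto
  have "nuclear (cblinfun_power T1 M)" using T1 by (simp add: deflates_def)
  then obtain T2 where T2: "deflates M T1 {\<alpha>} T2"
    using remove_eigenvalue[OF M \<alpha>] by blast
  obtain d where d1: "has_finite_dim (gen_eigenspace T1 \<alpha>) d" using T2 by (auto simp: deflates_def)
  then have d: "has_finite_dim (gen_eigenspace T \<alpha>) d"
    using T1 \<alpha> insert.hyps by (auto simp: deflates_def)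
  have mult: "alg_multiplicity T1 \<alpha> = alg_multiplicity T \<alpha>"
    using dim_eq_of_has_finite_dim[OF d] dim_eq_of_has_finite_dim[OF d1] by (simp add: alg_multiplicity_eq)
  have 1: "\<not> eigenvalue T2 \<mu>" if "\<mu> \<in> insert \<alpha> \<Lambda>" for \<mu>
  proof -
    have "\<mu> \<noteq> 0" using that insert.prems by auto
    then have "eigenvalue T2 \<mu> \<Longrightarrow> eigenvalue T1 \<mu>" using T2 by (simp add: deflates_def)
    moreover have "\<mu> \<in> \<Lambda> \<Longrightarrow> \<not> eigenvalue T1 \<mu>" using T1 by (simp add: deflates_def)
    moreover have "\<not> eigenvalue T2 \<alpha>" using T2 by (simp add: deflates_def)
    ultimately show ?thesis using that by (cases "\<mu> = \<alpha>") auto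
  qed
  have 2: "\<exists>d. has_finite_dim (gen_eigenspace T \<mu>) d" if "\<mu> \<in> insert \<alpha> \<Lambda>" for \<mu>
    using that d T1 by (auto simp: deflates_def)
  have 3: "has_finite_dim (gen_eigenspace T \<mu>) e"
    if "\<mu> \<noteq> 0" "\<mu> \<notin> insert \<alpha> \<Lambda>" "has_finite_dim (gen_eigenspace T2 \<mu>) e" for \<mu> e
    using that T1 T2 by (auto simp: deflates_def)
  have 4: "op_trace (cblinfun_power T2 l) =
      op_trace (cblinfun_power T l) - (\<Sum>\<mu>\<in>insert \<alpha> \<Lambda>. of_nat (alg_multiplicity T \<mu>) * \<mu> ^ l)"
    if "10 * M \<le> l" for l
    using that T1 T2 insert.hyps by (simp add: deflates_def mult)
  have 5: "eigenvalue T \<mu>" if "\<mu> \<noteq> 0" "eigenvalue T2 \<mu>" for \<mu>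
    using that T1 T2 by (auto simp: deflates_def)
  have "deflates M T (insert \<alpha> \<Lambda>) T2"
    unfolding deflates_def using T2 1 2 3 4 5 by (auto simp: deflates_def)
  then show ?case by blast
qed


section \<open>The trace formula\<close>

lemma finite_poly_level: "poly f (0::complex) = 0 \<Longrightarrow> \<kappa> \<noteq> 0 \<Longrightarrow> finite {\<mu>. poly f \<mu> = \<kappa>}"
proof -
  assume "poly f 0 = 0" "\<kappa> \<noteq> 0"
  then have "poly (f - [:\<kappa>:]) 0 \<noteq> 0" by simp
  then have "f - [:\<kappa>:] \<noteq> 0" by auto
  then have "finite {\<mu>. poly (f - [:\<kappa>:]) \<mu> = 0}" by (rule poly_roots_finite)
  then show "finite {\<mu>. poly f \<mu> = \<kappa>}" by simp
qed

lemma poly_0_of_monom_dvd: "0 < n \<Longrightarrow> monom 1 n dvd f \<Longrightarrow> poly f (0::complex) = 0"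
  by (auto simp: dvd_def poly_monom)

text \<open>All eigenvalues in the fibre of f over \<kappa> are removed at once. With n their total
  multiplicity, the trace of f^j drops by n \<kappa>^j. Afterwards \<kappa> no longer occurs in the
  sequence: an eigenvector for it is annihilated by f - \<kappa>, which would give T' an eigenvalue
  in the fibre.\<close>

lemma card_eigenvalue_family:
  fixes T :: "'a::complex_banach \<Rightarrow>\<^sub>C\<^sub>L 'a" and \<mu> :: "nat \<Rightarrow> complex"
  assumes M: "1 \<le> M" and nuc: "nuclear (cblinfun_power T M)" and f: "monom 1 (10 * M) dvd f"
    and \<mu>: "\<And>j. 3 \<le> j \<Longrightarrow> ((\<lambda>i. \<mu> i ^ j) has_sum op_trace (poly_op (f ^ j) T)) UNIV"
      "(\<lambda>i. cmod (\<mu> i ^ 3)) summable_on UNIV"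
    and \<kappa>: "\<kappa> \<noteq> 0"
  shows "finite {i. \<mu> i = \<kappa>}"
    and "card {i. \<mu> i = \<kappa>} = (\<Sum>\<nu>\<in>{\<nu>. poly f \<nu> = \<kappa> \<and> eigenvalue T \<nu>}. alg_multiplicity T \<nu>)"
proof -
  have f0: "poly f 0 = 0" using poly_0_of_monom_dvd[OF _ f] M by simp
  define \<Lambda> where "\<Lambda> = {\<nu>. poly f \<nu> = \<kappa> \<and> eigenvalue T \<nu>}"
  have fin: "finite \<Lambda>"
    unfolding \<Lambda>_def by (rule finite_subset[OF _ finite_poly_level[OF f0 \<kappa>]]) auto
  have "0 \<notin> \<Lambda>" using f0 \<kappa> by (auto simp: \<Lambda>_def)
  then obtain T' where T': "deflates M T \<Lambda> T'"
    using remove_eigenvalues[OF M nuc fin] by blast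
  then have nuc': "nuclear (cblinfun_power T' M)" by (simp add: deflates_def)
  obtain \<nu> :: "nat \<Rightarrow> complex" where ev: "\<And>i. \<nu> i \<noteq> 0 \<Longrightarrow> eigenvalue (poly_op f T') (\<nu> i)"
    and \<nu>: "\<And>j. 3 \<le> j \<Longrightarrow> ((\<lambda>i. \<nu> i ^ j) has_sum op_trace (poly_op (f ^ j) T')) UNIV"
      "(\<lambda>i. cmod (\<nu> i ^ 3)) summable_on UNIV"
    by (rule eigenvalue_family_power[OF nuc' f]) (rule that)
  define n where "n = (\<Sum>\<nu>\<in>\<Lambda>. alg_multiplicity T \<nu>)"
  have "((\<lambda>i. \<nu> i ^ j) has_sum (op_trace (poly_op (f ^ j) T) - of_nat n * \<kappa> ^ j)) UNIV" if "3 \<le> j" for j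
  proof -
    have "monom 1 (10 * M) dvd f ^ j" using f that by (intro dvd_power_le[of _ _ 1, simplified] ) (auto simp: dvd_trans)
    then have "op_trace (poly_op (f ^ j) T') = op_trace (poly_op (f ^ j) T)
        - (\<Sum>\<nu>\<in>\<Lambda>. of_nat (alg_multiplicity T \<nu>) * poly (f ^ j) \<nu>)"
      using T' nuclear_power_large(2)[OF nuc order_refl] nuclear_power_large(2)[OF nuc' order_refl]
      by (intro op_trace_poly_diff) (auto simp: deflates_def)
    also have "(\<Sum>\<nu>\<in>\<Lambda>. of_nat (alg_multiplicity T \<nu>) * poly (f ^ j) \<nu>) = of_nat n * \<kappa> ^ j"
      by (simp add: n_def sum_distrib_right \<Lambda>_def)
    finally show ?thesis using \<nu>(1)[OF that] by simp
  qed
  note copies = power_sums_add_copies[OF \<mu>(2) \<nu>(2) \<mu>(1) this \<kappa>]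
  have "\<nu> i \<noteq> \<kappa>" for i
  proof
    assume "\<nu> i = \<kappa>"
    then obtain y where y: "y \<noteq> 0" "poly_op f T' y = \<kappa> *\<^sub>C y"
      using ev[of i] \<kappa> by (auto simp: Defs.eigenvalue_def)
    have "f - [:\<kappa>:] = f + Polynomial.smult (- 1) [:\<kappa>:]" by simp
    then have "poly_op (f - [:\<kappa>:]) T' = poly_op f T' + (- 1) *\<^sub>C (\<kappa> *\<^sub>C id_cblinfun + T' \<circ>\<^sub>L 0)"
      by (simp only: poly_op_add poly_op_smult poly_op_pCons poly_op_0)
    then have "poly_op (f - [:\<kappa>:]) T' y = 0"
      by (simp add: y cblinfun_rep_simps cblinfun_linear_simps scaleC_one)
    moreover have "f - [:\<kappa>:] \<noteq> 0"
    proof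
      assume "f - [:\<kappa>:] = 0"
      then have "poly (f - [:\<kappa>:]) 0 = 0" by simp
      then show False using f0 \<kappa> by simp
    qed
    ultimately obtain \<beta> where "poly (f - [:\<kappa>:]) \<beta> = 0" and ev\<beta>: "eigenvalue T' \<beta>"
      using eigenvalue_of_annihilating_poly[OF _ y(1)] by blast
    then have \<beta>: "poly f \<beta> = \<kappa>" "eigenvalue T' \<beta>" by simp_all
    then have "\<beta> \<noteq> 0" using f0 \<kappa> by auto
    then have "\<beta> \<in> \<Lambda>" using T' \<beta> by (auto simp: deflates_def \<Lambda>_def)
    then show False using T' \<beta>(2) by (auto simp: deflates_def)
  qed
  then have "{i. \<nu> i = \<kappa>} = {}" by blast
  then show "finite {i. \<mu> i = \<kappa>}"
    and "card {i. \<mu> i = \<kappa>} = (\<Sum>\<nu>\<in>{\<nu>. poly f \<nu> = \<kappa> \<and> eigenvalue T \<nu>}. alg_multiplicity T \<nu>)"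
    using copies by (simp_all add: n_def \<Lambda>_def)
qed

text \<open>Bijections between the finite fibres over nonzero values are glued together. Zero values
  may differ in number, but contribute nothing as l > 0.\<close>

lemma has_sum_power_transfer:
  fixes \<mu> :: "'i \<Rightarrow> complex" and \<nu> :: "'j \<Rightarrow> complex"
  assumes fin: "\<And>\<kappa>. \<kappa> \<noteq> 0 \<Longrightarrow> finite {i\<in>I. \<mu> i = \<kappa>}" "\<And>\<kappa>. \<kappa> \<noteq> 0 \<Longrightarrow> finite {j\<in>J. \<nu> j = \<kappa>}"
    and card: "\<And>\<kappa>. \<kappa> \<noteq> 0 \<Longrightarrow> card {i\<in>I. \<mu> i = \<kappa>} = card {j\<in>J. \<nu> j = \<kappa>}"
    and hs: "((\<lambda>i. \<mu> i ^ l) has_sum s) I" and l: "0 < l"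
  shows "((\<lambda>j. \<nu> j ^ l) has_sum s) J"
proof -
  have "\<exists>b. bij_betw b {i\<in>I. \<mu> i = \<kappa>} {j\<in>J. \<nu> j = \<kappa>}" if "\<kappa> \<noteq> 0" for \<kappa>
    using finite_same_card_bij[OF fin(1)[OF that] fin(2)[OF that] card[OF that]] by blast
  then obtain b where b: "\<And>\<kappa>. \<kappa> \<noteq> 0 \<Longrightarrow> bij_betw (b \<kappa>) {i\<in>I. \<mu> i = \<kappa>} {j\<in>J. \<nu> j = \<kappa>}"
    by metis
  define g where "g i = b (\<mu> i) i" for i
  define I' where "I' = {i\<in>I. \<mu> i \<noteq> 0}"
  define J' where "J' = {j\<in>J. \<nu> j \<noteq> 0}"
  have g: "g i \<in> J \<and> \<nu> (g i) = \<mu> i" if "i \<in> I'" for i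
    using bij_betwE[OF b[of "\<mu> i"]] that by (auto simp: g_def I'_def)
  have "bij_betw g I' J'"
    unfolding bij_betw_def
  proof (intro conjI inj_onI equalityI subsetI)
    fix i k assume ik: "i \<in> I'" "k \<in> I'" "g i = g k"
    then have "\<mu> i = \<mu> k" using g by metis
    then show "i = k"
      using ik bij_betw_imp_inj_on[OF b[of "\<mu> i"]] by (auto simp: g_def I'_def inj_on_def)
  next
    fix j assume "j \<in> g ` I'"
    then show "j \<in> J'" using g by (auto simp: J'_def I'_def)
  next
    fix j assume j: "j \<in> J'"
    then have "j \<in> b (\<nu> j) ` {i\<in>I. \<mu> i = \<nu> j}"
      using bij_betw_imp_surj_on[OF b[of "\<nu> j"]] by (auto simp: J'_def)
    then obtain i where i: "i \<in> I" "\<mu> i = \<nu> j" "j = b (\<nu> j) i" by auto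
    then have "j = g i" "i \<in> I'" using j by (auto simp: g_def I'_def J'_def)
    then show "j \<in> g ` I'" by blast
  qed
  then have "((\<lambda>i. \<nu> (g i) ^ l) has_sum s) I' \<longleftrightarrow> ((\<lambda>j. \<nu> j ^ l) has_sum s) J'"
    by (rule has_sum_reindex_bij_betw)
  moreover have "((\<lambda>i. \<nu> (g i) ^ l) has_sum s) I' \<longleftrightarrow> ((\<lambda>i. \<mu> i ^ l) has_sum s) I'"
    by (rule has_sum_cong) (simp add: g)
  moreover have "((\<lambda>i. \<mu> i ^ l) has_sum s) I' \<longleftrightarrow> ((\<lambda>i. \<mu> i ^ l) has_sum s) I"
    by (rule has_sum_cong_neutral) (use l in \<open>auto simp: I'_def\<close>)
  moreover have "((\<lambda>j. \<nu> j ^ l) has_sum s) J' \<longleftrightarrow> ((\<lambda>j. \<nu> j ^ l) has_sum s) J"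
    by (rule has_sum_cong_neutral) (use l in \<open>auto simp: J'_def\<close>)
  ultimately show ?thesis using hs by simp
qed

text \<open>Index set that repeats each nonzero eigenvalue according to its multiplicity;
  \<open>fst\<close> is the family of eigenvalues.\<close>

definition spectral_index :: "('a::complex_normed_vector \<Rightarrow>\<^sub>C\<^sub>L 'a) \<Rightarrow> (complex \<times> nat) set"
  where "spectral_index T = (SIGMA \<mu>:{\<mu>. \<mu> \<noteq> 0 \<and> eigenvalue T \<mu>}. {..<alg_multiplicity T \<mu>})"

text \<open>The values of f along \<open>spectral_index T\<close> and the limiting sequence of f(T)
  take each nonzero value equally often. Three is the least exponent at which the limit is
  controlled.\<close>

lemma trace_formula_cube:
  fixes T :: "'a::complex_banach \<Rightarrow>\<^sub>C\<^sub>L 'a"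
  assumes M: "1 \<le> M" and nuc: "nuclear (cblinfun_power T M)" and f: "monom 1 (10 * M) dvd f"
  shows "((\<lambda>j. poly f (fst j) ^ 3) has_sum op_trace (poly_op (f ^ 3) T)) (spectral_index T)"
proof -
  obtain \<mu> :: "nat \<Rightarrow> complex" where \<mu>:
    "\<And>j. 3 \<le> j \<Longrightarrow> ((\<lambda>i. \<mu> i ^ j) has_sum op_trace (poly_op (f ^ j) T)) UNIV"
    "(\<lambda>i. cmod (\<mu> i ^ 3)) summable_on UNIV"
    by (rule eigenvalue_family_power[OF nuc f]) (rule that)
  have f0: "poly f 0 = 0" using poly_0_of_monom_dvd[OF _ f] M by simp
  have fib: "{j \<in> spectral_index T. poly f (fst j) = \<kappa>}
      = (SIGMA \<nu>:{\<nu>. poly f \<nu> = \<kappa> \<and> eigenvalue T \<nu>}. {..<alg_multiplicity T \<nu>})" if "\<kappa> \<noteq> 0" for \<kappa>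
    using f0 that by (auto simp: spectral_index_def)
  have fin: "finite {\<nu>. poly f \<nu> = \<kappa> \<and> eigenvalue T \<nu>}" if "\<kappa> \<noteq> 0" for \<kappa>
    by (rule finite_subset[OF _ finite_poly_level[OF f0 that]]) auto
  note count = card_eigenvalue_family[OF M nuc f \<mu>]
  show ?thesis
  proof (rule has_sum_power_transfer[where I = UNIV and \<mu> = \<mu>])
    fix \<kappa> :: complex assume \<kappa>: "\<kappa> \<noteq> 0"
    show "finite {i \<in> UNIV. \<mu> i = \<kappa>}" using count(1)[OF _ \<kappa>] by simp
    show "finite {j \<in> spectral_index T. poly f (fst j) = \<kappa>}"
      unfolding fib[OF \<kappa>] using fin[OF \<kappa>] by (intro finite_SigmaI) auto
    show "card {i \<in> UNIV. \<mu> i = \<kappa>} = card {j \<in> spectral_index T. poly f (fst j) = \<kappa>}"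
      unfolding fib[OF \<kappa>] using count(2)[OF _ \<kappa>] fin[OF \<kappa>] by (simp add: card_SigmaI)
  qed (use \<mu>(1)[of 3] in auto)
qed

text \<open>Cubes suffice by polarisation: \<open>6 a\<^sup>2 b = (a + b)\<^sup>3 - (a - b)\<^sup>3 - 2 b\<^sup>3\<close>.\<close>

theorem trace_formula:
  fixes T :: "'a::complex_banach \<Rightarrow>\<^sub>C\<^sub>L 'a"
  assumes M: "1 \<le> M" and nuc: "nuclear (cblinfun_power T M)" and n: "30 * M \<le> n"
  shows "((\<lambda>j. fst j ^ n) has_sum op_trace (cblinfun_power T n)) (spectral_index T)"
proof -
  define L where "L = 10 * M"
  \<comment> \<open>a^2 b = X^n, and n \<ge> 30 M makes the degree of b at least 10 M as well, so a,
    b and their combinations are divisible by X^(10 M).\<close>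
  define a where "a = monom (1::complex) L"
  define b where "b = monom (1::complex) (n - 2 * L)"
  have T: "s_nuclear (1/3) (cblinfun_power T L)"
    unfolding L_def by (rule nuclear_power_large(2)[OF nuc order_refl])
  have dvd_b: "monom 1 L dvd b"
    unfolding b_def monom_altdef using n by (simp add: L_def le_imp_power_dvd)
  have dvd: "monom 1 (10 * M) dvd a + b" "monom 1 (10 * M) dvd a - b" "monom 1 (10 * M) dvd b"
    using dvd_b by (auto simp: a_def L_def)
  have cube: "monom 1 L dvd f ^ 3" if "monom 1 (10 * M) dvd f" for f :: "complex poly"
    using that by (simp add: L_def power3_eq_cube)
  have dvds: "monom 1 L dvd (a + b) ^ 3" "monom 1 L dvd (a - b) ^ 3" "monom 1 L dvd b ^ 3"
    using cube dvd by auto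
  have pol: "monom 1 n = Polynomial.smult (1/6) ((a + b) ^ 3
      + Polynomial.smult (- 1) ((a - b) ^ 3 + Polynomial.smult 2 (b ^ 3)))"
  proof -
    have "monom 1 n = a\<^sup>2 * b"
      using n by (simp add: a_def b_def L_def monom_power mult_monom)
    moreover have "(a + b) ^ 3 + Polynomial.smult (- 1) ((a - b) ^ 3 + Polynomial.smult 2 (b ^ 3)) = Polynomial.smult 6 (a\<^sup>2 * b)"
    proof -
      have smult_2: "Polynomial.smult 2 p = p + p" for p :: "complex poly"
        using smult_add_left[of 1 1 p] by simp
      have smult_6: "Polynomial.smult 6 p = p + p + p + p + p + p" for p :: "complex poly"
        by (intro poly_eqI, simp only: coeff_smult coeff_add) simp
      show ?thesis
        unfolding smult_2 smult_6 by (simp add: power3_eq_cube power2_eq_square algebra_simps)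
    qed
    ultimately show ?thesis by simp
  qed
  have tr: "op_trace (cblinfun_power T n) = 1/6 * (op_trace (poly_op ((a + b) ^ 3) T)
      + - 1 * (op_trace (poly_op ((a - b) ^ 3) T) + 2 * op_trace (poly_op (b ^ 3) T)))"
  proof -
    note lin = op_trace_poly_linear[OF T]
    have "op_trace (cblinfun_power T n) = op_trace (poly_op (monom 1 n) T)"
      by (simp add: poly_op_monom scaleC_one)
    then show ?thesis
      unfolding pol using dvds by (simp only: lin dvd_add dvd_smult)
  qed
  have "((\<lambda>j. 1/6 * (poly (a + b) (fst j) ^ 3 + - 1 * (poly (a - b) (fst j) ^ 3 + 2 * poly b (fst j) ^ 3)))
      has_sum op_trace (cblinfun_power T n)) (spectral_index T)"
    unfolding tr by (intro has_sum_cmult_right has_sum_add trace_formula_cube[OF M nuc] dvd)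
  moreover have "1/6 * (poly (a + b) z ^ 3 + - 1 * (poly (a - b) z ^ 3 + 2 * poly b z ^ 3)) = z ^ n" for z
    using arg_cong[OF pol, of "\<lambda>p. poly p z"] by (simp add: poly_monom)
  ultimately show ?thesis by simp
qed


section \<open>Spectral symmetry\<close>

lemma finite_dim_gen_eigenspace:
  fixes T :: "'a::complex_banach \<Rightarrow>\<^sub>C\<^sub>L 'a"
  assumes "1 \<le> M" "nuclear (cblinfun_power T M)" "\<mu> \<noteq> 0"
  shows "\<exists>d. has_finite_dim (gen_eigenspace T \<mu>) d"
  using remove_eigenvalue[OF assms(1,3,2)] by (auto simp: deflates_def)

lemma card_spectral_index:
  fixes T :: "'a::complex_banach \<Rightarrow>\<^sub>C\<^sub>L 'a"
  assumes "1 \<le> M" "nuclear (cblinfun_power T M)" "\<mu> \<noteq> 0"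
  shows "card {j \<in> spectral_index T. fst j = \<mu>} = alg_multiplicity T \<mu>"
proof (cases "eigenvalue T \<mu>")
  case True
  then have "{j \<in> spectral_index T. fst j = \<mu>} = {\<mu>} \<times> {..<alg_multiplicity T \<mu>}"
    using assms(3) by (auto simp: spectral_index_def)
  then show ?thesis by (simp add: card_cartesian_product)
next
  case False
  then have "{j \<in> spectral_index T. fst j = \<mu>} = {}" by (auto simp: spectral_index_def)
  then have "card {j \<in> spectral_index T. fst j = \<mu>} = 0" by (simp only: card.empty)
  moreover have "alg_multiplicity T \<mu> = 0"
    using False finite_dim_gen_eigenspace[OF assms] eigenvalue_iff_alg_multiplicity by blast
  ultimately show ?thesis by simp
qed

lemma op_trace_power_eq_0_of_symmetric:
  fixes T :: "'a::complex_banach \<Rightarrow>\<^sub>C\<^sub>L 'a"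
  assumes M: "1 \<le> M" and nuc: "nuclear (cblinfun_power T M)" and n: "30 * M \<le> n"
    and sym: "Zd_symmetric_spectrum d T" and d: "0 < d" and nd: "\<not> d dvd n"
  shows "op_trace (cblinfun_power T n) = 0"
proof -
  define w where "w = cis (2 * pi / real d)"
  have wpow: "w ^ k = cis (2 * pi * real k / real d)" for k
    unfolding w_def Complex.DeMoivre by (simp add: mult.commute)
  have wd: "w ^ d = 1" using d by (simp add: wpow)
  have w0: "w \<noteq> 0" by (simp add: w_def)
  have wn: "w ^ n \<noteq> 1"
  proof
    assume "w ^ n = 1"
    then have "cis (2 * pi * real n / real d) = 1" by (simp add: wpow)
    then have "cos (2 * pi * real n / real d) = 1" by (simp add: complex_eq_iff)
    then obtain k :: int where "2 * pi * real n / real d = of_int k * 2 * pi"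
      using cos_one_2pi_int by blast
    then have "real n = real_of_int k * real d" using d by (simp add: field_simps)
    then have "int n = k * int d" by (metis of_int_eq_iff of_int_mult of_int_of_nat_eq)
    then show False using nd by (metis dvd_triv_right int_dvd_int_iff)
  qed
  have rot: "(w * \<mu>, i) \<in> spectral_index T" if "(\<mu>, i) \<in> spectral_index T" for \<mu> i
    using that sym wd w0 by (auto simp: spectral_index_def Zd_symmetric_spectrum_def)
  have rotinv: "(inverse w * \<mu>, i) \<in> spectral_index T" if "(\<mu>, i) \<in> spectral_index T" for \<mu> i
  proof -
    have "inverse w ^ d = 1" using wd by (simp add: power_inverse)
    then show ?thesis
      using that sym w0 by (auto simp: spectral_index_def Zd_symmetric_spectrum_def)
  qed
  have bij: "bij_betw (\<lambda>(\<mu>, i). (w * \<mu>, i)) (spectral_index T) (spectral_index T)"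
  proof (rule bij_betw_byWitness[where f' = "\<lambda>(\<mu>, i). (inverse w * \<mu>, i)"])
  qed (use w0 rot rotinv in auto)
  let ?p = "op_trace (cblinfun_power T n)"
  have hs: "((\<lambda>j. fst j ^ n) has_sum ?p) (spectral_index T)" by (rule trace_formula[OF M nuc n])
  have "((\<lambda>j. fst (case j of (\<mu>, i) \<Rightarrow> (w * \<mu>, i)) ^ n) has_sum ?p) (spectral_index T)"
    using has_sum_reindex_bij_betw[OF bij, of "\<lambda>j. fst j ^ n" ?p] hs by simp
  then have "((\<lambda>j. w ^ n * fst j ^ n) has_sum ?p) (spectral_index T)"
    by (simp add: case_prod_unfold power_mult_distrib)
  then have "?p = w ^ n * ?p"
    using has_sum_unique has_sum_cmult_right[OF hs, of "w ^ n"] by blast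
  then show ?thesis using wn by (metis mult_cancel_right1)
qed

lemma symmetric_of_op_trace_power_eq_0:
  fixes T :: "'a::complex_banach \<Rightarrow>\<^sub>C\<^sub>L 'a"
  assumes M: "1 \<le> M" and nuc: "nuclear (cblinfun_power T M)"
    and d: "0 < d" and tr: "\<And>n. L \<le> n \<Longrightarrow> \<not> d dvd n \<Longrightarrow> op_trace (cblinfun_power T n) = 0"
  shows "Zd_symmetric_spectrum d T"
  unfolding Zd_symmetric_spectrum_def
proof (intro allI impI, elim conjE)
  fix \<mu> t :: complex assume \<mu>: "\<mu> \<noteq> 0" "eigenvalue T \<mu>" and t: "t ^ d = 1"
  define J where "J = spectral_index T"
  define N where "N = max L (30 * M)"
  have t0: "t \<noteq> 0" using t d by (auto simp: power_0_left)
  show "eigenvalue T (t * \<mu>) \<and> alg_multiplicity T (t * \<mu>) = alg_multiplicity T \<mu>"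
  proof -
    have hs: "((\<lambda>j. fst j ^ n) has_sum op_trace (cblinfun_power T n)) J" if "N \<le> n" for n
      unfolding J_def using that by (intro trace_formula[OF M nuc]) (simp add: N_def)
    \<comment> \<open>The factor t^n is 1 at multiples of d and meets a zero trace
      elsewhere.\<close>
    have hst: "((\<lambda>j. (t * fst j) ^ n) has_sum op_trace (cblinfun_power T n)) J" if "N \<le> n" for n
    proof -
      have "((\<lambda>j. t ^ n * fst j ^ n) has_sum t ^ n * op_trace (cblinfun_power T n)) J"
        by (rule has_sum_cmult_right[OF hs[OF that]])
      moreover have "t ^ n * op_trace (cblinfun_power T n) = op_trace (cblinfun_power T n)"
      proof (cases "d dvd n")
        case True
        then have "t ^ n = 1" using t by (auto simp: dvd_def power_mult)
        then show ?thesis by simp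
      next
        case False
        then show ?thesis using tr[of n] that by (simp add: N_def)
      qed
      ultimately show ?thesis by (simp add: power_mult_distrib)
    qed
    \<comment> \<open>Unconditional summability of complex numbers is absolute summability.\<close>
    have sm: "(\<lambda>j. cmod (fst j ^ N)) summable_on J" "(\<lambda>j. cmod ((t * fst j) ^ N)) summable_on J"
      using hs[of N] hst[of N] by (auto simp: summable_on_iff_abs_summable_on_complex[symmetric] summable_on_def)
    have "t * \<mu> \<noteq> 0" using \<mu>(1) t0 by simp
    have "alg_multiplicity T (t * \<mu>) = card {j \<in> J. fst j = t * \<mu>}"
      unfolding J_def using card_spectral_index[OF M nuc \<open>t * \<mu> \<noteq> 0\<close>] by simp
    also have "\<dots> = card {j \<in> J. t * fst j = t * \<mu>}"
      by (rule power_sums_determine_multiplicities(2)[OF sm hs hst \<open>t * \<mu> \<noteq> 0\<close>])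
    also have "\<dots> = card {j \<in> J. fst j = \<mu>}" using t0 by simp
    also have "\<dots> = alg_multiplicity T \<mu>"
      unfolding J_def by (rule card_spectral_index[OF M nuc \<mu>(1)])
    finally have eq: "alg_multiplicity T (t * \<mu>) = alg_multiplicity T \<mu>" .
    obtain e where "has_finite_dim (gen_eigenspace T \<mu>) e"
      using finite_dim_gen_eigenspace[OF M nuc \<mu>(1)] by blast
    moreover obtain e' where "has_finite_dim (gen_eigenspace T (t * \<mu>)) e'"
      using finite_dim_gen_eigenspace[OF M nuc \<open>t * \<mu> \<noteq> 0\<close>] by blast
    ultimately show ?thesis using eq \<mu>(2) eigenvalue_iff_alg_multiplicity by metis
  qed
qed

theorem theorem4:
  fixes T :: "'a::complex_banach \<Rightarrow>\<^sub>C\<^sub>L 'a" and d M :: nat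
  assumes "d \<ge> 2"
    and "M \<ge> 1" and "nuclear (cblinfun_power T M)"
  shows "Zd_symmetric_spectrum d T \<longleftrightarrow>
    (\<exists>K :: nat.
      (\<forall>l > K * d. trace_well_defined (cblinfun_power T l)) \<and>
      (\<forall>k \<ge> K. \<forall>r \<in> {1..d - 1}. op_trace (cblinfun_power T (k * d + r)) = 0))"
proof
  assume sym: "Zd_symmetric_spectrum d T"
  \<comment> \<open>As d is positive, every exponent from K d on lies in the range of the trace
    formula.\<close>
  let ?K = "30 * M"
  have big: "?K \<le> l" if "?K * d \<le> l" for l
    using mult_le_mono2[of 1 d ?K] that assms(1) by linarith
  have "trace_well_defined (cblinfun_power T l)" if "?K * d < l" for l
    unfolding trace_well_defined_def
    using nuclear_power_large(2)[OF assms(3), of l] big[of l] that approx_property_third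
    by (intro exI[of _ "1/3"]) auto
  moreover have "op_trace (cblinfun_power T (k * d + r)) = 0" if "?K \<le> k" "r \<in> {1..d - 1}" for k r
  proof (rule op_trace_power_eq_0_of_symmetric[OF assms(2,3) _ sym])
    have "?K * d \<le> k * d" using that(1) by (rule mult_le_mono1)
    then show "30 * M \<le> k * d + r" by (intro big) linarith
    show "0 < d" using assms(1) by simp
    show "\<not> d dvd k * d + r"
      using that by (auto simp: dvd_add_right_iff dest: dvd_imp_le)
  qed
  ultimately show "\<exists>K :: nat. (\<forall>l > K * d. trace_well_defined (cblinfun_power T l)) \<and>
      (\<forall>k \<ge> K. \<forall>r \<in> {1..d - 1}. op_trace (cblinfun_power T (k * d + r)) = 0)"
    by blast
next
  assume "\<exists>K :: nat. (\<forall>l > K * d. trace_well_defined (cblinfun_power T l)) \<and>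
      (\<forall>k \<ge> K. \<forall>r \<in> {1..d - 1}. op_trace (cblinfun_power T (k * d + r)) = 0)"
  then obtain K where K: "\<And>k r. K \<le> k \<Longrightarrow> r \<in> {1..d - 1} \<Longrightarrow> op_trace (cblinfun_power T (k * d + r)) = 0"
    by blast
  show "Zd_symmetric_spectrum d T"
  proof (rule symmetric_of_op_trace_power_eq_0[OF assms(2,3), of d "K * d"])
    show "0 < d" using assms(1) by simp
    fix n assume n: "K * d \<le> n" "\<not> d dvd n"
    \<comment> \<open>Division with remainder brings n into the form k d + r with r between 1 and d
      - 1.\<close>
    have "K \<le> n div d" using n(1) assms(1) by (simp add: less_eq_div_iff_mult_less_eq)
    moreover have "n mod d \<in> {1..d - 1}"
    proof -
      have "n mod d < d" "n mod d \<noteq> 0" using n(2) assms(1) by (auto simp: dvd_eq_mod_eq_0)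
      then show ?thesis unfolding atLeastAtMost_iff by linarith
    qed
    ultimately have "op_trace (cblinfun_power T (n div d * d + n mod d)) = 0" by (rule K)
    then show "op_trace (cblinfun_power T n) = 0" by simp
  qed
qed

end
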